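(* Let $R$ be a Dedekind domain containing $\mathbb{Q}$ with field of fractions $K$, and let $B:=R[X,Y,Z]$ be the polynomial ring in three variables over $R$. Let $D$ be an irreducible locally nilpotent $R$-derivation of $B$ with $D^{2}X=D^{2}Y=0$, let $\overline{D}$ denote the extension of $D$ to $K[X,Y,Z]$, and let $A:=\operatorname{Ker} D$. Suppose that there exists a coordinate system $(L_1,L_2,Z)$ of $K[X,Y,Z]$, where $L_1$ and $L_2$ are linear forms in $X$ and $Y$ (with coefficients in $K$), such that $\overline{D}L_1=0$, $\overline{D}L_2\in K[L_1]$ and $\overline{D}Z\in K[L_1,L_2]=K[X,Y]$. Then the following hold: (i) $A$ is generated by at most $3$ elements (as an $R$-algebra). (ii) Moreover, if $D$ is fixed-point free, then $\operatorname{rank} D<3$ and $D$ has a slice. In particular, $\operatorname{rank} D=1$.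
   Context: A coordinate system of a polynomial ring $B=R^{[n]}$ in $n$ variables over $R$ is an $n$-tuple $(T_1,\dots,T_n)$ of elements of $B$ with $B=R[T_1,\dots,T_n]$. An $R$-derivation $D$ of $B$ is locally nilpotent if for each $b\in B$ there is $n$ with $D^n b=0$. $D$ is reducible if there is a non-unit $b\in B$ with $DB\subseteq bB$, and irreducible otherwise. $D$ is fixed-point free if the ideal of $B$ generated by $DB$ is $B$. A slice of $D$ is an element $s\in B$ with $Ds=1$. For a locally nilpotent $R$-derivation $D$ of $B=R^{[n]}$ with kernel $A$, $\operatorname{rank} D$ is the least integer $i$ for which there is a coordinate system $(X_1,\dots,X_n)$ of $B$ with $R[X_{i+1},\dots,X_n]\subseteq A$. *)

theory Defs
  imports "HOL-Computational_Algebra.Computational_Algebra"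
begin

(* Ideals of a commutative ring are its submodules as a module over itself:
   ideal.subspace I says that I is an ideal, ideal.span S is the ideal generated by S. *)
interpretation ideal: module "(*) :: 'a::comm_ring_1 \<Rightarrow> 'a \<Rightarrow> 'a"
  by unfold_locales (simp_all add: algebra_simps)

definition prime_ideal :: "'a::comm_ring_1 set \<Rightarrow> bool" where
  "prime_ideal P \<longleftrightarrow> ideal.subspace P \<and> P \<noteq> UNIV \<and>
     (\<forall>a b. a * b \<in> P \<longrightarrow> a \<in> P \<or> b \<in> P)"

definition maximal_ideal :: "'a::comm_ring_1 set \<Rightarrow> bool" where
  "maximal_ideal M \<longleftrightarrow> ideal.subspace M \<and> M \<noteq> UNIV \<and>
     (\<forall>I. ideal.subspace I \<and> M \<subseteq> I \<longrightarrow> I = M \<or> I = UNIV)"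

definition noetherian :: "'a::comm_ring_1 itself \<Rightarrow> bool" where
  "noetherian _ \<longleftrightarrow>
     (\<forall>I :: 'a set. ideal.subspace I \<longrightarrow> (\<exists>S. finite S \<and> I = ideal.span S))"

definition integral_over_base :: "'a::idom fract \<Rightarrow> bool" where
  "integral_over_base x \<longleftrightarrow>
     (\<exists>p :: 'a poly. lead_coeff p = 1 \<and> poly (map_poly to_fract p) x = 0)"

definition integrally_closed :: "'a::idom itself \<Rightarrow> bool" where
  "integrally_closed _ \<longleftrightarrow>
     (\<forall>x :: 'a fract. integral_over_base x \<longrightarrow> x \<in> range to_fract)"

(* Convention: fields count as Dedekind domains. *)
definition dedekind_domain :: "'a::idom itself \<Rightarrow> bool" where
  "dedekind_domain T \<longleftrightarrow> noetherian T \<and> integrally_closed T \<and>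
     (\<forall>P :: 'a set. prime_ideal P \<and> P \<noteq> {0} \<longrightarrow> maximal_ideal P)"

definition contains_rationals :: "'a::comm_ring_1 itself \<Rightarrow> bool" where
  "contains_rationals _ \<longleftrightarrow>
     (\<exists>\<phi> :: rat \<Rightarrow> 'a. inj \<phi> \<and> \<phi> 1 = 1 \<and>
        (\<forall>x y. \<phi> (x + y) = \<phi> x + \<phi> y) \<and> (\<forall>x y. \<phi> (x * y) = \<phi> x * \<phi> y))"

(* In what follows an R-algebra B is given by its structure homomorphism \<iota> from R to B.
   adjoin \<iota> S is the R-subalgebra R[S] of B. *)
inductive_set adjoin :: "('r::comm_ring_1 \<Rightarrow> 'b::comm_ring_1) \<Rightarrow> 'b set \<Rightarrow> 'b set"
  for \<iota> :: "'r \<Rightarrow> 'b" and S :: "'b set" where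
  const: "\<iota> r \<in> adjoin \<iota> S"
| gen: "s \<in> S \<Longrightarrow> s \<in> adjoin \<iota> S"
| add: "a \<in> adjoin \<iota> S \<Longrightarrow> b \<in> adjoin \<iota> S \<Longrightarrow> a + b \<in> adjoin \<iota> S"
| mult: "a \<in> adjoin \<iota> S \<Longrightarrow> b \<in> adjoin \<iota> S \<Longrightarrow> a * b \<in> adjoin \<iota> S"

(* Meaningful when B is a polynomial ring in n variables over R. *)
definition coordinate_system ::
    "('r::comm_ring_1 \<Rightarrow> 'b::comm_ring_1) \<Rightarrow> nat \<Rightarrow> 'b list \<Rightarrow> bool" where
  "coordinate_system \<iota> n Ts \<longleftrightarrow> length Ts = n \<and> adjoin \<iota> (set Ts) = UNIV"

definition derivation ::
    "('r::comm_ring_1 \<Rightarrow> 'b::comm_ring_1) \<Rightarrow> ('b \<Rightarrow> 'b) \<Rightarrow> bool" where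
  "derivation \<iota> D \<longleftrightarrow>
     (\<forall>f g. D (f + g) = D f + D g) \<and>
     (\<forall>r f. D (\<iota> r * f) = \<iota> r * D f) \<and>
     (\<forall>f g. D (f * g) = f * D g + g * D f)"

definition locally_nilpotent :: "('b::zero \<Rightarrow> 'b) \<Rightarrow> bool" where
  "locally_nilpotent D \<longleftrightarrow> (\<forall>b. \<exists>n. (D ^^ n) b = 0)"

definition reducible_derivation :: "('b::comm_ring_1 \<Rightarrow> 'b) \<Rightarrow> bool" where
  "reducible_derivation D \<longleftrightarrow> (\<exists>b. \<not> b dvd 1 \<and> range D \<subseteq> range (\<lambda>x. b * x))"

definition fixed_point_free :: "('b::comm_ring_1 \<Rightarrow> 'b) \<Rightarrow> bool" where
  "fixed_point_free D \<longleftrightarrow> ideal.span (range D) = UNIV"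

definition slice :: "('b::comm_ring_1 \<Rightarrow> 'b) \<Rightarrow> 'b \<Rightarrow> bool" where
  "slice D s \<longleftrightarrow> D s = 1"

definition Ker :: "('b::zero \<Rightarrow> 'b) \<Rightarrow> 'b set" where
  "Ker D = {b. D b = 0}"

(* drop i [X_1, ..., X_n] is the list [X_(i+1), ..., X_n]. *)
definition rank_derivation ::
    "('r::comm_ring_1 \<Rightarrow> 'b::comm_ring_1) \<Rightarrow> nat \<Rightarrow> ('b \<Rightarrow> 'b) \<Rightarrow> nat" where
  "rank_derivation \<iota> n D =
     (LEAST i. \<exists>Xs. coordinate_system \<iota> n Xs \<and> adjoin \<iota> (set (drop i Xs)) \<subseteq> Ker D)"

(* R[X,Y,Z] is the iterated polynomial ring R[X][Y][Z]. *)
type_synonym 'a poly3 = "'a poly poly poly"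

definition const3 :: "'a::comm_ring_1 \<Rightarrow> 'a poly3" where
  "const3 r = [:[:[:r:]:]:]"

definition var_X :: "'a::comm_ring_1 poly3" where
  "var_X = [:[:[:0, 1:]:]:]"

definition var_Y :: "'a::comm_ring_1 poly3" where
  "var_Y = [:[:0, 1:]:]"

definition var_Z :: "'a::comm_ring_1 poly3" where
  "var_Z = [:0, 1:]"

definition fract_poly3 :: "'a::idom poly3 \<Rightarrow> 'a fract poly3" where
  "fract_poly3 = map_poly (map_poly (map_poly to_fract))"

(* There is exactly one such extension E for each R-derivation D. *)
definition extends_derivation ::
    "('a::idom poly3 \<Rightarrow> 'a poly3) \<Rightarrow> ('a fract poly3 \<Rightarrow> 'a fract poly3) \<Rightarrow> bool" where
  "extends_derivation D E \<longleftrightarrow>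
     derivation const3 E \<and> (\<forall>f. E (fract_poly3 f) = fract_poly3 (D f))"

definition linear_form_XY :: "'k::comm_ring_1 poly3 \<Rightarrow> bool" where
  "linear_form_XY L \<longleftrightarrow> (\<exists>a b. L = const3 a * var_X + const3 b * var_Y)"

end

theory Submission
  imports Defs
begin

text \<open>
  Let K be the fraction field of R. After scaling, L1 = a X + b Y with coefficients in R.
  The ideal (a, b) is invertible, so there are x, y in K with a x + b y = 1 and
  a x, a y, b x, b y in R. In the coordinates U = a X + b Y, V = x Y - y X, Z the
  derivation is triangular, \<open>f(U) \<partial>\<^sub>V + g(U, V) \<partial>\<^sub>Z\<close>, and
  R X + R Y = J U \<oplus> J' V with the mutually inverse fractional ideals J = (x, y) and J' = (a, b).
  If f = 0, irreducibility makes D Z a unit and everything is immediate; let f \<noteq> 0.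

  Kernel over K. Let h be a common factor of f and the coefficients of g of largest degree,
  f = h \<phi> and g = h \<partial>\<Gamma>/\<partial>V. Then W = \<phi> Z - \<Gamma> is a kernel element. Comparing leading
  coefficients in Z shows that a nonzero polynomial in U multiplies any given kernel element into
  K[U, W]. It can be cancelled one prime factor \<pi> at a time: modulo \<pi> the element W is not
  constant, hence transcendental over K[U]/(\<pi>) (\<open>eval_in_poly_ideal\<close>), so \<pi> divides a polynomial
  in W only if it divides all its coefficients. Thus the kernel over K is K[U, W] (\<open>tri_kernel_field\<close>).

  Kernel over R. With a maximal ideal M of R in place of \<pi>, the same fact shows that the
  localised kernel is \<open>R\<^sub>M[u U, q W]\<close>, where u and q generate at M the fractional ideals
  {c. c U \<in> B} and {c. c W \<in> B} (\<open>local_generation\<close>). Globally, the kernel is generated by a module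
  J U \<oplus> I W with I a fractional ideal, and over a Dedekind domain such a module needs at most three
  generators (\<open>dedekind_three_generators\<close>).

  Slices. Where t = a x or t = b y is inverted, J and J' become free, and B becomes a
  polynomial ring in \<open>\<ell>\<^sub>1 = u U\<close>, \<open>\<ell>\<^sub>2 = v V\<close>, Z. Let \<open>C = R[\<ell>\<^sub>1]\<close> and let f, g now be the
  values of the derivation at \<open>\<ell>\<^sub>2\<close> and Z. If D is fixed-point free, f and g generate the unit
  ideal up to a power of t. Modulo a prime of C containing f, the unit g is constant, so its
  antiderivative is a unit multiple of \<open>\<ell>\<^sub>2\<close>; a Zorn argument on the ideals of C promotes this to
  \<open>\<ell>\<^sub>2 \<in> C[\<Gamma>] + f C[\<ell>\<^sub>2]\<close>. Since W = f Z - \<Gamma>, some polynomial Q satisfies \<open>\<ell>\<^sub>2 = Q(W) + f s\<close>,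
  and applying D gives D s = 1 (\<open>tri_slice\<close>). The values in R of D form an ideal containing
  powers of a x and of b y, hence 1.

  Rank. In the fixed-point free case h = 1 and I = J', and J \<oplus> J' is free because it is
  isomorphic to R X + R Y: the kernel is R[x U - b W, y U + a W] (\<open>kernel_coordinates\<close>). Together with
  a slice these two elements are coordinates of B, so the rank is 1.
\<close>

section \<open>Ideals\<close>

text \<open>As a rewrite rule, associativity from right to left would make \<open>algebra_simps\<close> loop.\<close>

declare ideal.scale_scale [simp del]

lemma subspace_iff:
  "ideal.subspace I \<longleftrightarrow> 0 \<in> I \<and> (\<forall>x\<in>I. \<forall>y\<in>I. x + y \<in> I) \<and> (\<forall>c. \<forall>x\<in>I. c * x \<in> I)"
  by (auto simp: ideal.subspace_def)

lemma ideal_eq_UNIV_iff: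
  assumes "ideal.subspace I"
  shows "I = UNIV \<longleftrightarrow> 1 \<in> I"
  using ideal.subspace_scale[OF assms, of 1] by auto

lemma ideal_dvd_closed:
  assumes "ideal.subspace I" "a \<in> I" "a dvd b"
  shows "b \<in> I"
  using assms by (auto elim!: dvdE simp: mult.commute[of a] intro: ideal.subspace_scale)

lemma ideal_sum_subspace:
  assumes "ideal.subspace I" "ideal.subspace J"
  shows "ideal.subspace {x + y | x y. x \<in> I \<and> y \<in> J}"
proof -
  have "ideal.span (I \<union> J) = {x + y | x y. x \<in> I \<and> y \<in> J}"
    using assms by (simp add: ideal.span_Un ideal.span_eq_iff[THEN iffD2])
  then show ?thesis by (metis ideal.subspace_span)
qed

lemma ideal_add_principal:
  assumes "ideal.subspace I"
  shows "ideal.subspace {i + r * a | i r. i \<in> I}" (is "ideal.subspace ?J")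
    and "I \<subseteq> {i + r * a | i r. i \<in> I}" and "a \<in> {i + r * a | i r. i \<in> I}"
proof -
  have "?J = {x + y | x y. x \<in> I \<and> y \<in> ideal.span {a}}"
    by (auto simp: ideal.span_singleton)
  then show "ideal.subspace ?J"
    by (simp add: ideal_sum_subspace[OF assms ideal.subspace_span])
  show "I \<subseteq> ?J"
  proof
    fix i assume "i \<in> I"
    moreover have "i = i + 0 * a" by simp
    ultimately show "i \<in> ?J" by blast
  qed
  have "a = 0 + 1 * a" by simp
  then show "a \<in> ?J" using ideal.subspace_0[OF assms] by blast
qed

lemma ideal_fraction_subspace:
  fixes I :: "'a::idom set"
  assumes I: "ideal.subspace I"
  shows "ideal.subspace {s. \<exists>m\<in>I. c * s = e * m}"
  unfolding subspace_iff
proof (intro conjI ballI allI)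
  let ?T = "{s. \<exists>m\<in>I. c * s = e * m}"
  show "0 \<in> ?T" using ideal.subspace_0[OF I] by force
  fix x k assume "x \<in> ?T"
  then obtain m where m: "m \<in> I" "c * x = e * m" by blast
  then have "c * (k * x) = e * (k * m)" by (simp add: mult.left_commute)
  then show "k * x \<in> ?T" using ideal.subspace_scale[OF I m(1)] by blast
  fix y assume "y \<in> ?T"
  then obtain m' where m': "m' \<in> I" "c * y = e * m'" by blast
  then have "c * (x + y) = e * (m + m')" using m by (simp add: distrib_left)
  then show "x + y \<in> ?T" using ideal.subspace_add[OF I m(1) m'(1)] by blast
qed

lemma ideal_chain_Union:
  assumes "\<And>I. I \<in> C \<Longrightarrow> ideal.subspace I" "subset.chain \<A> C" "C \<noteq> {}"
  shows "ideal.subspace (\<Union>C)"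
  unfolding subspace_iff
proof (intro conjI ballI allI)
  show "0 \<in> \<Union>C" using assms(1,3) ideal.subspace_0 by blast
next
  fix x y assume "x \<in> \<Union>C" "y \<in> \<Union>C"
  then obtain I J where IJ: "I \<in> C" "J \<in> C" "x \<in> I" "y \<in> J" by auto
  then have "I \<subseteq> J \<or> J \<subseteq> I" using assms(2) by (auto simp: subset_chain_def)
  then show "x + y \<in> \<Union>C"
    using IJ assms(1) by (meson UnionI ideal.subspace_add in_mono)
next
  fix c x assume "x \<in> \<Union>C"
  then show "c * x \<in> \<Union>C" using assms(1) ideal.subspace_scale by blast
qed

lemma noetherian_maximal_element:
  fixes \<A> :: "'a::comm_ring_1 set set"
  assumes "noetherian TYPE('a)" "\<A> \<noteq> {}" "\<And>I. I \<in> \<A> \<Longrightarrow> ideal.subspace I"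
  shows "\<exists>M\<in>\<A>. \<forall>I\<in>\<A>. M \<subseteq> I \<longrightarrow> I = M"
proof (rule subset_Zorn_nonempty[OF assms(2)])
  fix C assume C: "C \<noteq> {}" "subset.chain \<A> C"
  then have CA: "C \<subseteq> \<A>" by (auto simp: subset_chain_def)
  have "ideal.subspace (\<Union>C)"
    using ideal_chain_Union[OF _ C(2,1)] CA assms(3) by blast
  then obtain S where S: "finite S" "\<Union>C = ideal.span S"
    using assms(1) unfolding noetherian_def by metis
  then have "S \<subseteq> \<Union>C" using ideal.span_superset by blast
  then obtain X where X: "X \<in> C" "S \<subseteq> X"
    using finite_subset_Union_chain[OF S(1) _ C(1,2)] by blast
  have "ideal.span S \<subseteq> X"
    using X CA assms(3) by (intro ideal.span_minimal) auto
  then have "\<Union>C = X" using S X by auto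
  then show "\<Union>C \<in> \<A>" using X CA by auto
qed

lemma proper_ideal_in_maximal:
  fixes I :: "'a::comm_ring_1 set"
  assumes "noetherian TYPE('a)" "ideal.subspace I" "I \<noteq> UNIV"
  obtains M where "maximal_ideal M" "I \<subseteq> M"
proof -
  let ?A = "{J. ideal.subspace J \<and> J \<noteq> UNIV \<and> I \<subseteq> J}"
  have ne: "?A \<noteq> {}" using assms by auto
  obtain M where M: "M \<in> ?A" "\<And>J. J \<in> ?A \<Longrightarrow> M \<subseteq> J \<Longrightarrow> J = M"
    using noetherian_maximal_element[OF assms(1) ne] by auto
  have "maximal_ideal M" unfolding maximal_ideal_def
    using M by (auto; blast)
  then show ?thesis using that M by auto
qed

lemma ideal_eq_UNIV_if_no_maximal:
  fixes I :: "'a::comm_ring_1 set"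
  assumes "noetherian TYPE('a)" "ideal.subspace I"
    and "\<And>M. maximal_ideal M \<Longrightarrow> \<exists>r\<in>I. r \<notin> M"
  shows "1 \<in> I"
proof (rule ccontr)
  assume "1 \<notin> I"
  then obtain M where "maximal_ideal M" "I \<subseteq> M"
    using proper_ideal_in_maximal[OF assms(1,2)] by blast
  then show False using assms(3) by blast
qed

lemma maximal_ideal_prime:
  assumes "maximal_ideal M"
  shows "prime_ideal M"
proof -
  have M: "ideal.subspace M" "M \<noteq> UNIV" "\<And>I. ideal.subspace I \<Longrightarrow> M \<subseteq> I \<Longrightarrow> I = M \<or> I = UNIV"
    using assms by (auto simp: maximal_ideal_def)
  have "b \<in> M" if ab: "a * b \<in> M" "a \<notin> M" for a b
  proof -
    have "{i + r * a | i r. i \<in> M} = UNIV"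
      using M(3)[OF ideal_add_principal(1,2)[OF M(1)]] ideal_add_principal(3)[OF M(1)] ab by blast
    then have "1 \<in> {i + r * a | i r. i \<in> M}" by blast
    then obtain i r where ir: "1 = i + r * a" "i \<in> M" by blast
    have "b * (i + r * a) = b"
      unfolding ir(1)[symmetric] by simp
    then have "b = b * i + r * (a * b)"
      by (simp add: algebra_simps)
    then show ?thesis
      using M(1) ir(2) ab(1) by (metis ideal.subspace_add ideal.subspace_scale)
  qed
  then show ?thesis using M by (auto simp: prime_ideal_def)
qed

lemma prime_idealD:
  assumes "prime_ideal P"
  shows "ideal.subspace P" "1 \<notin> P" "a * b \<in> P \<Longrightarrow> a \<notin> P \<Longrightarrow> b \<in> P"
  using assms ideal_eq_UNIV_iff by (auto simp: prime_ideal_def)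

lemma prime_ideal_power:
  assumes "prime_ideal P" "a ^ n \<in> P"
  shows "a \<in> P"
  using assms(2) by (induction n) (use prime_idealD[OF assms(1)] in auto)

lemma comaximal_powers:
  fixes s t :: "'a::comm_ring_1"
  assumes I: "ideal.subspace I" and st: "s + t = 1" "s ^ m \<in> I" "t ^ n \<in> I"
  shows "1 \<in> I"
proof -
  have "(s + t) ^ (m + n) \<in> I"
    unfolding binomial_ring
  proof (rule ideal.subspace_sum[OF I])
    fix k assume "k \<in> {..m + n}"
    then consider "k \<ge> m" | "m + n - k \<ge> n" by fastforce
    then have "s ^ k * t ^ (m + n - k) \<in> I"
    proof cases
      case 1
      then show ?thesis using ideal_dvd_closed[OF I st(2)] by (simp add: dvd_mult2 le_imp_power_dvd)
    next
      case 2
      then show ?thesis using ideal_dvd_closed[OF I st(3)] by (simp add: dvd_mult le_imp_power_dvd)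
    qed
    then show "of_nat (m + n choose k) * s ^ k * t ^ (m + n - k) \<in> I"
      using ideal.subspace_scale[OF I] by (simp add: mult.assoc)
  qed
  then show ?thesis using st(1) by simp
qed

section \<open>Invertibility of ideals in Dedekind domains\<close>

text \<open>
  Take a nonzero y0 in M. All x^n y0 lie in the ring, and since the ideal they generate is
  finitely generated, some x^n y0 is a combination of the earlier ones. Dividing by y0 gives an
  equation of integral dependence.
\<close>

lemma integral_if_stabilises_ideal:
  fixes x :: "'a::idom fract"
  assumes noeth: "noetherian TYPE('a)" and M: "ideal.subspace M" "y0 \<in> M" "y0 \<noteq> 0"
    and stab: "\<And>y. y \<in> M \<Longrightarrow> \<exists>z\<in>M. x * to_fract y = to_fract z"
  shows "integral_over_base x"
proof -
  have "\<exists>y\<in>M. x ^ n * to_fract y0 = to_fract y" for n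
  proof (induction n)
    case (Suc n)
    then obtain y where "y \<in> M" "x ^ n * to_fract y0 = to_fract y" by blast
    with stab[of y] show ?case by (metis mult.assoc power_Suc)
  qed (use M in auto)
  then obtain y where y: "\<And>n. y n \<in> M" "\<And>n. x ^ n * to_fract y0 = to_fract (y n)" by metis
  obtain S where S: "finite S" "ideal.span (range y) = ideal.span S"
    using noeth unfolding noetherian_def by (metis ideal.subspace_span)
  have mono: "ideal.span (y ` {..<n}) \<subseteq> ideal.span (y ` {..<k})" if "n \<le> k" for n k
    using that by (intro ideal.span_mono) auto
  have fin: "\<exists>n. s \<in> ideal.span (y ` {..<n})" if "s \<in> ideal.span (range y)" for s
    using that
  proof (induction rule: ideal.span_induct_alt)
    case base
    show ?case using ideal.span_zero by blast
  next
    case (step c v z)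
    then obtain n k where nk: "z \<in> ideal.span (y ` {..<n})" "v = y k" by auto
    have "y k \<in> ideal.span (y ` {..<max n (Suc k)})" by (intro ideal.span_base) auto
    then have "c * v + z \<in> ideal.span (y ` {..<max n (Suc k)})"
      using nk mono[of n "max n (Suc k)"] by (auto intro: ideal.span_add ideal.span_scale)
    then show ?case by blast
  qed
  have "S \<subseteq> ideal.span (range y)" using S ideal.span_superset by blast
  then have "\<forall>s\<in>S. \<exists>n. s \<in> ideal.span (y ` {..<n})" using fin by blast
  then obtain N where N: "\<And>s. s \<in> S \<Longrightarrow> s \<in> ideal.span (y ` {..<N s})" by metis
  obtain n where n: "\<And>s. s \<in> S \<Longrightarrow> N s \<le> n"
    using finite_nat_set_iff_bounded_le[of "N ` S"] S(1) by auto
  have "S \<subseteq> ideal.span (y ` {..<n})"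
    using N mono[OF n] by auto
  then have "ideal.span S \<subseteq> ideal.span (y ` {..<n})"
    by (intro ideal.span_minimal ideal.subspace_span)
  moreover have "y n \<in> ideal.span S" unfolding S(2)[symmetric] by (intro ideal.span_base) auto
  ultimately have yn: "y n \<in> ideal.span (y ` {..<n})" by (rule subsetD)
  have "\<exists>c. z = (\<Sum>i<n. c i * y i)" if "z \<in> ideal.span (y ` {..<n})" for z
    using that
  proof (induction rule: ideal.span_induct_alt)
    case base
    show ?case by (rule exI[of _ "\<lambda>_. 0"]) simp
  next
    case (step k v z)
    then obtain c j where c: "z = (\<Sum>i<n. c i * y i)" "j < n" "v = y j" by auto
    have "k * v + z = (\<Sum>i<n. (c i + (if i = j then k else 0)) * y i)"
      using c by (simp add: algebra_simps sum.distrib if_distrib[of "\<lambda>u. _ * u"] cong: if_cong)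
    then show ?case by (rule exI[where P = "\<lambda>c. k * v + z = (\<Sum>i<n. c i * y i)"])
  qed
  with yn obtain c where c: "y n = (\<Sum>i<n. c i * y i)" by blast
  have "to_fract y0 * x ^ n = (\<Sum>i<n. to_fract (c i) * to_fract (y i))"
    using y(2)[of n] c by (simp add: mult.commute)
  also have "\<dots> = to_fract y0 * (\<Sum>i<n. to_fract (c i) * x ^ i)"
    unfolding sum_distrib_left
    by (intro sum.cong refl) (simp add: y(2)[symmetric] algebra_simps)
  finally have rel: "x ^ n = (\<Sum>i<n. to_fract (c i) * x ^ i)" using M(3) by simp
  define q where "q = (\<Sum>i<n. monom (c i) i)"
  define p where "p = monom 1 n - q"
  have cq: "coeff q i = (if i < n then c i else 0)" for i
    by (simp add: q_def coeff_sum sum.delta' if_distrib cong: if_cong)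
  have "degree p = n"
  proof (rule antisym)
    show "degree p \<le> n" by (rule degree_le) (auto simp: p_def cq)
    show "n \<le> degree p" by (rule le_degree) (auto simp: p_def cq)
  qed
  then have lc: "lead_coeff p = 1" by (simp add: p_def cq)
  have "map_poly to_fract p = monom 1 n - (\<Sum>i<n. monom (to_fract (c i)) i)"
    by (rule poly_eqI) (simp add: coeff_map_poly p_def cq coeff_sum sum.delta' if_distrib cong: if_cong)
  then have "poly (map_poly to_fract p) x = 0"
    by (simp add: poly_monom poly_sum rel)
  with lc show ?thesis unfolding integral_over_base_def by blast
qed

text \<open>
  The inverse of a nonzero maximal ideal is strictly larger than the ring: in a maximal ideal
  \<open>M\<close> containing \<open>a\<close>, a maximal member of the family of colon ideals \<open>(a) : b\<close> inside \<open>M\<close> is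
  prime, hence equal to \<open>M\<close>.
\<close>

lemma maximal_ideal_is_colon:
  fixes M :: "'a::idom set"
  assumes ded: "dedekind_domain TYPE('a)" and M: "maximal_ideal M" "a \<in> M" "a \<noteq> 0"
  obtains b where "\<not> a dvd b" "\<And>r. r \<in> M \<Longrightarrow> a dvd r * b"
proof -
  have noeth: "noetherian TYPE('a)" using ded by (simp add: dedekind_domain_def)
  define Q where "Q b = {r. a dvd r * b}" for b
  have sub: "ideal.subspace (Q b)" for b
    by (auto simp: subspace_iff Q_def distrib_right mult.assoc)
  note Mp = prime_idealD[OF maximal_ideal_prime[OF M(1)]]
  let ?A = "{Q b | b. Q b \<subseteq> M}"
  have "Q 1 \<subseteq> M" using ideal_dvd_closed[OF Mp(1) M(2)] by (auto simp: Q_def)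
  then have ne: "?A \<noteq> {}" by blast
  have subA: "ideal.subspace I" if "I \<in> ?A" for I using that sub by auto
  have "\<exists>P\<in>?A. \<forall>I\<in>?A. P \<subseteq> I \<longrightarrow> I = P"
    by (rule noetherian_maximal_element[OF noeth ne]) (rule subA)
  then obtain P where P: "P \<in> ?A" "\<forall>I\<in>?A. P \<subseteq> I \<longrightarrow> I = P" by (rule bexE)
  then obtain b where b: "P = Q b" "Q b \<subseteq> M" by auto
  have max: "Q c = Q b" if "Q c \<subseteq> M" "Q b \<subseteq> Q c" for c
    using P(2) that unfolding b(1) by auto
  have "prime_ideal (Q b)"
    unfolding prime_ideal_def
  proof (intro conjI allI impI)
    show "Q b \<noteq> UNIV" using b Mp(2) by blast
    fix r s assume rs: "r * s \<in> Q b"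
    show "r \<in> Q b \<or> s \<in> Q b"
    proof (cases "Q (b * s) \<subseteq> M")
      case True
      moreover have "Q b \<subseteq> Q (b * s)" by (auto simp: Q_def mult.assoc[symmetric])
      ultimately have "Q (b * s) = Q b" by (intro max)
      moreover have "r \<in> Q (b * s)" using rs by (simp add: Q_def algebra_simps)
      ultimately show ?thesis by blast
    next
      case False
      then obtain z where z: "z \<notin> M" "a dvd z * (b * s)" by (auto simp: Q_def)
      have "Q (z * b) \<subseteq> M"
      proof
        fix w assume "w \<in> Q (z * b)"
        then have "z * w \<in> M" using b(2) by (auto simp: Q_def algebra_simps)
        then show "w \<in> M" using Mp(3) z(1) by blast
      qed
      moreover have "Q b \<subseteq> Q (z * b)" by (auto simp: Q_def mult.left_commute[of _ z])
      ultimately have "Q (z * b) = Q b" by (intro max)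
      moreover have "s \<in> Q (z * b)" using z(2) by (simp add: Q_def algebra_simps)
      ultimately show ?thesis by blast
    qed
  qed (rule sub)
  moreover have "a \<in> Q b" by (simp add: Q_def)
  then have "Q b \<noteq> {0}" using M(3) by blast
  ultimately have "maximal_ideal (Q b)" using ded by (simp add: dedekind_domain_def)
  then have "Q b = M"
    using b(2) M(1) unfolding maximal_ideal_def by blast
  moreover have "1 \<notin> Q b" using b(2) Mp(2) by blast
  ultimately show ?thesis using that[of b] by (auto simp: Q_def)
qed

text \<open>
  For e in I, this is e times the inverse fractional ideal of I.
\<close>

definition colon :: "'a::idom \<Rightarrow> 'a set \<Rightarrow> 'a set" where
  "colon e I = {b. \<forall>a\<in>I. e dvd a * b}"

lemma colon_subspace: "ideal.subspace (colon e I)"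
  by (auto simp: subspace_iff colon_def distrib_left mult.left_commute)

text \<open>
  The product \<open>I I\<^sup>-\<^sup>1\<close>, scaled by e, is the span in the claim; let \<open>C = I I\<^sup>-\<^sup>1\<close>. Any x in \<open>C\<^sup>-\<^sup>1\<close>
  maps \<open>I\<^sup>-\<^sup>1\<close> into itself, so it is integral and lies in the ring. If C were contained in a maximal
  ideal M, then \<open>M\<^sup>-\<^sup>1 \<subseteq> C\<^sup>-\<^sup>1\<close> would be contained in the ring, contradicting \<open>maximal_ideal_is_colon\<close>.
\<close>

theorem dedekind_invertible:
  fixes I :: "'a::idom set"
  assumes ded: "dedekind_domain TYPE('a)" and I: "ideal.subspace I" and e: "e \<in> I" "e \<noteq> 0"
  shows "e \<in> ideal.span {a * b | a b. a \<in> I \<and> b \<in> colon e I}"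
proof (rule ccontr)
  let ?S = "ideal.span {a * b | a b. a \<in> I \<and> b \<in> colon e I}"
  assume notin: "e \<notin> ?S"
  have noeth: "noetherian TYPE('a)" and ic: "integrally_closed TYPE('a)"
    using ded by (auto simp: dedekind_domain_def)
  define C where "C = {c. e * c \<in> ?S}"
  have subC: "ideal.subspace C"
    by (auto simp: subspace_iff C_def distrib_left ideal.span_zero mult.left_commute
        intro: ideal.span_add ideal.span_scale)
  have "1 \<notin> C" using notin by (simp add: C_def)
  then obtain M where M: "maximal_ideal M" "C \<subseteq> M"
    using proper_ideal_in_maximal[OF noeth subC] by blast
  have "e \<in> colon e I" by (simp add: colon_def)
  then have "e * e \<in> ?S" using e by (intro ideal.span_base) blast
  then have eM: "e \<in> M" using M(2) by (auto simp: C_def)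
  obtain b where b: "\<not> e dvd b" "\<And>r. r \<in> M \<Longrightarrow> e dvd r * b"
    using maximal_ideal_is_colon[OF ded M(1) eM e(2)] by blast
  define x where "x = to_fract b / to_fract e"
  \<comment> \<open>\<open>x\<close> multiplies the inverse of \<open>I\<close> into itself, so it is integral and lies in the ring.\<close>
  have "integral_over_base x"
  proof (rule integral_if_stabilises_ideal[OF noeth colon_subspace \<open>e \<in> colon e I\<close> e(2)])
    fix y assume y: "y \<in> colon e I"
    have key: "e dvd c * b" if a: "a \<in> I" "a * y = e * c" for a c
    proof -
      have "e * c \<in> ?S" using a y by (intro ideal.span_base) (auto simp flip: a(2))
      then show ?thesis using b(2) M(2) by (auto simp: C_def)
    qed
    have "e dvd e * y" by simp
    then have "e dvd y * b" using key[of e y] e by simp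
    then obtain z where z: "y * b = e * z" by (auto elim: dvdE)
    have "z \<in> colon e I" unfolding colon_def
    proof safe
      fix a assume a: "a \<in> I"
      then obtain c where c: "a * y = e * c" using y by (auto simp: colon_def elim: dvdE)
      then obtain d where d: "c * b = e * d" using key[OF a c] by (auto elim: dvdE)
      have "e * (a * z) = (a * y) * b" using z by (simp add: algebra_simps)
      also have "\<dots> = e * (e * d)" using c d by (simp add: mult.assoc)
      finally show "e dvd a * z" using e(2) by simp
    qed
    moreover have "x * to_fract y = to_fract z"
      using z e(2) by (simp add: x_def field_simps flip: to_fract_mult)
    ultimately show "\<exists>z\<in>colon e I. x * to_fract y = to_fract z" by blast
  qed
  then obtain r where "x = to_fract r"
    using ic by (auto simp: integrally_closed_def)
  then have "to_fract b = to_fract (r * e)"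
    using e(2) by (simp add: x_def field_simps)
  then have "b = r * e" unfolding to_fract_eq_iff .
  then show False using b(1) by simp
qed

text \<open>
  The fraction c/e lies in the inverse of the ideal generated by S. A suitable one exists because the
  products of elements of S and of this inverse generate the unit ideal. In this form denominators
  are cleared below: the multiples by c/e stay in the ring, and not all lie in M.
\<close>

lemma dedekind_locally_principal:
  fixes S M :: "'a::idom set"
  assumes ded: "dedekind_domain TYPE('a)" and S: "a0 \<in> S" "a0 \<noteq> 0" and M: "maximal_ideal M"
  obtains e c s w where "e \<noteq> 0" "\<And>a. a \<in> S \<Longrightarrow> e dvd c * a" "s \<in> S" "c * s = e * w" "w \<notin> M"
proof -
  note Mp = prime_idealD[OF maximal_ideal_prime[OF M]]
  let ?I = "ideal.span S"
  let ?T = "{a * b | a b. a \<in> ?I \<and> b \<in> colon a0 ?I}"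
  have base: "a \<in> ?I" if "a \<in> S" for a using that by (rule ideal.span_base)
  have "\<exists>s\<in>S. \<exists>c\<in>colon a0 ?I. \<forall>w\<in>M. c * s \<noteq> a0 * w"
  proof (rule ccontr)
    assume "\<not> ?thesis"
    then have *: "\<exists>w\<in>M. c * s = a0 * w" if "s \<in> S" "c \<in> colon a0 ?I" for s c using that by blast
    have "a \<in> {s. \<exists>w\<in>M. c * s = a0 * w}" if "a \<in> ?I" "c \<in> colon a0 ?I" for a c
    proof -
      have "S \<subseteq> {s. \<exists>w\<in>M. c * s = a0 * w}" using * that(2) by blast
      from ideal.span_minimal[OF this ideal_fraction_subspace[OF Mp(1)]] show ?thesis using that(1) by blast
    qed
    then have "?T \<subseteq> {s. \<exists>w\<in>M. 1 * s = a0 * w}" by (auto simp: mult.commute)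
    then have "ideal.span ?T \<subseteq> {s. \<exists>w\<in>M. 1 * s = a0 * w}"
      by (rule ideal.span_minimal[OF _ ideal_fraction_subspace[OF Mp(1)]])
    then have "a0 \<in> {s. \<exists>w\<in>M. 1 * s = a0 * w}"
      using dedekind_invertible[OF ded ideal.subspace_span base[OF S(1)] S(2)] by blast
    then show False using S(2) Mp(2) by auto
  qed
  then obtain s c where s: "s \<in> S" "c \<in> colon a0 ?I" "\<forall>w\<in>M. c * s \<noteq> a0 * w" by blast
  have dv: "a0 dvd c * a" if "a \<in> S" for a
    using s(2) base[OF that] by (simp add: colon_def mult.commute[of c])
  obtain w where w: "c * s = a0 * w" using dv[OF s(1)] by (auto elim: dvdE)
  then show ?thesis using that[of a0 c s w] S(2) dv s(1,3) by blast
qed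

text \<open>\<open>gen_at I b M\<close>: the element \<open>b\<close> generates the localisation of the ideal \<open>I\<close> at \<open>M\<close>.\<close>

definition gen_at :: "'a::idom set \<Rightarrow> 'a \<Rightarrow> 'a set \<Rightarrow> bool" where
  "gen_at I b M \<longleftrightarrow> (\<exists>r. r \<notin> M \<and> (\<forall>a\<in>I. b dvd r * a))"

lemma dedekind_gen_at:
  fixes I M :: "'a::idom set"
  assumes ded: "dedekind_domain TYPE('a)" and I: "ideal.subspace I" "a0 \<in> I" "a0 \<noteq> 0"
    and M: "maximal_ideal M"
  obtains z where "z \<in> I" "gen_at I z M"
proof -
  obtain e c z w where e: "e \<noteq> 0" "\<And>a. a \<in> I \<Longrightarrow> e dvd c * a" "z \<in> I" "c * z = e * w" "w \<notin> M"
    by (rule dedekind_locally_principal[OF ded I(2,3) M]) blast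
  have "z dvd w * a" if a: "a \<in> I" for a
  proof -
    obtain v where v: "c * a = e * v" using e(2)[OF a] by (auto elim: dvdE)
    have "e * (w * a) = (c * z) * a" by (simp add: e(4) mult.assoc)
    also have "\<dots> = e * (z * v)" using v by (simp add: algebra_simps)
    finally show ?thesis using e(1) by simp
  qed
  then show ?thesis using that[of z] e(3,5) by (auto simp: gen_at_def)
qed

lemma maximal_ideals_avoid:
  assumes "finite F" "\<And>N. N \<in> F \<Longrightarrow> maximal_ideal N" "maximal_ideal M" "M \<notin> F"
  shows "\<exists>z. z \<notin> M \<and> (\<forall>N\<in>F. z \<in> N)"
  using assms(1,2,4)
proof (induction F)
  case empty
  then show ?case using prime_idealD(2)[OF maximal_ideal_prime[OF assms(3)]] by auto
next
  case (insert N F)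
  then obtain z where z: "z \<notin> M" "\<forall>N\<in>F. z \<in> N" by auto
  have N: "maximal_ideal N" "N \<noteq> M" using insert by auto
  then have "\<not> N \<subseteq> M" using assms(3) unfolding maximal_ideal_def by blast
  then obtain y where y: "y \<in> N" "y \<notin> M" by blast
  have "z * y \<notin> M" using z(1) y(2) prime_idealD(3)[OF maximal_ideal_prime[OF assms(3)]] by blast
  moreover have "z * y \<in> N'" if "N' \<in> insert N F" for N'
  proof -
    have "ideal.subspace N'" using insert.prems that by (auto simp: maximal_ideal_def)
    then show ?thesis using that y z
      by (metis ideal.subspace_scale insertE mult.commute)
  qed
  ultimately show ?case by blast
qed

text \<open>
  By induction on the set of maximal ideals: if b is good at the ideals of F but not at M, add to
  it a local generator at M, multiplied by an element that lies in all ideals of F but not in M.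
\<close>

lemma dedekind_gen_at_finite:
  fixes I :: "'a::idom set"
  assumes ded: "dedekind_domain TYPE('a)" and I: "ideal.subspace I" "a0 \<in> I" "a0 \<noteq> 0"
    and F: "finite F" "\<And>M. M \<in> F \<Longrightarrow> maximal_ideal M"
  shows "\<exists>b\<in>I. \<forall>M\<in>F. gen_at I b M"
  using F
proof (induction F)
  case empty
  show ?case using I(2) by blast
next
  case (insert M F)
  then obtain b where b: "b \<in> I" "\<forall>N\<in>F. gen_at I b N" by blast
  have M: "maximal_ideal M" using insert by auto
  note Mp = prime_idealD[OF maximal_ideal_prime[OF M]]
  show ?case
  proof (cases "gen_at I b M")
    case True
    then show ?thesis using b by blast
  next
    case False
    obtain \<alpha> where \<alpha>: "\<alpha> \<in> I" "gen_at I \<alpha> M" by (rule dedekind_gen_at[OF ded I M])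
    then obtain y where y: "y \<notin> M" "\<forall>a\<in>I. \<alpha> dvd y * a" by (auto simp: gen_at_def)
    have y0: "y \<noteq> 0" using y(1) ideal.subspace_0[OF Mp(1)] by blast
    obtain w where w: "y * b = \<alpha> * w" using y(2) b(1) by (auto elim: dvdE)
    \<comment> \<open>otherwise \<open>b\<close> would be an associate of \<open>\<alpha>\<close> at \<open>M\<close>\<close>
    have "w \<in> M"
    proof (rule ccontr)
      assume "w \<notin> M"
      then have "w * y \<notin> M" using y(1) Mp(3) by blast
      moreover have "b dvd (w * y) * a" if a: "a \<in> I" for a
      proof -
        obtain v where "y * a = \<alpha> * v" using y(2) a by (auto elim: dvdE)
        then have "(w * y) * a = b * (y * v)"
          using w by (metis mult.assoc mult.commute)
        then show ?thesis by (rule dvdI)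
      qed
      ultimately show False using False by (auto simp: gen_at_def)
    qed
    obtain z where z: "z \<notin> M" "\<forall>N\<in>F. z \<in> N"
      using maximal_ideals_avoid[OF insert(1) _ M insert(2)] insert.prems by blast
    define b' where "b' = b + z * \<alpha>"
    have "b' \<in> I" unfolding b'_def
      using b(1) \<alpha>(1) I(1) by (simp add: ideal.subspace_add ideal.subspace_scale)
    moreover have "gen_at I b' M"
      unfolding gen_at_def
    proof (intro exI conjI ballI)
      have "w + z * y - w \<notin> M" using z(1) y(1) Mp(3) by auto
      then show "w + z * y \<notin> M" using \<open>w \<in> M\<close> ideal.subspace_diff[OF Mp(1)] by blast
      fix a assume "a \<in> I"
      then obtain v where v: "y * a = \<alpha> * v" using y(2) by (auto elim: dvdE)
      have "y * ((w + z * y) * a) = (w + z * y) * (\<alpha> * v)"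
        unfolding v[symmetric] by (simp add: algebra_simps)
      also have "\<dots> = (\<alpha> * w + z * \<alpha> * y) * v" by (simp add: algebra_simps)
      also have "\<dots> = y * (b' * v)" unfolding w[symmetric] b'_def by (simp add: algebra_simps)
      finally show "b' dvd (w + z * y) * a" using y0 by simp
    qed
    moreover have "gen_at I b' N" if N: "N \<in> F" for N
    proof -
      have Np: "prime_ideal N" using insert.prems N maximal_ideal_prime by blast
      obtain r where r: "r \<notin> N" "\<forall>a\<in>I. b dvd r * a" using b(2) N by (auto simp: gen_at_def)
      obtain v where v: "r * \<alpha> = b * v" using r(2) \<alpha>(1) by (auto elim: dvdE)
      have r0: "r \<noteq> 0" using r(1) ideal.subspace_0[OF prime_idealD(1)[OF Np]] by blast
      have zv: "z * v \<in> N"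
        using z(2) N ideal.subspace_scale[OF prime_idealD(1)[OF Np], of z v]
        by (simp add: mult.commute)
      show ?thesis unfolding gen_at_def
      proof (intro exI conjI ballI)
        show "r + z * v \<notin> N"
          using r(1) zv ideal.subspace_diff[OF prime_idealD(1)[OF Np], of "r + z * v" "z * v"] by auto
        fix a assume "a \<in> I"
        then obtain k where k: "r * a = b * k" using r(2) by (auto elim: dvdE)
        have "r * ((r + z * v) * a) = (r + z * v) * (b * k)"
          unfolding k[symmetric] by (simp add: algebra_simps)
        also have "\<dots> = (r * b + z * (b * v)) * k" by (simp add: algebra_simps)
        also have "\<dots> = r * (b' * k)" unfolding v[symmetric] b'_def by (simp add: algebra_simps)
        finally show "b' dvd (r + z * v) * a" using r0 by simp
      qed
    qed
    ultimately show ?thesis by blast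
  qed
qed

text \<open>
  An ideal maximal among those that contain \<open>a\<close> and lie in infinitely many maximal ideals would be
  prime, since a maximal ideal containing r s contains r or s. Nonzero primes are maximal, so it
  would lie in only one maximal ideal.
\<close>

lemma dedekind_finite_maximal_over:
  fixes a :: "'a::idom"
  assumes ded: "dedekind_domain TYPE('a)" and a: "a \<noteq> 0"
  shows "finite {M. maximal_ideal M \<and> a \<in> M}"
proof (rule ccontr)
  assume inf: "infinite {M. maximal_ideal M \<and> a \<in> M}"
  have noeth: "noetherian TYPE('a)" using ded by (simp add: dedekind_domain_def)
  define V where "V I = {M. maximal_ideal M \<and> I \<subseteq> M}" for I :: "'a set"
  let ?A = "{I. ideal.subspace I \<and> a \<in> I \<and> infinite (V I)}"
  have "{M. maximal_ideal M \<and> a \<in> M} \<subseteq> V (ideal.span {a})"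
    unfolding V_def using ideal.span_minimal[of "{a}"] by (auto simp: maximal_ideal_def)
  then have "infinite (V (ideal.span {a}))" using inf finite_subset by blast
  then have "ideal.span {a} \<in> ?A" by (auto intro: ideal.span_base)
  then have ne: "?A \<noteq> {}" by blast
  have "\<exists>P\<in>?A. \<forall>I\<in>?A. P \<subseteq> I \<longrightarrow> I = P"
    by (rule noetherian_maximal_element[OF noeth ne]) auto
  then obtain P where P: "P \<in> ?A" "\<forall>I\<in>?A. P \<subseteq> I \<longrightarrow> I = P" by (rule bexE)
  have subP: "ideal.subspace P" and aP: "a \<in> P" and infP: "infinite (V P)" using P(1) by auto
  have fin: "finite (V {i + s * r | i s. i \<in> P})" if "r \<notin> P" for r
  proof (rule ccontr)
    let ?J = "{i + s * r | i s. i \<in> P}"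
    assume "infinite (V ?J)"
    then have "?J \<in> ?A" using ideal_add_principal[OF subP, of r] aP by auto
    then have "?J = P" using P(2) ideal_add_principal(2)[OF subP, of r] by auto
    then show False using that ideal_add_principal(3)[OF subP, of r] by auto
  qed
  have "prime_ideal P" unfolding prime_ideal_def
  proof (intro conjI allI impI)
    show "P \<noteq> UNIV"
    proof
      assume "P = UNIV"
      then have "V P = {}" by (auto simp: V_def maximal_ideal_def)
      then show False using infP by simp
    qed
    fix r s assume rs: "r * s \<in> P"
    show "r \<in> P \<or> s \<in> P"
    proof (rule ccontr)
      assume *: "\<not> (r \<in> P \<or> s \<in> P)"
      have "V P \<subseteq> V {i + t * r | i t. i \<in> P} \<union> V {i + t * s | i t. i \<in> P}"
      proof
        fix M assume "M \<in> V P"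
        then have M: "maximal_ideal M" "P \<subseteq> M" by (auto simp: V_def)
        note Mp = prime_idealD[OF maximal_ideal_prime[OF M(1)]]
        have "r \<in> M \<or> s \<in> M" using rs M(2) Mp(3) by blast
        moreover have "{i + t * x | i t. i \<in> P} \<subseteq> M" if "x \<in> M" for x
          using that M(2) Mp(1) by (auto intro!: ideal.subspace_add ideal.subspace_scale)
        ultimately show "M \<in> V {i + t * r | i t. i \<in> P} \<union> V {i + t * s | i t. i \<in> P}"
          using M(1) unfolding V_def by blast
      qed
      moreover have "finite (V {i + t * r | i t. i \<in> P} \<union> V {i + t * s | i t. i \<in> P})"
        using fin * by blast
      ultimately show False using infP finite_subset by blast
    qed
  qed (rule subP)
  moreover have "P \<noteq> {0}" using a aP by blast
  ultimately have "maximal_ideal P" using ded by (auto simp: dedekind_domain_def)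
  then have "V P \<subseteq> {P}" by (auto simp: V_def maximal_ideal_def)
  then show False using infP finite_subset by blast
qed

text \<open>
  Any nonzero \<open>a\<close> in I works as the first generator. The second one generates I locally at the
  finitely many maximal ideals containing \<open>a\<close>; at the others \<open>a\<close> generates the unit ideal.
\<close>

lemma dedekind_two_generators:
  fixes I :: "'a::idom set"
  assumes ded: "dedekind_domain TYPE('a)" and I: "ideal.subspace I"
  shows "\<exists>a\<in>I. \<exists>b\<in>I. \<forall>x\<in>I. \<exists>r s. x = r * a + s * b"
proof (cases "I = {0}")
  case False
  then obtain a where a: "a \<in> I" "a \<noteq> 0" using ideal.subspace_0[OF I] by blast
  have noeth: "noetherian TYPE('a)" using ded by (simp add: dedekind_domain_def)
  obtain b where b: "b \<in> I" "\<And>M. maximal_ideal M \<Longrightarrow> a \<in> M \<Longrightarrow> gen_at I b M"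
    using dedekind_gen_at_finite[OF ded I a dedekind_finite_maximal_over[OF ded a(2)]] by blast
  have "\<exists>r s. x = r * a + s * b" if x: "x \<in> I" for x
  proof -
    let ?Q = "{t. t * x \<in> ideal.span {a, b}}"
    have sub: "ideal.subspace ?Q"
      by (auto simp: subspace_iff distrib_right mult.assoc ideal.span_zero
          intro: ideal.span_add ideal.span_scale)
    have "1 \<in> ?Q"
    proof (rule ideal_eq_UNIV_if_no_maximal[OF noeth sub])
      fix M :: "'a set" assume M: "maximal_ideal M"
      show "\<exists>r\<in>?Q. r \<notin> M"
      proof (cases "a \<in> M")
        case True
        then obtain r where r: "r \<notin> M" "b dvd r * x" using b(2)[OF M] x by (auto simp: gen_at_def)
        have "b \<in> ideal.span {a, b}" by (intro ideal.span_base) simp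
        then have "r * x \<in> ideal.span {a, b}" using ideal_dvd_closed r(2) by blast
        then show ?thesis using r(1) by blast
      next
        case False
        have "a \<in> ideal.span {a, b}" by (intro ideal.span_base) simp
        then have "a * x \<in> ideal.span {a, b}" using ideal_dvd_closed by fastforce
        then show ?thesis using False by blast
      qed
    qed
    then have "x \<in> ideal.span {a, b}" by simp
    then obtain k where "x - k * a \<in> ideal.span {b}" by (auto simp: ideal.span_insert)
    then obtain l where "x - k * a = l * b" by (auto simp: ideal.span_singleton)
    then have "x = k * a + l * b" by (simp add: algebra_simps)
    then show ?thesis by blast
  qed
  then show ?thesis using a b by blast
qed auto

text \<open>
  Choose c in the inverse of I, scaled by e, that generates this inverse at the finitely many maximal
  ideals containing a fixed nonzero element of J. At these the multiple of I by c/e is the unit ideal.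
\<close>

lemma dedekind_comaximal_scaling:
  fixes I J :: "'a::idom set"
  assumes ded: "dedekind_domain TYPE('a)" and I: "ideal.subspace I" "e \<in> I" "e \<noteq> 0"
    and J: "ideal.subspace J" "a \<in> J" "a \<noteq> 0"
  obtains c p q \<beta> where "c \<in> colon e I" "c \<noteq> 0" "p \<in> J" "\<beta> \<in> I" "c * \<beta> = e * q" "p + q = 1"
proof -
  have noeth: "noetherian TYPE('a)" using ded by (simp add: dedekind_domain_def)
  have ee: "e \<in> colon e I" by (simp add: colon_def)
  obtain c0 where c0: "c0 \<in> colon e I" "\<And>M. maximal_ideal M \<Longrightarrow> a \<in> M \<Longrightarrow> gen_at (colon e I) c0 M"
    using dedekind_gen_at_finite[OF ded colon_subspace ee I(3) dedekind_finite_maximal_over[OF ded J(3)]]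
    by blast
  \<comment> \<open>only the case that no maximal ideal contains \<open>a\<close> could give the generator \<open>0\<close>\<close>
  define c where "c = (if c0 = 0 then e else c0)"
  have c: "c \<in> colon e I" "c \<noteq> 0" using c0(1) ee I(3) by (auto simp: c_def)
  have cM: "gen_at (colon e I) c M" if M: "maximal_ideal M" "a \<in> M" for M
  proof (cases "c0 = 0")
    case True
    with c0(2)[OF M] obtain r where "r \<notin> M" "0 dvd r * e" using ee by (auto simp: gen_at_def)
    then have "r = 0" using I(3) by simp
    then show ?thesis using \<open>r \<notin> M\<close> M(1) ideal.subspace_0 by (auto simp: maximal_ideal_def)
  qed (use c0(2)[OF M] in \<open>simp add: c_def\<close>)
  let ?T = "{a * b | a b. a \<in> I \<and> b \<in> colon e I}"
  let ?I' = "{q. \<exists>\<beta>\<in>I. e * q = c * \<beta>}"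
  let ?Q = "{p + q | p q. p \<in> J \<and> q \<in> ?I'}"
  have subQ: "ideal.subspace ?Q"
    by (rule ideal_sum_subspace[OF J(1) ideal_fraction_subspace[OF I(1)]])
  have "1 \<in> ?Q"
  proof (rule ideal_eq_UNIV_if_no_maximal[OF noeth subQ])
    fix M :: "'a set" assume M: "maximal_ideal M"
    show "\<exists>r\<in>?Q. r \<notin> M"
    proof (cases "a \<in> M")
      case True
      then obtain r where r: "r \<notin> M" "\<forall>b\<in>colon e I. c dvd r * b" using cM[OF M] by (auto simp: gen_at_def)
      have "ideal.span ?T \<subseteq> {s. \<exists>\<beta>\<in>I. r * s = c * \<beta>}"
      proof (rule ideal.span_minimal)
        show "?T \<subseteq> {s. \<exists>\<beta>\<in>I. r * s = c * \<beta>}"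
        proof clarify
          fix \<alpha> b assume *: "\<alpha> \<in> I" "b \<in> colon e I"
          then obtain d where "r * b = c * d" using r(2) by (auto elim: dvdE)
          then have "r * (\<alpha> * b) = c * (d * \<alpha>)" by (metis mult.assoc mult.commute)
          then show "\<exists>\<beta>\<in>I. r * (\<alpha> * b) = c * \<beta>" using ideal.subspace_scale[OF I(1) *(1)] by blast
        qed
        show "ideal.subspace {s. \<exists>\<beta>\<in>I. r * s = c * \<beta>}" by (rule ideal_fraction_subspace[OF I(1)])
      qed
      then obtain \<beta> where "\<beta> \<in> I" "r * e = c * \<beta>" using dedekind_invertible[OF ded I] by blast
      then have "r \<in> ?I'" by (auto simp: mult.commute)
      then have "0 + r \<in> ?Q" using ideal.subspace_0[OF J(1)] by blast
      then show ?thesis using r(1) by auto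
    next
      case False
      have "0 \<in> ?I'" by (rule ideal.subspace_0[OF ideal_fraction_subspace[OF I(1)]])
      then have "a + 0 \<in> ?Q" using J(2) by blast
      then have "a \<in> ?Q" by simp
      then show ?thesis using False by blast
    qed
  qed
  then obtain p q \<beta> where "1 = p + q" "p \<in> J" "\<beta> \<in> I" "e * q = c * \<beta>" by blast
  then show ?thesis using that[of c p \<beta> q] c by simp
qed

text \<open>
  After scaling \<open>I\<close> to an ideal comaximal with \<open>J\<close>, the module \<open>J \<oplus> I\<close> is generated by a lift of
  \<open>1 = p + q\<close> and by the antidiagonal of \<open>J \<inter> I\<close>, which needs two elements.
\<close>

lemma dedekind_three_generators:
  fixes I J :: "'a::idom set"
  assumes ded: "dedekind_domain TYPE('a)" and I: "ideal.subspace I" "e \<in> I" "e \<noteq> 0"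
    and J: "ideal.subspace J" "a \<in> J" "a \<noteq> 0"
  obtains \<alpha>1 \<beta>1 \<alpha>2 \<beta>2 \<alpha>3 \<beta>3
  where "\<alpha>1 \<in> J" "\<alpha>2 \<in> J" "\<alpha>3 \<in> J" "\<beta>1 \<in> I" "\<beta>2 \<in> I" "\<beta>3 \<in> I"
    "\<And>x y. x \<in> J \<Longrightarrow> y \<in> I \<Longrightarrow>
       \<exists>r1 r2 r3. x = r1 * \<alpha>1 + r2 * \<alpha>2 + r3 * \<alpha>3 \<and> y = r1 * \<beta>1 + r2 * \<beta>2 + r3 * \<beta>3"
proof -
  obtain c p q \<beta> where c: "c \<in> colon e I" "c \<noteq> 0" "p \<in> J" "\<beta> \<in> I" "c * \<beta> = e * q" "p + q = 1"
    by (rule dedekind_comaximal_scaling[OF ded I J])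
  let ?I' = "{z. \<exists>\<beta>\<in>I. e * z = c * \<beta>}"
  have subI': "ideal.subspace ?I'" by (rule ideal_fraction_subspace[OF I(1)])
  have "q \<in> ?I'" using c(4) c(5)[symmetric] by blast
  obtain g1 g2 where g: "g1 \<in> J \<inter> ?I'" "g2 \<in> J \<inter> ?I'"
    "\<forall>x\<in>J \<inter> ?I'. \<exists>r s. x = r * g1 + s * g2"
    using dedekind_two_generators[OF ded ideal.subspace_inter[OF J(1) subI']] by blast
  obtain \<gamma>1 \<gamma>2 where \<gamma>': "\<gamma>1 \<in> I" "e * g1 = c * \<gamma>1" "\<gamma>2 \<in> I" "e * g2 = c * \<gamma>2" using g(1,2) by blast
  note \<gamma> = \<gamma>'(1) \<gamma>'(2)[symmetric] \<gamma>'(3) \<gamma>'(4)[symmetric]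
  have gens: "\<exists>r1 r2 r3. x = r1 * p + r2 * g1 + r3 * g2 \<and> y = r1 * \<beta> + r2 * (- \<gamma>1) + r3 * (- \<gamma>2)"
    if xy: "x \<in> J" "y \<in> I" for x y
  proof -
    obtain z where z: "c * y = e * z"
    proof -
      have "e dvd y * c" using c(1) xy(2) by (simp add: colon_def)
      then have "e dvd c * y" by (simp add: mult.commute)
      then show ?thesis using that by (auto elim: dvdE)
    qed
    have "z \<in> ?I'" using z[symmetric] xy(2) by blast
    \<comment> \<open>\<open>(x, y) - (x + z) (p, \<beta>)\<close> is antidiagonal\<close>
    have eq: "x - (x + z) * p = x * q - z * p"
    proof -
      have "x * (p + q) = x" using c(6) by simp
      then show ?thesis by (simp add: algebra_simps)
    qed
    have "x - (x + z) * p \<in> J"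
      by (intro ideal.subspace_diff[OF J(1) xy(1)] ideal.subspace_scale[OF J(1) c(3)])
    moreover have "x * q - z * p \<in> ?I'"
    proof (rule ideal.subspace_diff[OF subI'])
      show "x * q \<in> ?I'" using ideal.subspace_scale[OF subI' \<open>q \<in> ?I'\<close>] .
      show "z * p \<in> ?I'" using ideal.subspace_scale[OF subI' \<open>z \<in> ?I'\<close>, of p] by (simp add: mult.commute)
    qed
    ultimately have "x - (x + z) * p \<in> J \<inter> ?I'" by (simp only: eq Int_iff)
    then obtain r s where rs: "x - (x + z) * p = r * g1 + s * g2" using g(3) by blast
    have "c * (y - ((x + z) * \<beta> - r * \<gamma>1 - s * \<gamma>2))
        = e * z - (x + z) * (c * \<beta>) + r * (c * \<gamma>1) + s * (c * \<gamma>2)"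
      using z by (simp add: algebra_simps)
    also have "\<dots> = e * (z - (x + z) * q + (r * g1 + s * g2))"
      unfolding c(5) \<gamma>(2,4) by (simp add: algebra_simps)
    also have "r * g1 + s * g2 = x * q - z * p" using rs eq by simp
    also have "z - (x + z) * q + (x * q - z * p) = z * (1 - (p + q))" by (simp add: algebra_simps)
    finally have "y = (x + z) * \<beta> - r * \<gamma>1 - s * \<gamma>2" using c(2,6) by simp
    then have "x = (x + z) * p + r * g1 + s * g2 \<and> y = (x + z) * \<beta> + r * (- \<gamma>1) + s * (- \<gamma>2)"
      using rs by (simp add: algebra_simps)
    then show ?thesis by blast
  qed
  show ?thesis
    by (rule that[of p g1 g2 \<beta> "- \<gamma>1" "- \<gamma>2"])
      (use c g \<gamma> I(1) gens in \<open>auto intro: ideal.subspace_neg\<close>)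
qed

lemma dedekind_split_pair:
  fixes a b :: "'a::idom"
  assumes ded: "dedekind_domain TYPE('a)" and "a \<noteq> 0 \<or> b \<noteq> 0"
  obtains e c d where "e \<noteq> 0" "a * c + b * d = e" "e dvd a * c" "e dvd a * d" "e dvd b * c" "e dvd b * d"
proof -
  define I where "I = ideal.span {a, b}"
  have I: "ideal.subspace I" "a \<in> I" "b \<in> I" by (auto simp: I_def intro: ideal.span_base)
  obtain e where e: "e \<in> I" "e \<noteq> 0" using I assms(2) by blast
  let ?T = "{x * y | x y. x \<in> I \<and> y \<in> colon e I}"
  let ?C = "colon e I"
  let ?Q = "{p + q | p q. p \<in> {s. \<exists>c\<in>?C. 1 * s = a * c} \<and> q \<in> {s. \<exists>d\<in>?C. 1 * s = b * d}}"
  have "ideal.span ?T \<subseteq> ?Q"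
  proof (rule ideal.span_minimal)
    show "?T \<subseteq> ?Q"
    proof clarify
      fix x y assume xy: "x \<in> I" "y \<in> colon e I"
      obtain k where "x - k * a \<in> ideal.span {b}" using xy(1) by (auto simp: I_def ideal.span_insert)
      then obtain l where "x - k * a = l * b" by (auto simp: ideal.span_singleton)
      then have "x = k * a + l * b" by (simp add: algebra_simps)
      then have "x * y = a * (k * y) + b * (l * y)" by (simp add: algebra_simps)
      then show "\<exists>p q. x * y = p + q \<and> p \<in> {s. \<exists>c\<in>?C. 1 * s = a * c} \<and> q \<in> {s. \<exists>d\<in>?C. 1 * s = b * d}"
        using ideal.subspace_scale[OF colon_subspace xy(2)] by auto
    qed
    show "ideal.subspace ?Q"
      by (rule ideal_sum_subspace) (rule ideal_fraction_subspace[OF colon_subspace])+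
  qed
  then obtain c d where cd: "e = a * c + b * d" "c \<in> colon e I" "d \<in> colon e I"
    using dedekind_invertible[OF ded I(1) e] by auto
  have "e dvd x * y" if "x \<in> I" "y \<in> colon e I" for x y
    using that by (simp add: colon_def)
  then show ?thesis
    by (intro that[OF e(2) cd(1)[symmetric]]) (use I(2,3) cd(2,3) in blast)+
qed

section \<open>Ring homomorphisms\<close>

definition is_ring_hom :: "('a::comm_ring_1 \<Rightarrow> 'b::comm_ring_1) \<Rightarrow> bool" where
  "is_ring_hom h \<longleftrightarrow>
     h 1 = 1 \<and> (\<forall>x y. h (x + y) = h x + h y) \<and> (\<forall>x y. h (x * y) = h x * h y)"

lemma is_ring_homD:
  assumes "is_ring_hom h"
  shows "h 1 = 1" "h (x + y) = h x + h y" "h (x * y) = h x * h y"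
    "h 0 = 0" "h (- x) = - h x" "h (x - y) = h x - h y" "h (x ^ n) = h x ^ n" "h (sum g A) = (\<Sum>i\<in>A. h (g i))"
proof -
  show *: "h 1 = 1" "h (x + y) = h x + h y" "h (x * y) = h x * h y" for x y
    using assms by (auto simp: is_ring_hom_def)
  have "h 0 + h 0 = h 0" using *(2)[of 0 0] by simp
  then show 0: "h 0 = 0" by simp
  show minus: "h (- x) = - h x" for x using *(2)[of x "- x"] 0 by (simp add: eq_neg_iff_add_eq_0 add.commute)
  show "h (x - y) = h x - h y" using *(2)[of x "- y"] minus by simp
  show "h (x ^ n) = h x ^ n" by (induction n) (simp_all add: *)
  show "h (sum g A) = (\<Sum>i\<in>A. h (g i))" by (induction A rule: infinite_finite_induct) (simp_all add: * 0)
qed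

lemma is_ring_hom_of_nat:
  assumes "is_ring_hom h"
  shows "h (of_nat n) = of_nat n"
  by (induction n) (simp_all add: is_ring_homD[OF assms])

lemma is_ring_hom_comp: "is_ring_hom g \<Longrightarrow> is_ring_hom h \<Longrightarrow> is_ring_hom (\<lambda>x. g (h x))"
  by (simp add: is_ring_hom_def)

lemma is_ring_hom_map_poly:
  assumes "is_ring_hom h"
  shows "is_ring_hom (map_poly h)"
  unfolding is_ring_hom_def
  by (auto intro!: poly_eqI simp: coeff_map_poly is_ring_homD[OF assms] coeff_mult)

lemma is_ring_hom_const_poly: "is_ring_hom (\<lambda>c. [:c:])"
  by (auto simp: is_ring_hom_def one_pCons)

lemma is_ring_hom_pcompose:
  fixes q :: "'a::comm_ring_1 poly"
  shows "is_ring_hom (\<lambda>p. pcompose p q)"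
  by (simp add: is_ring_hom_def pcompose_add pcompose_mult pcompose_1)

lemma is_ring_hom_poly:
  fixes x :: "'a::comm_ring_1"
  shows "is_ring_hom (\<lambda>p. poly p x)"
  by (simp add: is_ring_hom_def)

section \<open>Prime ideals in polynomial rings\<close>

definition poly_ideal :: "'a::comm_ring_1 set \<Rightarrow> 'a poly set" where
  "poly_ideal P = {p. \<forall>i. coeff p i \<in> P}"

lemma poly_ideal_subspace:
  assumes P: "ideal.subspace P"
  shows "ideal.subspace (poly_ideal P)"
  unfolding subspace_iff poly_ideal_def
  by (auto simp: coeff_mult ideal.subspace_0[OF P]
      intro!: ideal.subspace_add[OF P] ideal.subspace_sum[OF P] ideal.subspace_scale[OF P])

lemma const_in_poly_ideal:
  assumes "ideal.subspace P"
  shows "[:c:] \<in> poly_ideal P \<longleftrightarrow> c \<in> P"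
  using ideal.subspace_0[OF assms] by (auto simp: poly_ideal_def coeff_pCons split: nat.splits)

text \<open>
  Multiply the top coefficients outside P. Besides primality of the extended ideal this
  yields the lower bound on the index that shows that a product with a nonconstant polynomial is
  nonconstant modulo P.
\<close>

lemma prime_ideal_top_coeff:
  assumes P: "prime_ideal P" and p: "coeff p i \<notin> P" and q: "coeff q j \<notin> P"
  obtains n where "n \<ge> i + j" "coeff (p * q) n \<notin> P"
proof -
  note Pp = prime_idealD[OF P]
  have 0: "0 \<in> P" by (rule ideal.subspace_0[OF Pp(1)])
  have top: "\<exists>d\<ge>k. coeff r d \<notin> P \<and> (\<forall>m>d. coeff r m \<in> P)" if "coeff r k \<notin> P" for r k
  proof -
    have "\<forall>m. coeff r m \<notin> P \<longrightarrow> m \<le> degree r" using 0 by (metis le_degree)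
    then have *: "finite {m. coeff r m \<notin> P}" by (meson finite_nat_set_iff_bounded_le mem_Collect_eq)
    have "Max {m. coeff r m \<notin> P} \<in> {m. coeff r m \<notin> P}" using * that by (intro Max_in) auto
    moreover have "coeff r m \<in> P" if "m > Max {m. coeff r m \<notin> P}" for m
      using Max_ge[OF *, of m] that by auto
    moreover have "Max {m. coeff r m \<notin> P} \<ge> k" using * that by (intro Max_ge) auto
    ultimately show ?thesis by blast
  qed
  obtain d where d: "d \<ge> i" "coeff p d \<notin> P" "\<And>m. m > d \<Longrightarrow> coeff p m \<in> P" using top[OF p] by blast
  obtain e where e: "e \<ge> j" "coeff q e \<notin> P" "\<And>m. m > e \<Longrightarrow> coeff q m \<in> P" using top[OF q] by blast
  have "coeff (p * q) (d + e) = coeff p d * coeff q e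
      + (\<Sum>k\<in>{..d + e} - {d}. coeff p k * coeff q (d + e - k))"
    unfolding coeff_mult by (subst sum.remove[of _ d]) auto
  moreover have "(\<Sum>k\<in>{..d + e} - {d}. coeff p k * coeff q (d + e - k)) \<in> P"
  proof (rule ideal.subspace_sum[OF Pp(1)])
    fix k assume "k \<in> {..d + e} - {d}"
    then have "k > d \<or> d + e - k > e" by auto
    then show "coeff p k * coeff q (d + e - k) \<in> P"
      using d(3) e(3) ideal_dvd_closed[OF Pp(1)] by (meson dvd_triv_left dvd_triv_right)
  qed
  moreover have "coeff p d * coeff q e \<notin> P" using d(2) e(2) Pp(3) by blast
  ultimately have "coeff (p * q) (d + e) \<notin> P"
    using ideal.subspace_diff[OF Pp(1)] by (metis add_diff_cancel_right')
  then show ?thesis using that[of "d + e"] d(1) e(1) by auto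
qed

lemma poly_ideal_prime:
  assumes "prime_ideal P"
  shows "prime_ideal (poly_ideal P)"
proof -
  note Pp = prime_idealD[OF assms]
  have "1 \<notin> poly_ideal P"
    using const_in_poly_ideal[OF Pp(1), of 1] Pp(2) by (simp add: one_pCons)
  moreover have "p \<in> poly_ideal P \<or> q \<in> poly_ideal P" if "p * q \<in> poly_ideal P" for p q
    using prime_ideal_top_coeff[OF assms] that unfolding poly_ideal_def mem_Collect_eq by metis
  ultimately show ?thesis
    unfolding prime_ideal_def using poly_ideal_subspace[OF Pp(1)] by blast
qed

text \<open>
  Modulo P the polynomial w is not constant, hence transcendental over the residue domain. In the
  induction, a + w Q(w) vanishes modulo P; if Q(w) did not, w Q(w) would be nonconstant.
\<close>

lemma pcompose_in_poly_ideal: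
  assumes P: "prime_ideal P" and w: "coeff w i \<notin> P" "i \<ge> 1"
    and "pcompose Q w \<in> poly_ideal P"
  shows "Q \<in> poly_ideal P"
  using assms(4)
proof (induction Q)
  case 0
  then show ?case by simp
next
  case (pCons a Q)
  note Pp = prime_idealD[OF P]
  have eq: "pcompose (pCons a Q) w = [:a:] + w * pcompose Q w" by (simp add: pcompose_pCons)
  have "pcompose Q w \<in> poly_ideal P"
  proof (rule ccontr)
    assume "pcompose Q w \<notin> poly_ideal P"
    then obtain j where "coeff (pcompose Q w) j \<notin> P" by (auto simp: poly_ideal_def)
    then obtain n where n: "n \<ge> i + j" "coeff (w * pcompose Q w) n \<notin> P"
      using prime_ideal_top_coeff[OF P w(1)] by blast
    then have "coeff (pcompose (pCons a Q) w) n \<notin> P"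
      unfolding eq using w(2) by (auto simp: coeff_pCons split: nat.splits)
    then show False using pCons.prems by (simp add: poly_ideal_def)
  qed
  then have Q: "Q \<in> poly_ideal P" and "w * pcompose Q w \<in> poly_ideal P"
    using pCons.IH ideal.subspace_scale[OF poly_ideal_subspace[OF Pp(1)]] by auto
  then have "[:a:] \<in> poly_ideal P"
    using pCons.prems ideal.subspace_diff[OF poly_ideal_subspace[OF Pp(1)]] unfolding eq
    by (metis add_diff_cancel_right')
  then show ?case
    using Q const_in_poly_ideal[OF Pp(1)] by (auto simp: poly_ideal_def coeff_pCons split: nat.splits)
qed

text \<open>
  The value at w \<in> C[V][Z] of a polynomial with coefficients in C.
\<close>

definition eval_in :: "'c::comm_ring_1 poly poly \<Rightarrow> 'c poly \<Rightarrow> 'c poly poly" where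
  "eval_in w Q = pcompose (map_poly (\<lambda>c. [:c:]) Q) w"

lemma eval_in_hom: "is_ring_hom (eval_in w)"
  unfolding eval_in_def
  by (rule is_ring_hom_comp[OF is_ring_hom_pcompose is_ring_hom_map_poly[OF is_ring_hom_const_poly]])

lemmas eval_in_simps = is_ring_homD[OF eval_in_hom]

lemma eval_in_pCons: "eval_in w (pCons c Q) = [:[:c:]:] + w * eval_in w Q"
  by (simp add: eval_in_def pcompose_pCons map_poly_pCons)

lemma eval_in_const: "eval_in w [:c:] = [:[:c:]:]"
  by (simp add: eval_in_def map_poly_pCons)

lemma eval_in_smult: "eval_in w (smult c Q) = smult [:c:] (eval_in w Q)"
  using eval_in_simps(3)[of w "[:c:]" Q] by (simp add: eval_in_const)

lemma eval_in_X: "eval_in w [:0, 1:] = w"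
  by (simp add: eval_in_pCons eval_in_simps flip: one_pCons)

text \<open>
  Modulo a prime of \<open>C\<close> that does not contain all coefficients of \<open>W = \<phi> Z - \<Gamma>(V)\<close>, the element
  \<open>W\<close> is nonconstant, hence transcendental over the residue domain.
\<close>

lemma eval_in_poly_ideal:
  fixes P :: "'c::comm_ring_1 set"
  assumes P: "prime_ideal P" and \<Gamma>0: "coeff \<Gamma> 0 = 0" and nt: "\<phi> \<notin> P \<or> (\<exists>i. coeff \<Gamma> i \<notin> P)"
    and Q: "eval_in [:- \<Gamma>, [:\<phi>:]:] Q \<in> poly_ideal (poly_ideal P)"
  shows "Q \<in> poly_ideal P"
proof (cases "\<phi> \<in> P")
  case False
  note Pp = prime_idealD[OF P]
  have "map_poly (\<lambda>c. [:c:]) Q \<in> poly_ideal (poly_ideal P)"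
  proof (rule pcompose_in_poly_ideal[OF poly_ideal_prime[OF P], where w = "[:- \<Gamma>, [:\<phi>:]:]" and i = 1])
    show "coeff [:- \<Gamma>, [:\<phi>:]:] 1 \<notin> poly_ideal P" using False const_in_poly_ideal[OF Pp(1)] by simp
  qed (use Q in \<open>simp_all add: eval_in_def\<close>)
  then show ?thesis
    by (simp add: poly_ideal_def[of "poly_ideal P"] coeff_map_poly const_in_poly_ideal[OF Pp(1)])
      (simp add: poly_ideal_def)
next
  case True
  note Pp = prime_idealD[OF P]
  then obtain i where i: "coeff \<Gamma> i \<notin> P" using nt True by blast
  then have "i \<noteq> 0" using \<Gamma>0 ideal.subspace_0[OF Pp(1)] by metis
  moreover have "coeff (- \<Gamma>) i \<notin> P" using i ideal.subspace_neg[OF Pp(1), of "- coeff \<Gamma> i"] by auto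
  moreover have "coeff (eval_in [:- \<Gamma>, [:\<phi>:]:] Q) 0 = pcompose Q (- \<Gamma>)"
    unfolding poly_0_coeff_0[symmetric] eval_in_def poly_pcompose
    by (simp add: pcompose_altdef)
  moreover have "coeff (eval_in [:- \<Gamma>, [:\<phi>:]:] Q) 0 \<in> poly_ideal P"
    using Q by (simp add: poly_ideal_def)
  ultimately show ?thesis using pcompose_in_poly_ideal[OF P, of "- \<Gamma>" i Q] by auto
qed

section \<open>Antiderivatives\<close>

definition nat_units :: "'c::comm_ring_1 itself \<Rightarrow> bool" where
  "nat_units _ \<longleftrightarrow> (\<forall>n. (of_nat (Suc n) :: 'c) dvd 1)"

lemma nat_units_if_contains_rationals:
  assumes "contains_rationals TYPE('a::comm_ring_1)"
  shows "nat_units TYPE('a)"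
  unfolding nat_units_def
proof
  fix n
  obtain \<phi> :: "rat \<Rightarrow> 'a" where \<phi>: "\<phi> 1 = 1" "\<And>x y. \<phi> (x + y) = \<phi> x + \<phi> y" "\<And>x y. \<phi> (x * y) = \<phi> x * \<phi> y"
    using assms unfolding contains_rationals_def by blast
  have hom: "is_ring_hom \<phi>" using \<phi> by (simp add: is_ring_hom_def)
  have "of_nat (Suc n) * \<phi> (1 / of_nat (Suc n)) = \<phi> (of_nat (Suc n) * (1 / of_nat (Suc n)))"
    unfolding \<phi>(3) is_ring_hom_of_nat[OF hom] ..
  also have "\<dots> = 1" using \<phi>(1) by (simp del: of_nat_Suc)
  finally show "(of_nat (Suc n) :: 'a) dvd 1" by (metis dvd_triv_left)
qed

lemma nat_units_poly:
  assumes "nat_units TYPE('c::comm_ring_1)"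
  shows "nat_units TYPE('c poly)"
  unfolding nat_units_def
proof
  fix n
  obtain c :: 'c where "1 = of_nat (Suc n) * c" using assms unfolding nat_units_def by (meson dvdE)
  then have "of_nat (Suc n) * [:c:] = 1"
    by (simp add: of_nat_poly one_pCons mult.commute del: of_nat_Suc)
  then show "(of_nat (Suc n) :: 'c poly) dvd 1" by (metis dvd_triv_left)
qed

lemma nat_units_nonzero:
  assumes "nat_units TYPE('c::comm_ring_1)"
  shows "(of_nat (Suc n) :: 'c) \<noteq> 0"
  using assms unfolding nat_units_def by (metis dvd_0_left_iff zero_neq_one)

lemma antiderivative_exists:
  fixes p :: "'c::idom poly"
  assumes "nat_units TYPE('c)"
  obtains q where "pderiv q = p" "coeff q 0 = 0"
proof -
  have "\<exists>c. of_nat (Suc n) * c = (1::'c)" for n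
    using assms unfolding nat_units_def by (metis dvdE)
  then obtain \<nu> where \<nu>: "\<And>n. of_nat (Suc n) * \<nu> n = (1::'c)" by metis
  define q where "q = (\<Sum>i\<le>degree p. monom (\<nu> i * coeff p i) (Suc i))"
  have c0: "coeff q 0 = 0" by (simp add: q_def coeff_sum)
  have cS: "coeff q (Suc n) = \<nu> n * coeff p n" for n
    by (simp add: q_def coeff_sum sum.delta' coeff_eq_0)
  have "coeff (pderiv q) n = coeff p n" for n
    unfolding coeff_pderiv cS mult.assoc[symmetric] \<nu> by simp
  then show ?thesis using that[of q] c0 by (simp add: poly_eq_iff)
qed

lemma pderiv_eq_0_imp_const:
  fixes p :: "'c::idom poly"
  assumes "nat_units TYPE('c)" "pderiv p = 0"
  shows "p = [:coeff p 0:]"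
proof (rule poly_eqI)
  fix n
  show "coeff p n = coeff [:coeff p 0:] n"
  proof (cases n)
    case (Suc m)
    have "of_nat (Suc m) * coeff p (Suc m) = 0"
      using assms(2) by (metis coeff_0 coeff_pderiv)
    then show ?thesis using nat_units_nonzero[OF assms(1), of m] Suc by auto
  qed simp
qed

lemma pderiv_inject:
  fixes p q :: "'c::idom poly"
  assumes "nat_units TYPE('c)" "pderiv p = pderiv q" "coeff p 0 = coeff q 0"
  shows "p = q"
proof -
  have "pderiv (p - q) = 0" using assms(2) by (simp add: pderiv_diff)
  from pderiv_eq_0_imp_const[OF assms(1) this] show ?thesis using assms(3) by simp
qed

lemma coeff_antiderivative_dvd:
  fixes p :: "'c::idom poly"
  assumes "nat_units TYPE('c)"
  shows "coeff (pderiv p) n dvd coeff p (Suc n)"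
proof -
  obtain c :: 'c where "1 = of_nat (Suc n) * c" using assms unfolding nat_units_def by (meson dvdE)
  then have "coeff p (Suc n) = (of_nat (Suc n) * coeff p (Suc n)) * c"
    by (metis mult.assoc mult.commute mult_1)
  then show ?thesis unfolding coeff_pderiv by (metis dvd_triv_left)
qed

section \<open>Triangular derivations\<close>

text \<open>The derivation \<open>f \<partial>\<^sub>V + g \<partial>\<^sub>Z\<close> of \<open>C[V][Z]\<close>, where \<open>f \<in> C\<close> and \<open>g \<in> C[V]\<close>.\<close>

definition tri :: "'c::idom \<Rightarrow> 'c poly \<Rightarrow> 'c poly poly \<Rightarrow> 'c poly poly" where
  "tri f g F = smult [:f:] (map_poly pderiv F) + smult g (pderiv F)"

lemma pderiv_sum: "pderiv (sum h A) = (\<Sum>i\<in>A. pderiv (h i))"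
  by (induction A rule: infinite_finite_induct) (simp_all add: pderiv_add)

lemma map_poly_pderiv_add: "map_poly pderiv (F + G) = map_poly pderiv F + map_poly pderiv G"
  by (rule poly_eqI) (simp add: coeff_map_poly pderiv_add)

lemma map_poly_pderiv_mult:
  fixes F G :: "'c::idom poly poly"
  shows "map_poly pderiv (F * G) = F * map_poly pderiv G + G * map_poly pderiv F"
proof (rule poly_eqI)
  fix n
  have "coeff (G * map_poly pderiv F) n = (\<Sum>i\<le>n. pderiv (coeff F i) * coeff G (n - i))"
    unfolding mult.commute[of G] coeff_mult by (simp add: coeff_map_poly)
  then show "coeff (map_poly pderiv (F * G)) n = coeff (F * map_poly pderiv G + G * map_poly pderiv F) n"
    by (simp add: coeff_map_poly coeff_mult pderiv_sum pderiv_mult sum.distrib mult.commute)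
qed

lemma tri_add: "tri f g (F + G) = tri f g F + tri f g G"
  by (simp add: tri_def map_poly_pderiv_add pderiv_add smult_add_right)

lemma tri_mult: "tri f g (F * G) = F * tri f g G + G * tri f g F"
  by (simp add: tri_def map_poly_pderiv_mult pderiv_mult smult_add_right algebra_simps)

lemma tri_const: "tri f g [:[:c:]:] = 0"
  by (simp add: tri_def map_poly_pCons)

lemma tri_V: "tri f g [:[:0, 1:]:] = [:[:f:]:]"
  by (simp add: tri_def map_poly_pCons pderiv_pCons)

lemma tri_Z: "tri f g [:0, 1:] = [:g:]"
  by (simp add: tri_def map_poly_pCons pderiv_pCons)

lemma tri_scale: "tri f g (smult [:c:] F) = smult [:c:] (tri f g F)"
  using tri_mult[of f g "[:[:c:]:]" F] by (simp add: tri_const)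

lemma tri_minus: "tri f g (- F) = - tri f g F"
proof -
  have "tri f g F + tri f g (- F) = 0"
    unfolding tri_add[symmetric] by (simp add: tri_def)
  then show ?thesis by (simp add: add_eq_0_iff2)
qed

lemma tri_diff: "tri f g (F - G) = tri f g F - tri f g G"
  using tri_add[of f g F "- G"] by (simp add: tri_minus)

lemma tri_power:
  assumes "tri f g F = 0"
  shows "tri f g (F ^ n) = 0"
  using assms by (induction n) (simp_all add: tri_mult tri_const one_pCons)

lemma tri_eval_in:
  assumes "tri f g w = 0"
  shows "tri f g (eval_in w Q) = 0"
  by (induction Q) (simp_all add: eval_in_simps tri_const[of f g 0, simplified] eval_in_pCons tri_add tri_mult tri_const assms)

text \<open>
  The chosen element is the classical first integral \<phi> Z - \<Gamma> of \<open>h \<phi> \<partial>\<^sub>V + h \<Gamma>' \<partial>\<^sub>Z\<close>.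
\<close>

lemma tri_first_integral:
  "tri (h * \<phi>) (smult h (pderiv \<Gamma>)) [:- \<Gamma>, [:\<phi>:]:] = 0"
  by (simp add: tri_def map_poly_pCons pderiv_pCons pderiv_minus mult.commute)

section \<open>Kernels of triangular derivations\<close>

text \<open>
  Compare leading coefficients in \<open>Z\<close>: that of a kernel element is constant in \<open>V\<close>, so it can be
  cancelled by a power of \<open>W = \<phi> Z - \<Gamma>\<close> after multiplication by a power of \<open>\<phi>\<close>.
\<close>

lemma tri_kernel_denominator:
  fixes F :: "'c::idom poly poly"
  assumes nu: "nat_units TYPE('c)" and \<phi>: "\<phi> \<noteq> 0" and "tri \<phi> (pderiv \<Gamma>) F = 0"
  shows "\<exists>q Q. q \<noteq> 0 \<and> smult [:q:] F = eval_in [:- \<Gamma>, [:\<phi>:]:] Q"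
  using assms(3)
proof (induction "degree F" arbitrary: F rule: less_induct)
  case less
  let ?w = "[:- \<Gamma>, [:\<phi>:]:]"
  let ?n = "degree F"
  have w: "tri \<phi> (pderiv \<Gamma>) ?w = 0" using tri_first_integral[of 1 \<phi> \<Gamma>] by simp
  have "coeff (tri \<phi> (pderiv \<Gamma>) F) ?n = smult \<phi> (pderiv (coeff F ?n))"
    by (simp add: tri_def coeff_map_poly coeff_pderiv coeff_eq_0)
  then have "pderiv (coeff F ?n) = 0" using less.prems \<phi> by simp
  then obtain c where c: "coeff F ?n = [:c:]" using pderiv_eq_0_imp_const[OF nu] by blast
  show ?case
  proof (cases "?n = 0")
    case True
    then have "F = [:[:c:]:]" using c by (metis degree_0_id)
    then have "smult [:1:] F = eval_in ?w [:c:]" by (simp add: eval_in_const)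
    then show ?thesis by (metis zero_neq_one)
  next
    case False
    define G where "G = smult [:\<phi> ^ ?n:] F - smult [:c:] (?w ^ ?n)"
    have dw: "degree ?w = 1" using \<phi> by simp
    have dwn: "degree (?w ^ ?n) = ?n" using \<phi> by (subst degree_power_eq) (auto simp: dw)
    have cwn: "coeff (?w ^ ?n) ?n = [:\<phi>:] ^ ?n"
      using lead_coeff_power[of ?w ?n] \<phi> unfolding dwn by simp
    have "degree G \<le> ?n" unfolding G_def
      by (intro degree_diff_le) (simp_all add: dwn)
    moreover have "coeff G ?n = 0"
      unfolding G_def coeff_diff using c cwn by (simp add: poly_const_pow mult.commute)
    ultimately have "degree G < ?n"
      using False by (metis eq_zero_or_degree_less le_neq_implies_less degree_0 neq0_conv leading_coeff_0_iff)
    moreover have "tri \<phi> (pderiv \<Gamma>) G = 0"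
      unfolding G_def tri_diff tri_scale less.prems tri_power[OF w] by simp
    ultimately obtain q Q where q: "q \<noteq> 0" "smult [:q:] G = eval_in ?w Q" using less.hyps by blast
    have "smult [:q * \<phi> ^ ?n:] F = smult [:q:] G + smult [:q:] (smult [:c:] (?w ^ ?n))"
      by (simp add: G_def smult_diff_right mult.commute)
    also have "\<dots> = eval_in ?w (Q + smult q (smult c ([:0, 1:] ^ ?n)))"
      by (simp only: eval_in_simps eval_in_smult eval_in_X q(2))
    finally show ?thesis using q(1) \<phi> by (metis no_zero_divisors power_not_zero)
  qed
qed

lemma field_poly_prime_divisor:
  fixes q :: "'k::field poly"
  assumes "degree q > 0"
  obtains \<pi> where "\<pi> dvd q" "degree \<pi> > 0" "prime_ideal {c. \<pi> dvd c}"
proof -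
  let ?S = "\<lambda>p. p dvd q \<and> degree p > 0"
  obtain \<pi> where \<pi>: "?S \<pi>" "\<And>p. ?S p \<Longrightarrow> degree \<pi> \<le> degree p"
    using ex_has_least_nat[of ?S q degree] assms by auto
  then have \<pi>0: "\<pi> \<noteq> 0" by auto
  have "irreducible \<pi>"
  proof (rule irreducibleI)
    show "\<not> \<pi> dvd 1" using \<pi>(1) by (auto simp: is_unit_poly_iff)
    fix a b assume ab: "\<pi> = a * b"
    then have nz: "a \<noteq> 0" "b \<noteq> 0" using \<pi>0 by auto
    have deg: "degree \<pi> = degree a + degree b" using ab nz degree_mult_eq by blast
    show "a dvd 1 \<or> b dvd 1"
    proof (cases "degree a > 0")
      case True
      then have "degree \<pi> \<le> degree a" using \<pi> ab by (meson dvd_mult_left)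
      then have "degree b = 0" using deg by simp
      then show ?thesis using nz by (metis is_unit_iff_degree)
    next
      case False
      then show ?thesis using nz by (metis is_unit_iff_degree neq0_conv)
    qed
  qed (rule \<pi>0)
  then have pr: "prime_elem \<pi>" by (rule field_poly_irreducible_imp_prime)
  have "prime_ideal {c. \<pi> dvd c}"
    unfolding prime_ideal_def
  proof (intro conjI allI impI)
    show "{c. \<pi> dvd c} \<noteq> UNIV" using prime_elem_not_unit[OF pr] by blast
    show "a \<in> {c. \<pi> dvd c} \<or> b \<in> {c. \<pi> dvd c}" if "a * b \<in> {c. \<pi> dvd c}" for a b
      using that prime_elem_dvd_mult_iff[OF pr] by simp
  qed (auto simp: subspace_iff)
  then show ?thesis using that \<pi>(1) by blast
qed

text \<open>
  Choose the denominator of smallest degree. A prime factor \<pi> of it divides the polynomial in W on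
  the right, hence all its coefficients by \<open>eval_in_poly_ideal\<close>, and can be cancelled.
\<close>

lemma tri_kernel_field:
  fixes F :: "'k::field poly poly poly"
  assumes nu: "nat_units TYPE('k)" and \<phi>: "\<phi> \<noteq> 0" and \<Gamma>0: "coeff \<Gamma> 0 = 0"
    and coprime: "\<And>\<pi>. \<pi> dvd \<phi> \<Longrightarrow> (\<And>i. \<pi> dvd coeff \<Gamma> i) \<Longrightarrow> \<pi> dvd 1"
    and F: "tri \<phi> (pderiv \<Gamma>) F = 0"
  obtains Q where "F = eval_in [:- \<Gamma>, [:\<phi>:]:] Q"
proof -
  let ?w = "[:- \<Gamma>, [:\<phi>:]:]"
  have *: "\<exists>Q. F = eval_in ?w Q" if "q \<noteq> 0" "smult [:q:] F = eval_in ?w Q" for q Q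
    using that
  proof (induction "degree q" arbitrary: q Q rule: less_induct)
    case less
    show ?case
    proof (cases "degree q = 0")
      case True
      then obtain k where k: "q = [:k:]" "k \<noteq> 0" using less.prems(1) by (metis degree_0_id pCons_eq_0_iff)
      have "eval_in ?w (smult [:inverse k:] Q) = [:[:[:inverse k:] * q:]:] * F"
        unfolding eval_in_smult less.prems(2)[symmetric] by simp
      also have "\<dots> = F" using k by (simp flip: one_pCons)
      finally show ?thesis by metis
    next
      case False
      then obtain \<pi> where \<pi>: "\<pi> dvd q" "degree \<pi> > 0" "prime_ideal {c. \<pi> dvd c}"
        using field_poly_prime_divisor by blast
      obtain q1 where q1: "q = \<pi> * q1" using \<pi>(1) by (auto elim: dvdE)
      have nz: "\<pi> \<noteq> 0" "q1 \<noteq> 0" using q1 less.prems(1) by auto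
      have "\<not> \<pi> dvd 1" using \<pi>(2) by (auto simp: is_unit_poly_iff)
      then have "\<phi> \<notin> {c. \<pi> dvd c} \<or> (\<exists>i. coeff \<Gamma> i \<notin> {c. \<pi> dvd c})" using coprime by auto
      moreover have "eval_in ?w Q \<in> poly_ideal (poly_ideal {c. \<pi> dvd c})"
        unfolding less.prems(2)[symmetric] by (simp add: poly_ideal_def q1 mult.assoc)
      ultimately have "Q \<in> poly_ideal {c. \<pi> dvd c}"
        by (rule eval_in_poly_ideal[OF \<pi>(3) \<Gamma>0])
      then have "[:\<pi>:] dvd Q" by (simp add: poly_ideal_def const_poly_dvd_iff)
      then obtain Q1 where Q1: "Q = smult \<pi> Q1" by (auto elim: dvdE)
      have "smult [:\<pi>:] (smult [:q1:] F) = smult [:\<pi>:] (eval_in ?w Q1)"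
        using less.prems(2) unfolding Q1 eval_in_smult q1 by (simp add: mult.commute)
      then have "smult [:\<pi>:] (smult [:q1:] F - eval_in ?w Q1) = 0" by (simp only: smult_diff_right) simp
      then have "smult [:q1:] F - eval_in ?w Q1 = 0" using nz(1) unfolding smult_eq_0_iff by simp
      then have "smult [:q1:] F = eval_in ?w Q1" by simp
      moreover have "degree q1 < degree q" using nz \<pi>(2) by (simp add: q1 degree_mult_eq)
      ultimately show ?thesis using less.hyps nz(2) by blast
    qed
  qed
  then show ?thesis using tri_kernel_denominator[OF nat_units_poly[OF nu] \<phi> F] that by blast
qed

section \<open>Slices of triangular derivations\<close>

lemma poly_ideal_add_principal:
  assumes I: "ideal.subspace I" and "p \<in> poly_ideal {i + r * c | i r. i \<in> I}"
  obtains \<alpha> \<beta> where "p = \<alpha> + smult c \<beta>" "\<alpha> \<in> poly_ideal I"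
proof -
  have "\<exists>\<alpha> \<beta>. p = \<alpha> + smult c \<beta> \<and> \<alpha> \<in> poly_ideal I"
    using assms(2)
  proof (induction p)
    case 0
    then show ?case using ideal.subspace_0[OF poly_ideal_subspace[OF I]]
      by (intro exI[of _ 0]) simp
  next
    case (pCons a p)
    have "coeff (pCons a p) (Suc n) \<in> {i + r * c | i r. i \<in> I}" for n
      using pCons.prems unfolding poly_ideal_def by blast
    then have "p \<in> poly_ideal {i + r * c | i r. i \<in> I}" by (simp add: poly_ideal_def)
    then obtain \<alpha> \<beta> where *: "p = \<alpha> + smult c \<beta>" "\<alpha> \<in> poly_ideal I" using pCons.IH by blast
    have "coeff (pCons a p) 0 \<in> {i + r * c | i r. i \<in> I}"
      using pCons.prems unfolding poly_ideal_def by blast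
    then obtain i r where ir: "a = i + r * c" "i \<in> I" by auto
    have "pCons a p = pCons i \<alpha> + smult c (pCons r \<beta>)" using * ir by (simp add: mult.commute)
    moreover have "pCons i \<alpha> \<in> poly_ideal I"
      using * ir by (simp add: poly_ideal_def coeff_pCons split: nat.splits)
    ultimately show ?case by blast
  qed
  then show ?thesis using that by blast
qed

text \<open>
  The polynomials whose class modulo \<open>I\<close> lies in \<open>C[\<Gamma>]\<close> after inverting \<open>\<tau>\<close>.
\<close>

definition generated_mod :: "'c::comm_ring_1 \<Rightarrow> 'c poly \<Rightarrow> 'c set \<Rightarrow> 'c poly set" where
  "generated_mod \<tau> \<Gamma> I = {p. \<exists>M Q. smult (\<tau> ^ M) p - pcompose Q \<Gamma> \<in> poly_ideal I}"

lemma generated_modI: "smult (\<tau> ^ M) p - pcompose Q \<Gamma> \<in> poly_ideal I \<Longrightarrow> p \<in> generated_mod \<tau> \<Gamma> I"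
  by (auto simp: generated_mod_def)

text \<open>
  The set in question is closed under sums and products and contains C.
\<close>

lemma generated_mod_UNIV:
  assumes I: "ideal.subspace I" and V: "[:0, 1:] \<in> generated_mod \<tau> \<Gamma> I"
  shows "p \<in> generated_mod \<tau> \<Gamma> I"
proof (induction p)
  case 0
  have "smult (\<tau> ^ 0) 0 - pcompose 0 \<Gamma> \<in> poly_ideal I"
    using ideal.subspace_0[OF poly_ideal_subspace[OF I]] by simp
  then show ?case by (rule generated_modI)
next
  case (pCons a p)
  note J = poly_ideal_subspace[OF I]
  obtain M Q where 1: "smult (\<tau> ^ M) [:0, 1:] - pcompose Q \<Gamma> \<in> poly_ideal I" (is "?x \<in> _")
    using V unfolding generated_mod_def by blast
  obtain M' Q' where 2: "smult (\<tau> ^ M') p - pcompose Q' \<Gamma> \<in> poly_ideal I" (is "?y \<in> _")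
    using pCons.IH unfolding generated_mod_def by blast
  have split: "pCons a p = [:a:] + [:0, 1:] * p" by simp
  have "smult (\<tau> ^ (M + M')) (pCons a p) - pcompose ([:a * \<tau> ^ (M + M'):] + Q * Q') \<Gamma>
      = smult (\<tau> ^ M') p * ?x + pcompose Q \<Gamma> * ?y"
    unfolding split pcompose_add pcompose_mult
    by (simp add: algebra_simps power_add smult_add_right smult_diff_right)
  moreover have "smult (\<tau> ^ M') p * ?x + pcompose Q \<Gamma> * ?y \<in> poly_ideal I"
    by (intro ideal.subspace_add[OF J] ideal.subspace_scale[OF J] 1 2)
  ultimately show ?case using generated_modI by metis
qed

text \<open>
  Substitute one representation into the remainder of the other: the remainders c \<beta> and d \<beta>'
  combine to a multiple of c d. This is what makes a maximal counterexample prime.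
\<close>

lemma generated_mod_product:
  assumes I: "ideal.subspace I" and cd: "c * d \<in> I"
    and c: "[:0, 1:] \<in> generated_mod \<tau> \<Gamma> {i + r * c | i r. i \<in> I}"
    and d: "[:0, 1:] \<in> generated_mod \<tau> \<Gamma> {i + r * d | i r. i \<in> I}"
  shows "[:0, 1:] \<in> generated_mod \<tau> \<Gamma> I"
proof -
  note J = poly_ideal_subspace[OF I]
  obtain M Q where 1: "smult (\<tau> ^ M) [:0, 1:] - pcompose Q \<Gamma> \<in> poly_ideal {i + r * c | i r. i \<in> I}"
    using c unfolding generated_mod_def by blast
  obtain \<alpha> \<beta> where \<alpha>: "smult (\<tau> ^ M) [:0, 1:] - pcompose Q \<Gamma> = \<alpha> + smult c \<beta>" "\<alpha> \<in> poly_ideal I"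
    using poly_ideal_add_principal[OF I 1] by blast
  have "\<beta> \<in> generated_mod \<tau> \<Gamma> {i + r * d | i r. i \<in> I}"
    by (rule generated_mod_UNIV[OF ideal_add_principal(1)[OF I] d])
  then obtain M' Q' where 2: "smult (\<tau> ^ M') \<beta> - pcompose Q' \<Gamma> \<in> poly_ideal {i + r * d | i r. i \<in> I}"
    unfolding generated_mod_def by blast
  obtain \<alpha>' \<beta>' where \<alpha>': "smult (\<tau> ^ M') \<beta> - pcompose Q' \<Gamma> = \<alpha>' + smult d \<beta>'" "\<alpha>' \<in> poly_ideal I"
    using poly_ideal_add_principal[OF I 2] by blast
  have "smult (\<tau> ^ (M + M')) [:0, 1:] - pcompose (smult (\<tau> ^ M') Q + smult c Q') \<Gamma>
      = smult (\<tau> ^ M') (smult (\<tau> ^ M) [:0, 1:] - pcompose Q \<Gamma>) - smult c (pcompose Q' \<Gamma>)"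
    by (simp add: pcompose_add pcompose_smult power_add smult_diff_right mult.commute)
  also have "\<dots> = smult (\<tau> ^ M') \<alpha> + smult c (smult (\<tau> ^ M') \<beta> - pcompose Q' \<Gamma>)"
    unfolding \<alpha>(1) by (simp add: smult_add_right smult_diff_right mult.commute)
  also have "\<dots> = [:\<tau> ^ M':] * \<alpha> + ([:c:] * \<alpha>' + \<beta>' * [:c * d:])"
    unfolding \<alpha>'(1) by (simp add: smult_add_right)
  also have "\<dots> \<in> poly_ideal I"
    using \<alpha>(2) \<alpha>'(2) cd const_in_poly_ideal[OF I, of "c * d"]
    by (intro ideal.subspace_add[OF J] ideal.subspace_scale[OF J]) auto
  finally show ?thesis by (rule generated_modI)
qed

text \<open>
  Modulo a prime containing \<open>f\<close> but not \<open>\<tau>\<close>, the polynomial \<open>g\<close> becomes a unit after inverting \<open>\<tau>\<close>,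
  hence a constant, and its antiderivative is a multiple of \<open>V\<close>.
\<close>

lemma generated_mod_prime:
  fixes g :: "'c::idom poly"
  assumes nu: "nat_units TYPE('c)" and P: "prime_ideal P" and f: "f \<in> P"
    and \<Gamma>: "coeff \<Gamma> 0 = 0" "pderiv \<Gamma> = g" and \<tau>: "[:f:] * p + g * q = [:\<tau>:]"
  shows "[:0, 1:] \<in> generated_mod \<tau> \<Gamma> P"
proof -
  note Pp = prime_idealD[OF P]
  note PS = poly_ideal_subspace[OF Pp(1)]
  show ?thesis
  proof (cases "\<tau> \<in> P")
    case True
    then have "smult (\<tau> ^ 1) [:0, 1:] - pcompose 0 \<Gamma> \<in> poly_ideal P"
      using ideal.subspace_0[OF Pp(1)] by (auto simp: poly_ideal_def coeff_pCons split: nat.splits)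
    then show ?thesis by (rule generated_modI)
  next
    case False
    have gq: "coeff (g * q) n - coeff [:\<tau>:] n \<in> P" for n
    proof -
      have "coeff [:\<tau>:] n = f * coeff p n + coeff (g * q) n" unfolding \<tau>[symmetric] by simp
      then have "coeff (g * q) n - coeff [:\<tau>:] n = - coeff p n * f" by (simp add: mult.commute)
      then show ?thesis using ideal.subspace_scale[OF Pp(1) f] by metis
    qed
    have "\<exists>j. coeff q j \<notin> P"
    proof (rule ccontr)
      assume "\<nexists>j. coeff q j \<notin> P"
      then have "g * q \<in> poly_ideal P"
        by (intro ideal.subspace_scale[OF PS]) (simp add: poly_ideal_def)
      then have c0: "coeff (g * q) 0 \<in> P" by (simp add: poly_ideal_def)
      from ideal.subspace_diff[OF Pp(1) c0 gq[of 0]] show False using False by simp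
    qed
    then obtain j where j: "coeff q j \<notin> P" by blast
    have gi: "coeff g i \<in> P" if "i \<ge> 1" for i
    proof (rule ccontr)
      assume "coeff g i \<notin> P"
      then obtain n where n: "n \<ge> i + j" "coeff (g * q) n \<notin> P" using prime_ideal_top_coeff[OF P _ j] by blast
      then have "coeff [:\<tau>:] n = 0" using that by (cases n) auto
      then show False using gq[of n] n(2) by simp
    qed
    have "coeff (smult (\<tau> ^ 1) [:0, 1:] - pcompose [:0, coeff q 0:] \<Gamma>) n \<in> P" for n
    proof -
      have eq: "pcompose [:0, coeff q 0:] \<Gamma> = smult (coeff q 0) \<Gamma>"
        by (simp add: pcompose_pCons mult.commute)
      consider "n = 0" | "n = 1" | m where "n = Suc m" "m \<ge> 1" by (cases n) force+
      then show ?thesis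
      proof cases
        case 1
        then show ?thesis unfolding eq using \<Gamma>(1) ideal.subspace_0[OF Pp(1)] by simp
      next
        case 2
        have "coeff \<Gamma> 1 = coeff g 0" unfolding \<Gamma>(2)[symmetric] coeff_pderiv by simp
        moreover have "coeff (g * q) 0 = coeff g 0 * coeff q 0" by (simp add: coeff_mult_0)
        ultimately have "coeff (smult (\<tau> ^ 1) [:0, 1:] - pcompose [:0, coeff q 0:] \<Gamma>) n
            = - (coeff (g * q) 0 - coeff [:\<tau>:] 0)"
          unfolding eq 2 by simp
        then show ?thesis using ideal.subspace_neg[OF Pp(1) gq[of 0]] by simp
      next
        case 3
        have "coeff \<Gamma> n \<in> P"
          using coeff_antiderivative_dvd[OF nu, of \<Gamma> m] gi[OF 3(2)] ideal_dvd_closed[OF Pp(1)]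
          unfolding 3 \<Gamma>(2) by blast
        moreover have "coeff [:0, \<tau>:] n = 0" using 3 by (auto simp: coeff_pCons split: nat.splits)
        ultimately show ?thesis unfolding eq
          using ideal.subspace_neg[OF Pp(1) ideal.subspace_scale[OF Pp(1), of "coeff \<Gamma> n" "coeff q 0"]]
          by simp
      qed
    qed
    then have "smult (\<tau> ^ 1) [:0, 1:] - pcompose [:0, coeff q 0:] \<Gamma> \<in> poly_ideal P"
      by (simp add: poly_ideal_def)
    then show ?thesis by (rule generated_modI)
  qed
qed

text \<open>
  The counterexamples form an inductive family, since only finitely many coefficients are involved
  in a representation of V. A maximal one is prime, contradicting \<open>generated_mod_prime\<close>.
\<close>

lemma generated_mod_all:
  fixes g :: "'c::idom poly"
  assumes nu: "nat_units TYPE('c)"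
    and \<Gamma>: "coeff \<Gamma> 0 = 0" "pderiv \<Gamma> = g" and \<tau>: "[:f:] * p + g * q = [:\<tau>:]"
    and I: "ideal.subspace I" "f \<in> I"
  shows "[:0, 1:] \<in> generated_mod \<tau> \<Gamma> I"
proof (rule ccontr)
  assume bad: "[:0, 1:] \<notin> generated_mod \<tau> \<Gamma> I"
  let ?A = "{I. ideal.subspace I \<and> f \<in> I \<and> [:0, 1:] \<notin> generated_mod \<tau> \<Gamma> I}"
  have "\<exists>P\<in>?A. \<forall>I\<in>?A. P \<subseteq> I \<longrightarrow> I = P"
  proof (rule subset_Zorn_nonempty)
    show "?A \<noteq> {}" using bad I by blast
    fix C assume C: "C \<noteq> {}" "subset.chain ?A C"
    then have CA: "C \<subseteq> ?A" by (auto simp: subset_chain_def)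
    then have CD: "ideal.subspace J" "f \<in> J" "[:0, 1:] \<notin> generated_mod \<tau> \<Gamma> J" if "J \<in> C" for J
      using that by auto
    have sub: "ideal.subspace (\<Union>C)"
      by (rule ideal_chain_Union[OF _ C(2,1)]) (rule CD(1))
    have "[:0, 1:] \<notin> generated_mod \<tau> \<Gamma> (\<Union>C)"
    proof
      assume "[:0, 1:] \<in> generated_mod \<tau> \<Gamma> (\<Union>C)"
      then obtain M Q where MQ: "smult (\<tau> ^ M) [:0, 1:] - pcompose Q \<Gamma> \<in> poly_ideal (\<Union>C)" (is "?x \<in> _")
        unfolding generated_mod_def by blast
      have "finite (set (coeffs ?x))" "set (coeffs ?x) \<subseteq> \<Union>C"
        using MQ by (auto simp: poly_ideal_def coeffs_def)
      then obtain J where J: "J \<in> C" "set (coeffs ?x) \<subseteq> J"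
        using finite_subset_Union_chain[OF _ _ C] by blast
      have "range (coeff ?x) \<subseteq> J"
        unfolding range_coeff using J CD(1) ideal.subspace_0 by blast
      then have "?x \<in> poly_ideal J" unfolding poly_ideal_def by blast
      then show False using CD(3)[OF J(1)] generated_modI by blast
    qed
    then show "\<Union>C \<in> ?A" using sub CD(2) C(1) by blast
  qed
  then obtain P where P: "P \<in> ?A" "\<forall>I\<in>?A. P \<subseteq> I \<longrightarrow> I = P" by (rule bexE)
  have PD: "ideal.subspace P" "f \<in> P" "[:0, 1:] \<notin> generated_mod \<tau> \<Gamma> P" using P(1) by auto
  have "prime_ideal P" unfolding prime_ideal_def
  proof (intro conjI allI impI)
    have "[:0, 1:] \<in> generated_mod \<tau> \<Gamma> UNIV" by (rule generated_modI[of _ 0 _ 0]) (simp add: poly_ideal_def)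
    then show "P \<noteq> UNIV" using PD(3) by metis
    fix c d assume cd: "c * d \<in> P"
    have *: "[:0, 1:] \<in> generated_mod \<tau> \<Gamma> {i + r * x | i r. i \<in> P}" if "x \<notin> P" for x
    proof (rule ccontr)
      let ?J = "{i + r * x | i r. i \<in> P}"
      note J = ideal_add_principal[OF PD(1), of x]
      assume "[:0, 1:] \<notin> generated_mod \<tau> \<Gamma> ?J"
      then have "?J \<in> ?A" using J(1,2) PD(2) by blast
      then have "?J = P" using P(2) J(2) by blast
      then show False using J(3) that by blast
    qed
    show "c \<in> P \<or> d \<in> P" using generated_mod_product[OF PD(1) cd] * PD(3) by blast
  qed (rule PD(1))
  then show False using generated_mod_prime[OF nu _ PD(2) \<Gamma> \<tau>] PD(3) by blast
qed

text \<open>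
  Write \<tau>^M V = Q(\<Gamma>) + f t. As \<Gamma> and -W differ by a multiple of f, also
  \<tau>^M V = Q(-W) + f s. Applying the derivation, which kills W and maps V to f, and cancelling f
  gives the value \<tau>^M at s.
\<close>

lemma tri_slice:
  fixes g :: "'c::idom poly"
  assumes nu: "nat_units TYPE('c)" and f: "f \<noteq> 0" and \<tau>: "[:f:] * p + g * q = [:\<tau>:]"
  obtains s M where "tri f g s = [:[:\<tau> ^ M:]:]"
proof -
  obtain \<Gamma> where \<Gamma>: "pderiv \<Gamma> = g" "coeff \<Gamma> 0 = 0" by (rule antiderivative_exists[OF nu])
  have "[:0, 1:] \<in> generated_mod \<tau> \<Gamma> (range (\<lambda>r. r * f))"
    by (rule generated_mod_all[OF nu \<Gamma>(2,1) \<tau>])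
      (auto simp: ideal.span_singleton[symmetric] intro: ideal.span_base)
  then obtain M Q where MQ: "smult (\<tau> ^ M) [:0, 1:] - pcompose Q \<Gamma> \<in> poly_ideal (range (\<lambda>r. r * f))"
    unfolding generated_mod_def by blast
  then have "[:f:] dvd smult (\<tau> ^ M) [:0, 1:] - pcompose Q \<Gamma>"
    unfolding const_poly_dvd_iff poly_ideal_def by (auto simp: dvd_def mult.commute)
  then obtain t where t: "smult (\<tau> ^ M) [:0, 1:] - pcompose Q \<Gamma> = [:f:] * t" by (auto elim: dvdE)
  let ?w = "[:- \<Gamma>, [:f:]:]"
  have "\<exists>t'. eval_in (- ?w) Q = [:pcompose Q \<Gamma>:] + smult [:f:] t'"
  proof (induction Q)
    case 0
    show ?case by (rule exI[of _ 0]) (simp add: eval_in_simps)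
  next
    case (pCons c Q)
    then obtain t' where t': "eval_in (- ?w) Q = [:pcompose Q \<Gamma>:] + smult [:f:] t'" by blast
    have w: "- ?w = [:\<Gamma>:] + smult [:f:] [:0, - 1:]" by simp
    have "- ?w * eval_in (- ?w) Q
        = [:\<Gamma>:] * eval_in (- ?w) Q + smult [:f:] ([:0, - 1:] * eval_in (- ?w) Q)"
      by (subst w) (simp only: distrib_right mult_smult_left)
    also have "[:\<Gamma>:] * eval_in (- ?w) Q = [:\<Gamma> * pcompose Q \<Gamma>:] + smult [:f:] ([:\<Gamma>:] * t')"
      unfolding t' by (simp add: smult_add_right mult.commute)
    finally have "eval_in (- ?w) (pCons c Q)
        = [:pcompose (pCons c Q) \<Gamma>:] + smult [:f:] ([:0, - 1:] * eval_in (- ?w) Q + [:\<Gamma>:] * t')"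
      unfolding eval_in_pCons pcompose_pCons smult_add_right by simp
    then show ?case by blast
  qed
  then obtain t' where t': "eval_in (- ?w) Q = [:pcompose Q \<Gamma>:] + smult [:f:] t'" by blast
  define s where "s = [:t:] - t'"
  have s: "smult [:f:] s = smult [:\<tau> ^ M:] [:[:0, 1:]:] - eval_in (- ?w) Q"
  proof -
    have "smult [:f:] s = [:[:f:] * t:] - smult [:f:] t'" by (simp add: s_def smult_diff_right)
    also have "\<dots> = [:smult (\<tau> ^ M) [:0, 1:]:] - eval_in (- ?w) Q"
      unfolding t[symmetric] t' by simp
    finally show ?thesis by simp
  qed
  have w: "tri f g (- ?w) = 0"
    using tri_first_integral[of 1 f \<Gamma>] \<Gamma>(1) by (simp add: tri_minus del: minus_pCons)
  have "smult [:f:] (tri f g s) = smult [:f:] [:[:\<tau> ^ M:]:]"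
    unfolding tri_scale[symmetric] s tri_diff tri_eval_in[OF w]
    by (simp add: tri_scale tri_V del: smult_pCons) (simp add: mult.commute)
  then have "smult [:f:] (tri f g s - [:[:\<tau> ^ M:]:]) = 0" by (simp only: smult_diff_right) simp
  then have "tri f g s = [:[:\<tau> ^ M:]:]" using f unfolding smult_eq_0_iff by simp
  then show ?thesis by (rule that)
qed

section \<open>Polynomial rings in three variables\<close>

lemma poly3_induct [case_names const X Y Z add mult]:
  fixes F :: "'a::comm_ring_1 poly3"
  assumes "\<And>r. P (const3 r)" "P var_X" "P var_Y" "P var_Z"
    and add: "\<And>F G. P F \<Longrightarrow> P G \<Longrightarrow> P (F + G)" and mult: "\<And>F G. P F \<Longrightarrow> P G \<Longrightarrow> P (F * G)"
  shows "P F"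
proof -
  have 1: "P [:[:p:]:]" for p :: "'a poly"
  proof (induction p)
    case 0
    then show ?case using assms(1)[of 0] by (simp add: const3_def)
  next
    case (pCons a p)
    have "[:[:pCons a p:]:] = const3 a + var_X * [:[:p:]:]" by (simp add: const3_def var_X_def)
    then show ?case by (simp only:) (intro add mult assms(1,2) pCons.IH)
  qed
  have 2: "P [:p:]" for p :: "'a poly poly"
  proof (induction p)
    case 0
    then show ?case using assms(1)[of 0] by (simp add: const3_def)
  next
    case (pCons a p)
    have "[:pCons a p:] = [:[:a:]:] + var_Y * [:p:]" by (simp add: var_Y_def)
    then show ?case by (simp only:) (intro add mult assms(3) 1 pCons.IH)
  qed
  show ?thesis
  proof (induction F)
    case 0
    then show ?case using assms(1)[of 0] by (simp add: const3_def)
  next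
    case (pCons a p)
    have "pCons a p = [:a:] + var_Z * p" by (simp add: var_Z_def)
    then show ?case by (simp only:) (intro add mult assms(4) 2 pCons.IH)
  qed
qed

lemma is_ring_hom_const3: "is_ring_hom const3"
  by (simp add: is_ring_hom_def const3_def one_pCons)

lemmas const3_simps = is_ring_homD[OF is_ring_hom_const3]

lemma is_ring_hom_to_fract: "is_ring_hom to_fract"
  by (simp add: is_ring_hom_def)

abbreviation scalar :: "'a::idom \<Rightarrow> 'a fract poly3" where
  "scalar r \<equiv> const3 (to_fract r)"

lemma to_fract_power: "to_fract (c ^ n) = to_fract c ^ n"
  by (rule is_ring_homD(7)[OF is_ring_hom_to_fract])

lemma const3_eq_0_iff [simp]: "const3 c = 0 \<longleftrightarrow> c = 0"
  by (simp add: const3_def)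

lemma poly3_hom_eqI:
  fixes h :: "'a::comm_ring_1 poly3 \<Rightarrow> 'b::comm_ring_1"
  assumes "is_ring_hom h" "is_ring_hom h'" "\<And>r. h (const3 r) = h' (const3 r)"
    "h var_X = h' var_X" "h var_Y = h' var_Y" "h var_Z = h' var_Z"
  shows "h F = h' F"
  by (induction F rule: poly3_induct)
    (simp_all add: assms(3-) is_ring_homD[OF assms(1)] is_ring_homD[OF assms(2)])

lemma poly3_derivation_eqI:
  fixes h \<delta> \<delta>' :: "'a::comm_ring_1 poly3 \<Rightarrow> 'b::comm_ring_1"
  assumes "\<And>F G. \<delta> (F + G) = \<delta> F + \<delta> G" "\<And>F G. \<delta> (F * G) = h F * \<delta> G + h G * \<delta> F"
    and "\<And>F G. \<delta>' (F + G) = \<delta>' F + \<delta>' G" "\<And>F G. \<delta>' (F * G) = h F * \<delta>' G + h G * \<delta>' F"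
    and "\<And>r. \<delta> (const3 r) = \<delta>' (const3 r)" "\<delta> var_X = \<delta>' var_X" "\<delta> var_Y = \<delta>' var_Y" "\<delta> var_Z = \<delta>' var_Z"
  shows "\<delta> F = \<delta>' F"
  by (induction F rule: poly3_induct) (simp_all add: assms)

lemma derivationD:
  fixes D :: "'a::comm_ring_1 poly3 \<Rightarrow> 'a poly3"
  assumes "derivation const3 D"
  shows "D (F + G) = D F + D G" "D (F * G) = F * D G + G * D F" "D (const3 r) = 0"
    "D (const3 r * F) = const3 r * D F" "D (F - G) = D F - D G" "D 0 = 0"
proof -
  show *: "D (F + G) = D F + D G" "D (F * G) = F * D G + G * D F" "D (const3 r * F) = const3 r * D F"
    for F G r using assms by (auto simp: derivation_def)
  have "D 1 + D 1 = D 1" using *(2)[of 1 1] by simp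
  then have "D 1 = 0" by simp
  then show c: "D (const3 r) = 0" for r using *(3)[of r 1] by simp
  then show "D 0 = 0" using c[of 0] by (simp add: const3_simps)
  have "F - G = F + const3 (- 1) * G" by (simp add: const3_simps)
  then show "D (F - G) = D F - D G" 
    using c[of "- 1"] by (simp only: * const3_simps) (simp add: const3_simps)
qed

definition subst3 :: "('a::comm_ring_1 \<Rightarrow> 'b::comm_ring_1) \<Rightarrow> 'b \<Rightarrow> 'b \<Rightarrow> 'b \<Rightarrow> 'a poly3 \<Rightarrow> 'b" where
  "subst3 h p q r F = poly (map_poly (\<lambda>G. poly (map_poly (\<lambda>H. poly (map_poly h H) p) G) q) F) r"

lemma subst3_hom:
  assumes "is_ring_hom h"
  shows "is_ring_hom (subst3 h p q r)"
  unfolding subst3_def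
  by (intro is_ring_hom_comp[OF is_ring_hom_poly] is_ring_hom_map_poly assms)

lemma subst3_gens:
  assumes h: "is_ring_hom h"
  shows "subst3 h p q r (const3 c) = h c" "subst3 h p q r var_X = p"
    "subst3 h p q r var_Y = q" "subst3 h p q r var_Z = r"
proof -
  note h1 = is_ring_hom_comp[OF is_ring_hom_poly[of p] is_ring_hom_map_poly[OF h]]
  note h2 = is_ring_hom_comp[OF is_ring_hom_poly[of q] is_ring_hom_map_poly[OF h1]]
  note s = is_ring_homD[OF h] map_poly_pCons
  show "subst3 h p q r (const3 c) = h c"
    by (simp add: subst3_def const3_def map_poly_pCons is_ring_homD[OF h])
  show "subst3 h p q r var_X = p"
    by (simp add: subst3_def var_X_def map_poly_pCons is_ring_homD[OF h])
  show "subst3 h p q r var_Y = q"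
    using is_ring_homD(1)[OF h1] by (simp add: subst3_def var_Y_def map_poly_pCons is_ring_homD[OF h])
  show "subst3 h p q r var_Z = r"
    using is_ring_homD(1)[OF h2] by (simp add: subst3_def var_Z_def map_poly_pCons is_ring_homD[OF h])
qed

lemma to_fract_of_nat: "to_fract (of_nat n) = of_nat n"
  by (induction n) simp_all

lemma fract_poly3_hom: "is_ring_hom (fract_poly3 :: 'a::idom poly3 \<Rightarrow> _)"
  unfolding fract_poly3_def by (intro is_ring_hom_map_poly is_ring_hom_to_fract)

lemma coeff_fract_poly3:
  "coeff (coeff (coeff (fract_poly3 F) k) j) i = to_fract (coeff (coeff (coeff F k) j) i)"
  by (simp add: fract_poly3_def coeff_map_poly)

lemma fract_poly3_gens [simp]:
  "fract_poly3 (const3 c) = scalar c" "fract_poly3 var_X = var_X"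
  "fract_poly3 var_Y = var_Y" "fract_poly3 var_Z = var_Z"
  by (simp_all add: fract_poly3_def const3_def var_X_def var_Y_def var_Z_def map_poly_pCons one_pCons)

lemma poly3_eqI:
  assumes "\<And>i j k. coeff (coeff (coeff F k) j) i = coeff (coeff (coeff G k) j) i"
  shows "F = G"
  using assms by (auto intro!: poly_eqI)

lemma fract_poly3_inject: "fract_poly3 F = fract_poly3 G \<longleftrightarrow> F = G"
proof
  assume "fract_poly3 F = fract_poly3 G"
  then have "to_fract (coeff (coeff (coeff F k) j) i) = to_fract (coeff (coeff (coeff G k) j) i)" for i j k
    by (simp flip: coeff_fract_poly3)
  then show "F = G" by (intro poly3_eqI) simp
qed simp

lemma coeff_const3_mult: "coeff (coeff (coeff (const3 c * F) k) j) i = c * coeff (coeff (coeff F k) j) i"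
  by (simp add: const3_def)

lemma fract_denominator:
  obtains d n where "d \<noteq> 0" "to_fract d * c = to_fract n"
proof (cases c rule: Fract_cases)
  case (Fract n d)
  then have "to_fract d * c = to_fract n" by (simp add: Fract_conv_to_fract)
  then show ?thesis using that Fract by blast
qed

lemma adjoin_mono_closed:
  assumes "\<And>r. \<iota> r \<in> T" "S \<subseteq> T" "\<And>p q. p \<in> T \<Longrightarrow> q \<in> T \<Longrightarrow> p + q \<in> T" "\<And>p q. p \<in> T \<Longrightarrow> q \<in> T \<Longrightarrow> p * q \<in> T"
  shows "adjoin \<iota> S \<subseteq> T"
proof
  fix p assume "p \<in> adjoin \<iota> S"
  then show "p \<in> T" by induction (use assms in auto)
qed

section \<open>Scaled coordinates\<close>

text \<open>
  scale3 u v is the embedding R[X, Y, Z] \<rightarrow> K[X, Y, Z] with X \<rightarrow> u X, Y \<rightarrow> v Y, Z \<rightarrow> Z. It is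
  composed of substitutions in one variable, so that the coefficients of its values can be read off.
\<close>

definition scale1 :: "'a::idom fract \<Rightarrow> 'a poly \<Rightarrow> 'a fract poly" where
  "scale1 u H = pcompose (map_poly to_fract H) [:0, u:]"

definition scale2 :: "'a::idom fract \<Rightarrow> 'a fract \<Rightarrow> 'a poly poly \<Rightarrow> 'a fract poly poly" where
  "scale2 u v G = pcompose (map_poly (scale1 u) G) [:0, [:v:]:]"

definition scale3 :: "'a::idom fract \<Rightarrow> 'a fract \<Rightarrow> 'a poly3 \<Rightarrow> 'a fract poly3" where
  "scale3 u v F = map_poly (scale2 u v) F"

lemma scale1_hom: "is_ring_hom (scale1 u)"
  unfolding scale1_def
  by (rule is_ring_hom_comp[OF is_ring_hom_pcompose is_ring_hom_map_poly[OF is_ring_hom_to_fract]])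

lemma scale2_hom: "is_ring_hom (scale2 u v)"
  unfolding scale2_def
  by (rule is_ring_hom_comp[OF is_ring_hom_pcompose is_ring_hom_map_poly[OF scale1_hom]])

lemma scale3_hom: "is_ring_hom (scale3 u v)"
  unfolding scale3_def by (rule is_ring_hom_map_poly[OF scale2_hom])

lemmas scale3_simps = is_ring_homD[OF scale3_hom]

lemma scale1_pCons: "scale1 u (pCons r H) = [:to_fract r:] + [:0, u:] * scale1 u H"
  by (simp add: scale1_def map_poly_pCons pcompose_pCons)

lemma scale2_pCons: "scale2 u v (pCons H G) = [:scale1 u H:] + [:0, [:v:]:] * scale2 u v G"
  by (simp add: scale2_def map_poly_pCons pcompose_pCons is_ring_homD[OF scale1_hom])

lemma scale3_pCons: "scale3 u v (pCons G F) = pCons (scale2 u v G) (scale3 u v F)"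
  by (simp add: scale3_def map_poly_pCons is_ring_homD[OF scale2_hom])

lemma scale_0 [simp]: "scale1 u 0 = 0" "scale2 u v 0 = 0" "scale3 u v 0 = 0"
  by (simp_all add: scale1_def scale2_def scale3_def)

lemma coeff_scale1: "coeff (scale1 u H) i = u ^ i * to_fract (coeff H i)"
  by (simp add: scale1_def coeff_pcompose_linear coeff_map_poly)

lemma scale1_smult: "scale1 u (smult c H) = smult (to_fract c) (scale1 u H)"
  by (rule poly_eqI) (simp add: coeff_scale1)

lemma coeff_scale2: "coeff (scale2 u v G) j = smult (v ^ j) (scale1 u (coeff G j))"
  by (simp add: scale2_def coeff_pcompose_linear coeff_map_poly poly_const_pow)

lemma coeff_scale3: "coeff (coeff (coeff (scale3 u v F) k) j) i = v ^ j * u ^ i * to_fract (coeff (coeff (coeff F k) j) i)"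
  by (simp add: scale3_def coeff_map_poly coeff_scale2 coeff_scale1)

lemma scale3_inject:
  assumes "u \<noteq> 0" "v \<noteq> 0" "scale3 u v F = scale3 u v G"
  shows "F = G"
proof (rule poly3_eqI)
  fix i j k
  have "v ^ j * u ^ i * to_fract (coeff (coeff (coeff F k) j) i) = v ^ j * u ^ i * to_fract (coeff (coeff (coeff G k) j) i)"
    using assms(3) by (simp flip: coeff_scale3)
  then show "coeff (coeff (coeff F k) j) i = coeff (coeff (coeff G k) j) i" using assms(1,2) by simp
qed

lemma scale3_gens:
  "scale3 u v (const3 c) = scalar c" "scale3 u v var_X = const3 u * var_X"
  "scale3 u v var_Y = const3 v * var_Y" "scale3 u v var_Z = var_Z"
  by (simp_all add: const3_def var_X_def var_Y_def var_Z_def scale3_pCons scale2_pCons scale1_pCons one_pCons)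

lemma pderiv_scale2: "pderiv (scale2 u v G) = smult [:v:] (scale2 u v (pderiv G))"
  by (rule poly_eqI)
    (simp add: coeff_pderiv coeff_scale2 is_ring_homD[OF scale1_hom] is_ring_hom_of_nat[OF scale1_hom] smult_add_right algebra_simps)

lemma lift_const:
  assumes "u \<noteq> 0" "v \<noteq> 0"
  shows "scale3 u v G = [:A:] \<Longrightarrow> \<exists>g. G = [:g:]"
    and "scale3 u v G = [:[:B:]:] \<Longrightarrow> \<exists>\<phi>. G = [:[:\<phi>:]:]"
proof -
  have 0: "coeff (coeff (coeff G k) j) i = 0" if "coeff (coeff (coeff (scale3 u v G) k) j) i = 0" for i j k
    using that assms unfolding coeff_scale3 by simp
  show 1: "\<exists>g. G = [:g:]" if eq: "scale3 u v G = [:A:]" for A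
  proof -
    have "G = [:coeff G 0:]"
      by (rule poly3_eqI) (auto simp: coeff_pCons 0 eq split: nat.splits)
    then show ?thesis by blast
  qed
  show "\<exists>\<phi>. G = [:[:\<phi>:]:]" if eq: "scale3 u v G = [:[:B:]:]"
  proof -
    have "G = [:[:coeff (coeff G 0) 0:]:]"
      by (rule poly3_eqI) (auto simp: coeff_pCons 0 eq split: nat.splits)
    then show ?thesis by blast
  qed
qed

lemma clear_denominators_closed:
  fixes \<sigma> :: "'a::idom poly3 \<Rightarrow> 'a fract poly3"
  assumes hom: "is_ring_hom \<sigma>" and const: "\<And>r. \<sigma> (const3 r) = scalar r"
    and 1: "scalar d1 * F1 = \<sigma> G1" and 2: "scalar d2 * F2 = \<sigma> G2"
  shows "scalar (d1 * d2) * (F1 + F2) = \<sigma> (const3 d2 * G1 + const3 d1 * G2)"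
    and "scalar (d1 * d2) * (F1 * F2) = \<sigma> (G1 * G2)"
  unfolding is_ring_homD(2,3)[OF hom] const 1[symmetric] 2[symmetric]
  by (simp_all add: const3_simps algebra_simps)

lemma scale3_clear_denominators:
  assumes "u \<noteq> 0" "v \<noteq> 0"
  obtains d G where "d \<noteq> 0" "scalar d * F = scale3 u v G"
proof -
  have var: "\<exists>d G. d \<noteq> 0 \<and> scalar d * x = scale3 u v G"
    if "scale3 u v y = const3 c * x" "c \<noteq> 0" for x y c
  proof -
    obtain d n where "d \<noteq> 0" "to_fract d * (1 / c) = to_fract n" by (rule fract_denominator)
    then have "to_fract d = to_fract n * c" using \<open>c \<noteq> 0\<close> by (simp add: field_simps)
    then have "scalar d * x = scale3 u v (const3 n * y)"
      by (simp add: scale3_simps scale3_gens that(1) const3_simps mult.assoc)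
    then show ?thesis using \<open>d \<noteq> 0\<close> by blast
  qed
  have "\<exists>d G. d \<noteq> 0 \<and> scalar d * F = scale3 u v G"
  proof (induction F rule: poly3_induct)
    case (const r)
    obtain d n where "d \<noteq> 0" "to_fract d * r = to_fract n" by (rule fract_denominator)
    then show ?case by (metis const3_simps(3) scale3_gens(1))
  next
    case X
    show ?case by (rule var[OF scale3_gens(2) assms(1)])
  next
    case Y
    show ?case by (rule var[OF scale3_gens(3) assms(2)])
  next
    case Z
    show ?case by (rule var[of var_Z 1]) (simp_all add: scale3_gens const3_simps)
  next
    case (add F1 F2)
    then obtain d1 G1 d2 G2 where *: "d1 \<noteq> 0" "scalar d1 * F1 = scale3 u v G1"
      "d2 \<noteq> 0" "scalar d2 * F2 = scale3 u v G2" by blast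
    show ?case
      using clear_denominators_closed(1)[OF scale3_hom scale3_gens(1) *(2,4)] *(1,3) by (metis no_zero_divisors)
  next
    case (mult F1 F2)
    then obtain d1 G1 d2 G2 where *: "d1 \<noteq> 0" "scalar d1 * F1 = scale3 u v G1"
      "d2 \<noteq> 0" "scalar d2 * F2 = scale3 u v G2" by blast
    show ?case
      using clear_denominators_closed(2)[OF scale3_hom scale3_gens(1) *(2,4)] *(1,3) by (metis no_zero_divisors)
  qed
  then show ?thesis using that by blast
qed

lemma eval_in_rescale:
  fixes w :: "'k::field poly3"
  assumes "q \<noteq> 0"
  shows "eval_in (const3 q * w) (pcompose R [:0, [:1 / q:]:]) = eval_in w R"
proof (induction R)
  case (pCons r R)
  have "[:0, [:1 / q:]:] = smult [:1 / q:] [:0, 1:]" by simp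
  then have "eval_in (const3 q * w) [:0, [:1 / q:]:] = smult [:[:1 / q:]:] (const3 q * w)"
    using eval_in_smult eval_in_X by metis
  also have "\<dots> = w" using assms by (simp add: const3_def) (simp add: one_pCons[symmetric])
  finally have lin: "eval_in (const3 q * w) [:0, [:1 / q:]:] = w" .
  show ?case
    unfolding pcompose_pCons eval_in_simps(2,3) lin pCons.IH eval_in_const by (simp only: eval_in_pCons)
qed (simp add: eval_in_simps)

lemma eval_in_scale3: "eval_in (scale3 u v \<Omega>) (map_poly (scale1 u) Q) = scale3 u v (eval_in \<Omega> Q)"
proof (induction Q)
  case 0
  then show ?case by (simp add: eval_in_simps)
next
  case (pCons c Q)
  have "scale3 u v [:[:c:]:] = [:[:scale1 u c:]:]"
    by (simp add: scale3_pCons scale2_pCons)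
  then show ?case
    by (simp add: map_poly_pCons eval_in_pCons scale3_simps pCons.IH is_ring_homD[OF scale1_hom])
qed

lemma eval_in_scale1_adjoin:
  "eval_in w (map_poly (scale1 u) Q) \<in> adjoin scalar {const3 u * var_X, w}"
proof (induction Q)
  case 0
  have "scalar 0 \<in> adjoin scalar {const3 u * var_X, w}" by (rule adjoin.const)
  then show ?case by (simp add: eval_in_simps const3_simps)
next
  case (pCons c Q)
  have c: "[:[:scale1 u c:]:] \<in> adjoin scalar {const3 u * var_X, w}"
  proof (induction c)
    case 0
    have "scalar 0 \<in> adjoin scalar {const3 u * var_X, w}" by (rule adjoin.const)
    then show ?case by (simp add: const3_simps)
  next
    case (pCons r c)
    have "[:[:scale1 u (pCons r c):]:] = scalar r + (const3 u * var_X) * [:[:scale1 u c:]:]"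
      by (simp add: scale1_pCons const3_def var_X_def)
    also have "\<dots> \<in> adjoin scalar {const3 u * var_X, w}"
      by (intro adjoin.add adjoin.mult adjoin.const pCons.IH adjoin.gen) simp
    finally show ?case .
  qed
  have "[:[:scale1 u c:]:] + w * eval_in w (map_poly (scale1 u) Q)
      \<in> adjoin scalar {const3 u * var_X, w}"
    by (rule adjoin.add[OF c adjoin.mult[OF adjoin.gen pCons.IH]]) simp
  then show ?case by (simp add: map_poly_pCons eval_in_pCons is_ring_homD[OF scale1_hom])
qed

text \<open>
  In scaled coordinates the derivation becomes triangular with coefficients in R[X] and R[X, Y],
  up to the factor c that clears denominators.
\<close>

lemma tri_scale3:
  assumes "scale3 u v [:[:\<phi>:]:] = const3 c * (const3 v * [:[:f:]:])" "scale3 u v [:g0:] = const3 c * [:g:]"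
  shows "const3 c * tri f g (scale3 u v F) = scale3 u v (tri \<phi> g0 F)"
proof (rule poly3_derivation_eqI[where h = "scale3 u v" and \<delta> = "\<lambda>F. const3 c * tri f g (scale3 u v F)"
      and \<delta>' = "\<lambda>F. scale3 u v (tri \<phi> g0 F)"])
  have v: "const3 v * var_Y = smult [:[:v:]:] [:[:0, 1:]:]" by (simp add: const3_def var_Y_def)
  show "const3 c * tri f g (scale3 u v var_Y) = scale3 u v (tri \<phi> g0 var_Y)"
    unfolding scale3_gens v tri_scale tri_V unfolding var_Y_def tri_V assms(1) by (simp add: const3_def)
  have u: "const3 u * var_X = [:[:[:0, u:]:]:]" by (simp add: const3_def var_X_def)
  show "const3 c * tri f g (scale3 u v var_X) = scale3 u v (tri \<phi> g0 var_X)"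
    unfolding scale3_gens u tri_const unfolding var_X_def tri_const by simp
  show "const3 c * tri f g (scale3 u v var_Z) = scale3 u v (tri \<phi> g0 var_Z)"
    unfolding scale3_gens unfolding var_Z_def tri_Z assms(2) by simp
  show "const3 c * tri f g (scale3 u v (const3 r)) = scale3 u v (tri \<phi> g0 (const3 r))" for r
    unfolding scale3_gens unfolding const3_def tri_const by simp
qed (simp_all add: tri_add tri_mult scale3_simps algebra_simps)

lemma tri_const3_mult: "tri f g (const3 c * var_X) = 0" "tri f g (const3 c * var_Y) = const3 c * [:[:f:]:]"
  "tri f g (const3 c * F) = const3 c * tri f g F"
proof -
  have "const3 c * var_X = [:[:[:0, c:]:]:]" by (simp add: const3_def var_X_def)
  then show "tri f g (const3 c * var_X) = 0" using tri_const by simp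
  show s: "tri f g (const3 c * F) = const3 c * tri f g F" for F
    using tri_scale[of f g "[:c:]" F] by (simp add: const3_def)
  show "tri f g (const3 c * var_Y) = const3 c * [:[:f:]:]"
    unfolding s using tri_V[of f g] by (simp add: var_Y_def)
qed

lemma tri_const3: "tri f g (const3 c) = 0"
  by (simp add: const3_def tri_const)

section \<open>Adapted coordinates\<close>

text \<open>
  The coordinates are U = a X + b Y and V = x Y - y X, a unimodular change of variables over K.
  Below, the variables of 'a fract poly3 that receive U, V and Z are again var_X, var_Y and
  var_Z; \<eta> rewrites a polynomial in the new coordinates, \<mu> is its inverse, and \<theta> embeds the
  polynomial ring over the base ring.
\<close>

locale adapted_coordinates =
  fixes a b :: "'a::idom" and x y :: "'a fract"
  assumes unimodular: "to_fract a * x + to_fract b * y = 1"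
    and integral: "to_fract a * x \<in> range to_fract" "to_fract a * y \<in> range to_fract"
      "to_fract b * x \<in> range to_fract" "to_fract b * y \<in> range to_fract"
begin

definition \<eta> :: "'a fract poly3 \<Rightarrow> 'a fract poly3" where
  "\<eta> = subst3 const3 (const3 x * var_X - scalar b * var_Y)
     (const3 y * var_X + scalar a * var_Y) var_Z"

definition \<mu> :: "'a fract poly3 \<Rightarrow> 'a fract poly3" where
  "\<mu> = subst3 const3 (scalar a * var_X + scalar b * var_Y)
     (const3 x * var_Y - const3 y * var_X) var_Z"

definition \<theta> :: "'a poly3 \<Rightarrow> 'a fract poly3" where
  "\<theta> F = \<eta> (fract_poly3 F)"

lemma \<eta>_hom: "is_ring_hom \<eta>" and \<mu>_hom: "is_ring_hom \<mu>"
  unfolding \<eta>_def \<mu>_def by (rule subst3_hom[OF is_ring_hom_const3])+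

lemma \<theta>_hom: "is_ring_hom \<theta>"
  unfolding \<theta>_def by (rule is_ring_hom_comp[OF \<eta>_hom fract_poly3_hom])

lemmas \<eta>_simps = is_ring_homD[OF \<eta>_hom]
lemmas \<mu>_simps = is_ring_homD[OF \<mu>_hom]
lemmas \<theta>_simps = is_ring_homD[OF \<theta>_hom]

lemma \<eta>_gens: "\<eta> (const3 c) = const3 c" "\<eta> var_X = const3 x * var_X - scalar b * var_Y"
  "\<eta> var_Y = const3 y * var_X + scalar a * var_Y" "\<eta> var_Z = var_Z"
  by (simp_all add: \<eta>_def subst3_gens[OF is_ring_hom_const3])

lemma \<mu>_gens: "\<mu> (const3 c) = const3 c"
  "\<mu> var_X = scalar a * var_X + scalar b * var_Y"
  "\<mu> var_Y = const3 x * var_Y - const3 y * var_X" "\<mu> var_Z = var_Z"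
  by (simp_all add: \<mu>_def subst3_gens[OF is_ring_hom_const3])

lemma \<theta>_gens: "\<theta> (const3 c) = scalar c"
  "\<theta> var_X = const3 x * var_X - scalar b * var_Y"
  "\<theta> var_Y = const3 y * var_X + scalar a * var_Y" "\<theta> var_Z = var_Z"
  by (simp_all add: \<theta>_def \<eta>_gens)

lemma const3_unimodular: "scalar a * const3 x + scalar b * const3 y = 1"
  using unimodular by (simp flip: const3_simps)

lemma \<mu>_\<eta>: "\<mu> (\<eta> F) = F"
proof (rule poly3_hom_eqI[OF is_ring_hom_comp[OF \<mu>_hom \<eta>_hom], of "\<lambda>F. F"])
  have "\<mu> (\<eta> var_X) = (scalar a * const3 x + scalar b * const3 y) * var_X"
    by (simp add: \<eta>_gens \<mu>_gens \<mu>_simps) (simp add: algebra_simps)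
  then show "\<mu> (\<eta> var_X) = var_X" by (simp add: const3_unimodular)
  have "\<mu> (\<eta> var_Y) = (scalar a * const3 x + scalar b * const3 y) * var_Y"
    by (simp add: \<eta>_gens \<mu>_gens \<mu>_simps) (simp add: algebra_simps)
  then show "\<mu> (\<eta> var_Y) = var_Y" by (simp add: const3_unimodular)
qed (simp_all add: \<eta>_gens \<mu>_gens is_ring_hom_def)

lemma \<eta>_\<mu>: "\<eta> (\<mu> F) = F"
proof (rule poly3_hom_eqI[OF is_ring_hom_comp[OF \<eta>_hom \<mu>_hom], of "\<lambda>F. F"])
  have "\<eta> (\<mu> var_X) = (scalar a * const3 x + scalar b * const3 y) * var_X"
    by (simp add: \<eta>_gens \<mu>_gens \<eta>_simps) (simp add: algebra_simps)
  then show "\<eta> (\<mu> var_X) = var_X" by (simp add: const3_unimodular)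
  have "\<eta> (\<mu> var_Y) = (scalar a * const3 x + scalar b * const3 y) * var_Y"
    by (simp add: \<eta>_gens \<mu>_gens \<eta>_simps) (simp add: algebra_simps)
  then show "\<eta> (\<mu> var_Y) = var_Y" by (simp add: const3_unimodular)
qed (simp_all add: \<eta>_gens \<mu>_gens is_ring_hom_def)

lemma \<theta>_inject: "\<theta> F = \<theta> G \<longleftrightarrow> F = G"
  unfolding \<theta>_def by (metis \<mu>_\<eta> fract_poly3_inject)

lemma range_\<theta>_closed:
  "p \<in> range \<theta> \<Longrightarrow> q \<in> range \<theta> \<Longrightarrow> p + q \<in> range \<theta>"
  "p \<in> range \<theta> \<Longrightarrow> q \<in> range \<theta> \<Longrightarrow> p - q \<in> range \<theta>"
  "p \<in> range \<theta> \<Longrightarrow> q \<in> range \<theta> \<Longrightarrow> p * q \<in> range \<theta>"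
  "scalar r \<in> range \<theta>" "var_Z \<in> range \<theta>"
proof -
  show "p \<in> range \<theta> \<Longrightarrow> q \<in> range \<theta> \<Longrightarrow> p + q \<in> range \<theta>"
    "p \<in> range \<theta> \<Longrightarrow> q \<in> range \<theta> \<Longrightarrow> p - q \<in> range \<theta>"
    "p \<in> range \<theta> \<Longrightarrow> q \<in> range \<theta> \<Longrightarrow> p * q \<in> range \<theta>"
    by (auto simp flip: \<theta>_simps)
  show "scalar r \<in> range \<theta>" "var_Z \<in> range \<theta>"
    by (metis \<theta>_gens(1) rangeI, metis \<theta>_gens(4) rangeI)
qed

text \<open>
  On the chart given by \<open>u\<close> and \<open>v\<close> the element \<open>t = u v\<close> is inverted. The two charts
  \<open>(x, a)\<close> and \<open>(y, b)\<close> cover everything because \<open>x a + y b = 1\<close>.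
\<close>

definition chart :: "'a fract \<Rightarrow> 'a fract \<Rightarrow> 'a \<Rightarrow> bool" where
  "chart u v t \<longleftrightarrow> t \<noteq> 0 \<and> to_fract t = u * v \<and>
     u * to_fract a \<in> range to_fract \<and> u * to_fract b \<in> range to_fract \<and>
     v * x \<in> range to_fract \<and> v * y \<in> range to_fract"

lemma chart_nonzero: "chart u v t \<Longrightarrow> u \<noteq> 0 \<and> v \<noteq> 0"
  by (auto simp: chart_def)

lemma two_charts:
  obtains t1 t2 where "t1 + t2 = 1" "t1 \<noteq> 0 \<Longrightarrow> chart x (to_fract a) t1" "t2 \<noteq> 0 \<Longrightarrow> chart y (to_fract b) t2"
proof -
  obtain t1 t2 where t: "to_fract a * x = to_fract t1" "to_fract b * y = to_fract t2"
    using integral by blast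
  have "to_fract (t1 + t2) = to_fract 1" using unimodular t by simp
  then have "t1 + t2 = 1" unfolding to_fract_eq_iff .
  then show ?thesis using that t integral by (auto simp: chart_def mult.commute)
qed

text \<open>
  The preimages are u (a X + b Y) and v (x Y - y X).
\<close>

lemma chart_in_range:
  assumes "chart u v t"
  shows "const3 u * var_X \<in> range \<theta>" "const3 v * var_Y \<in> range \<theta>"
proof -
  obtain ua ub vx vy where c: "u * to_fract a = to_fract ua" "u * to_fract b = to_fract ub"
    "v * x = to_fract vx" "v * y = to_fract vy" using assms by (auto simp: chart_def)
  have "\<theta> (const3 ua * var_X + const3 ub * var_Y)
      = const3 u * ((scalar a * const3 x + scalar b * const3 y) * var_X)"
    by (simp add: \<theta>_simps \<theta>_gens c[symmetric] const3_simps) (simp add: algebra_simps)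
  then show "const3 u * var_X \<in> range \<theta>" unfolding const3_unimodular by (metis mult_1 rangeI)
  have "\<theta> (const3 vx * var_Y - const3 vy * var_X)
      = const3 v * ((scalar a * const3 x + scalar b * const3 y) * var_Y)"
    by (simp add: \<theta>_simps \<theta>_gens c[symmetric] const3_simps) (simp add: algebra_simps)
  then show "const3 v * var_Y \<in> range \<theta>" unfolding const3_unimodular by (metis mult_1 rangeI)
qed

lemma range_scale3_subset:
  assumes "chart u v t"
  shows "scale3 u v F \<in> range \<theta>"
  by (induction F rule: poly3_induct)
    (simp_all add: scale3_gens scale3_simps range_\<theta>_closed chart_in_range[OF assms])

text \<open>
  In the chart t X = v x (u U) - u b (v V) and t Y = v y (u U) + u a (v V).
\<close>

lemma chart_clear:
  assumes "chart u v t"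
  obtains N G where "const3 (to_fract t ^ N) * \<theta> F = scale3 u v G"
proof -
  obtain ua ub vx vy where c: "u * to_fract a = to_fract ua" "u * to_fract b = to_fract ub"
    "v * x = to_fract vx" "v * y = to_fract vy" using assms by (auto simp: chart_def)
  have t: "to_fract t = u * v" using assms by (simp add: chart_def)
  have "\<exists>N G. const3 (to_fract t ^ N) * \<theta> F = scale3 u v G"
  proof (induction F rule: poly3_induct)
    case (const r)
    show ?case by (rule exI[of _ 0], rule exI[of _ "const3 r"]) (simp add: \<theta>_gens scale3_gens const3_simps)
  next
    case X
    show ?case
      by (rule exI[of _ 1], rule exI[of _ "const3 vx * var_X - const3 ub * var_Y"])
        (simp add: \<theta>_gens scale3_gens scale3_simps t c[symmetric] const3_simps right_diff_distrib mult.assoc mult.left_commute)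
  next
    case Y
    show ?case
      by (rule exI[of _ 1], rule exI[of _ "const3 vy * var_X + const3 ua * var_Y"])
        (simp add: \<theta>_gens scale3_gens scale3_simps t c[symmetric] const3_simps distrib_left mult.assoc mult.left_commute)
  next
    case Z
    show ?case by (rule exI[of _ 0], rule exI[of _ var_Z]) (simp add: \<theta>_gens scale3_gens const3_simps)
  next
    case (add F1 F2)
    then obtain N1 G1 N2 G2 where *: "scalar (t ^ N1) * \<theta> F1 = scale3 u v G1"
      "scalar (t ^ N2) * \<theta> F2 = scale3 u v G2" unfolding to_fract_power by blast
    show ?case
      using clear_denominators_closed(1)[OF scale3_hom scale3_gens(1) *]
      unfolding power_add[symmetric] \<theta>_simps(2)[symmetric] to_fract_power by blast
  next
    case (mult F1 F2)
    then obtain N1 G1 N2 G2 where *: "scalar (t ^ N1) * \<theta> F1 = scale3 u v G1"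
      "scalar (t ^ N2) * \<theta> F2 = scale3 u v G2" unfolding to_fract_power by blast
    show ?case
      using clear_denominators_closed(2)[OF scale3_hom scale3_gens(1) *]
      unfolding power_add[symmetric] \<theta>_simps(3)[symmetric] to_fract_power by blast
  qed
  then show ?thesis using that by blast
qed

text \<open>
  The set of scalars c with c F integral is a fractional ideal: compare one nonzero coefficient of
  F in the original coordinates.
\<close>

lemma bounded_denominators:
  assumes "F \<noteq> 0"
  obtains d where "d \<noteq> 0" "\<And>c. const3 c * F \<in> range \<theta> \<Longrightarrow> to_fract d * c \<in> range to_fract"
proof -
  have "\<mu> F \<noteq> 0" using assms by (metis \<eta>_\<mu> \<eta>_simps(4))
  then obtain i j k where \<kappa>: "coeff (coeff (coeff (\<mu> F) k) j) i \<noteq> 0" (is "?\<kappa> \<noteq> 0")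
    using poly3_eqI[of "\<mu> F" 0] by auto
  obtain m n where mn: "m \<noteq> 0" "to_fract m * ?\<kappa> = to_fract n" by (rule fract_denominator)
  show ?thesis
  proof (rule that[of n])
    show "n \<noteq> 0" using mn \<kappa> by auto
    fix c assume "const3 c * F \<in> range \<theta>"
    then obtain G where "const3 c * F = \<eta> (fract_poly3 G)" by (auto simp: \<theta>_def)
    then have "const3 c * \<mu> F = fract_poly3 G" by (metis \<mu>_\<eta> \<mu>_gens(1) \<mu>_simps(3))
    then have "c * ?\<kappa> = to_fract (coeff (coeff (coeff G k) j) i)"
      by (metis coeff_const3_mult coeff_fract_poly3)
    then have "to_fract n * c = to_fract (m * coeff (coeff (coeff G k) j) i)"
      unfolding mn(2)[symmetric] to_fract_mult by (simp add: mult.assoc mult.commute mult.left_commute)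
    then show "to_fract n * c \<in> range to_fract" by blast
  qed
qed

text \<open>
  Let \<omega> be the image of \<Omega>. Choose d' in R such that d' Q has coefficients in R and either d' or
  one of these coefficients lies outside M. If d' is not in M, it is the required r. Otherwise
  d' p = (d' Q)(\<omega>) vanishes modulo M, and as \<omega> is transcendental modulo M, so do all
  coefficients of d' Q, a contradiction.
\<close>

lemma local_generation:
  assumes ded: "dedekind_domain TYPE('a)" and M: "maximal_ideal M"
    and ch: "chart u v t" and t: "t \<notin> M"
    and \<Omega>: "\<Omega> = [:- \<Gamma>, [:\<phi>:]:]" "coeff \<Gamma> 0 = 0"
    and nt: "\<phi> \<notin> poly_ideal M \<or> (\<exists>i. coeff \<Gamma> i \<notin> poly_ideal M)"
    and p: "\<theta> p = eval_in (scale3 u v \<Omega>) Q"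
  shows "\<exists>r. r \<notin> M \<and>
    scalar r * \<theta> p \<in> adjoin scalar {const3 u * var_X, scale3 u v \<Omega>}"
proof -
  note Mp = maximal_ideal_prime[OF M]
  note MP = prime_idealD[OF Mp]
  have uv: "u \<noteq> 0" "v \<noteq> 0" using chart_nonzero[OF ch] by auto
  \<comment> \<open>Clear the denominators of the coefficients of \<open>Q\<close> ...\<close>
  obtain d F where d: "d \<noteq> 0" "scalar d * [:Q:] = scale3 u 1 F"
    by (rule scale3_clear_denominators[OF uv(1), of 1 "[:Q:]"]) auto
  define Q2 where "Q2 = coeff F 0"
  have Q2: "smult [:to_fract d:] Q = map_poly (scale1 u) Q2"
  proof -
    have "smult [:to_fract d:] Q = coeff (scalar d * [:Q:]) 0" by (simp add: const3_def)
    also have "\<dots> = scale2 u 1 Q2" unfolding d(2) by (simp add: scale3_def coeff_map_poly Q2_def)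
    also have "\<dots> = map_poly (scale1 u) Q2"
      by (rule poly_eqI) (simp add: coeff_scale2 coeff_map_poly)
    finally show ?thesis .
  qed
  \<comment> \<open>... and divide by the locally greatest common divisor of the common denominator and the numerators.\<close>
  let ?S = "insert d {coeff (coeff Q2 j) i | i j. True}"
  have dS: "d \<in> ?S" and QS: "coeff (coeff Q2 j) i \<in> ?S" for i j by blast+
  obtain e c z w where e: "e \<noteq> 0" "\<And>a. a \<in> ?S \<Longrightarrow> e dvd c * a" "z \<in> ?S" "c * z = e * w" "w \<notin> M"
    by (rule dedekind_locally_principal[OF ded dS d(1) M]) blast
  obtain d' where d': "c * d = e * d'" using e(2)[OF dS] by (auto elim: dvdE)
  have "[:[:e:]:] dvd smult [:c:] Q2"
    using e(2)[OF QS] by (simp add: const_poly_dvd_iff)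
  then obtain Q1 where "smult [:c:] Q2 = [:[:e:]:] * Q1" by (auto elim: dvdE)
  then have Q1: "smult [:c:] Q2 = smult [:e:] Q1" by simp
  have cQ: "c * coeff (coeff Q2 j) i = e * coeff (coeff Q1 j) i" for i j
  proof -
    have "coeff (coeff (smult [:c:] Q2) j) i = coeff (coeff (smult [:e:] Q1) j) i" using Q1 by simp
    then show ?thesis by simp
  qed
  have notall: "d' \<notin> M \<or> Q1 \<notin> poly_ideal (poly_ideal M)"
  proof -
    consider "z = d" | i j where "z = coeff (coeff Q2 j) i" using e(3) by blast
    then show ?thesis
    proof cases
      case 1
      then have "w = d'" using e(1,4) d' by simp
      then show ?thesis using e(5) by simp
    next
      case (2 i j)
      then have "w = coeff (coeff Q1 j) i" using e(1,4) cQ[of j i] by simp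
      then show ?thesis using e(5) by (auto simp: poly_ideal_def)
    qed
  qed
  have key: "scalar d' * \<theta> p = scale3 u v (eval_in \<Omega> Q1)"
  proof -
    have sc: "map_poly (scale1 u) (smult [:c:] R) = smult [:to_fract c:] (map_poly (scale1 u) R)" for c and R :: "'a poly poly"
      by (rule poly_eqI) (simp add: coeff_map_poly scale1_smult)
    have "smult [:to_fract e:] (smult [:to_fract d':] Q) = smult [:to_fract (e * d'):] Q" by (simp add: mult.commute)
    also have "\<dots> = smult [:to_fract c:] (smult [:to_fract d:] Q)" unfolding d'[symmetric] by (simp add: mult.commute)
    also have "\<dots> = smult [:to_fract e:] (map_poly (scale1 u) Q1)"
      unfolding Q2 sc[symmetric] Q1 ..
    finally have "smult [:to_fract e:] (smult [:to_fract d':] Q - map_poly (scale1 u) Q1) = 0"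
      by (simp only: smult_diff_right) simp
    then have "smult [:to_fract d':] Q = map_poly (scale1 u) Q1"
      using e(1) unfolding smult_eq_0_iff by simp
    then have "smult [:[:to_fract d':]:] (\<theta> p) = eval_in (scale3 u v \<Omega>) (map_poly (scale1 u) Q1)"
      unfolding p by (metis eval_in_smult)
    then show ?thesis by (simp add: eval_in_scale3 const3_def)
  qed
  show ?thesis
  proof (cases "d' \<in> M")
    case False
    have "scalar d' * \<theta> p \<in> adjoin scalar {const3 u * var_X, scale3 u v \<Omega>}"
      unfolding key eval_in_scale3[symmetric] by (rule eval_in_scale1_adjoin)
    then show ?thesis using False by blast
  next
    case True
    obtain N G where NG: "const3 (to_fract t ^ N) * \<theta> p = scale3 u v G" by (rule chart_clear[OF ch])
    have "scale3 u v (const3 d' * G) = scalar (t ^ N) * (scalar d' * \<theta> p)"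
      by (simp add: scale3_simps scale3_gens NG[symmetric] to_fract_power mult.left_commute)
    also have "\<dots> = scale3 u v (const3 (t ^ N) * eval_in \<Omega> Q1)"
      unfolding key by (simp add: scale3_simps scale3_gens)
    finally have "const3 d' * G = const3 (t ^ N) * eval_in \<Omega> Q1" by (rule scale3_inject[OF uv])
    also have "\<dots> = eval_in \<Omega> ([:[:t ^ N:]:] * Q1)"
      by (simp add: eval_in_smult const3_def)
    finally have eq: "eval_in \<Omega> ([:[:t ^ N:]:] * Q1) = const3 d' * G" ..
    have "const3 d' * G \<in> poly_ideal (poly_ideal (poly_ideal M))"
      unfolding poly_ideal_def mem_Collect_eq coeff_const3_mult
      using ideal_dvd_closed[OF MP(1) True dvd_triv_left] by blast
    then have "[:[:t ^ N:]:] * Q1 \<in> poly_ideal (poly_ideal M)"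
      unfolding eq[symmetric] \<Omega>(1)
      by (rule eval_in_poly_ideal[OF poly_ideal_prime[OF Mp] \<Omega>(2) nt])
    moreover have "[:[:t ^ N:]:] \<notin> poly_ideal (poly_ideal M)"
      using const_in_poly_ideal[OF MP(1)] const_in_poly_ideal[OF poly_ideal_subspace[OF MP(1)]]
        prime_ideal_power[OF Mp] t by blast
    ultimately have "Q1 \<in> poly_ideal (poly_ideal M)"
      using prime_idealD(3)[OF poly_ideal_prime[OF poly_ideal_prime[OF Mp]]] by blast
    then show ?thesis using notall True by blast
  qed
qed

end

section \<open>The kernel of the derivation\<close>

locale adapted_derivation = adapted_coordinates a b x y
  for a b :: "'a::idom" and x y :: "'a fract" +
  fixes D :: "'a poly3 \<Rightarrow> 'a poly3" and f :: "'a fract poly" and g :: "'a fract poly poly"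
  assumes ded: "dedekind_domain TYPE('a)" and nu: "nat_units TYPE('a)"
    and \<theta>_D: "\<theta> (D F) = tri f g (\<theta> F)"
begin

lemma noeth: "noetherian TYPE('a)" using ded by (simp add: dedekind_domain_def)

lemma nu_fract: "nat_units TYPE('a fract)"
  unfolding nat_units_def
proof
  fix n
  obtain c :: 'a where "1 = of_nat (Suc n) * c" using nu unfolding nat_units_def by (meson dvdE)
  then have "1 = of_nat (Suc n) * to_fract c"
    by (metis to_fract_1 to_fract_mult to_fract_of_nat)
  then show "of_nat (Suc n) dvd (1 :: 'a fract)" by (metis dvd_triv_left)
qed

lemma kernel_eval_in:
  assumes f0: "f \<noteq> 0" and h: "f = h * \<phi>" "g = smult h (pderiv \<Gamma>)" and \<Gamma>0: "coeff \<Gamma> 0 = 0"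
    and coprime: "\<And>\<pi>. \<pi> dvd \<phi> \<Longrightarrow> (\<And>i. \<pi> dvd coeff \<Gamma> i) \<Longrightarrow> \<pi> dvd 1"
    and p: "D p = 0"
  obtains Q where "\<theta> p = eval_in [:- \<Gamma>, [:\<phi>:]:] Q"
proof -
  have "smult [:h:] (tri \<phi> (pderiv \<Gamma>) (\<theta> p)) = tri f g (\<theta> p)"
    by (simp add: tri_def h smult_add_right mult.commute)
  also have "\<dots> = 0" using \<theta>_D[of p] p by (simp add: \<theta>_simps)
  finally have "tri \<phi> (pderiv \<Gamma>) (\<theta> p) = 0" using f0 h(1) unfolding smult_eq_0_iff by auto
  moreover have "\<phi> \<noteq> 0" using f0 h by auto
  ultimately show ?thesis using tri_kernel_field[OF nu_fract _ \<Gamma>0 coprime] that by blast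
qed

lemma first_integral:
  assumes "f = h * \<phi>" "g = smult h (pderiv \<Gamma>)"
  shows "tri f g [:- \<Gamma>, [:\<phi>:]:] = 0"
  unfolding assms by (rule tri_first_integral)

lemma D_eq_0_iff: "D F = 0 \<longleftrightarrow> tri f g (\<theta> F) = 0"
  using \<theta>_D[of F] \<theta>_inject[of "D F" 0] by (simp add: \<theta>_simps)

lemma Ker_subalgebra:
  assumes "S \<subseteq> Ker D"
  shows "adjoin const3 S \<subseteq> Ker D"
  by (rule adjoin_mono_closed)
    (use assms in \<open>auto simp: Ker_def D_eq_0_iff \<theta>_simps \<theta>_gens tri_add tri_mult tri_const3\<close>)

text \<open>
  A subalgebra of the kernel is all of it once every kernel element can be multiplied into it by
  a scalar outside any given maximal ideal.
\<close>

lemma kernel_eq_adjoinI: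
  assumes S: "S \<subseteq> Ker D"
    and loc: "\<And>M p. maximal_ideal M \<Longrightarrow> D p = 0 \<Longrightarrow>
      \<exists>T r. T \<subseteq> \<theta> ` adjoin const3 S \<and> r \<notin> M \<and> scalar r * \<theta> p \<in> adjoin scalar T"
  shows "adjoin const3 S = Ker D"
proof
  show "adjoin const3 S \<subseteq> Ker D" by (rule Ker_subalgebra[OF S])
  show "Ker D \<subseteq> adjoin const3 S"
  proof
    fix p assume "p \<in> Ker D"
    then have p: "D p = 0" by (simp add: Ker_def)
    let ?I = "{r. const3 r * p \<in> adjoin const3 S}"
    have sub: "ideal.subspace ?I" unfolding subspace_iff
    proof (intro conjI ballI allI)
      show "0 \<in> ?I" using adjoin.const[of const3 0 S] by (simp add: const3_simps)
    next
      fix r s assume "r \<in> ?I" "s \<in> ?I"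
      then show "r + s \<in> ?I" by (simp add: const3_simps distrib_right adjoin.add)
    next
      fix c r assume "r \<in> ?I"
      then show "c * r \<in> ?I" by (simp add: const3_simps mult.assoc adjoin.mult adjoin.const)
    qed
    have "1 \<in> ?I"
    proof (rule ideal_eq_UNIV_if_no_maximal[OF noeth sub])
      fix M :: "'a set" assume M: "maximal_ideal M"
      obtain T r where T: "T \<subseteq> \<theta> ` adjoin const3 S" "r \<notin> M"
        "scalar r * \<theta> p \<in> adjoin scalar T" using loc[OF M p] by blast
      have "adjoin scalar T \<subseteq> \<theta> ` adjoin const3 S"
      proof (rule adjoin_mono_closed[OF _ T(1)])
        show "scalar r \<in> \<theta> ` adjoin const3 S" for r
          using adjoin.const[of const3 r S] \<theta>_gens(1) by (metis image_eqI)
      qed (auto simp flip: \<theta>_simps intro!: imageI adjoin.add adjoin.mult)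
      then obtain q where "q \<in> adjoin const3 S" "\<theta> (const3 r * p) = \<theta> q"
        using T(3) by (auto simp: \<theta>_simps \<theta>_gens)
      then have "r \<in> ?I" by (simp add: \<theta>_inject)
      then show "\<exists>r\<in>?I. r \<notin> M" using T(2) by blast
    qed
    then show "p \<in> adjoin const3 S" by (simp add: const3_simps)
  qed
qed

lemma chart_avoiding:
  assumes "maximal_ideal M"
  obtains u v t where "chart u v t" "t \<notin> M"
proof -
  obtain t1 t2 where t: "t1 + t2 = 1" "t1 \<noteq> 0 \<Longrightarrow> chart x (to_fract a) t1" "t2 \<noteq> 0 \<Longrightarrow> chart y (to_fract b) t2"
    by (rule two_charts) blast
  note Mp = prime_idealD[OF maximal_ideal_prime[OF assms]]
  have "t1 \<notin> M \<or> t2 \<notin> M" using t(1) Mp(2) ideal.subspace_add[OF Mp(1), of t1 t2] by auto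
  then show ?thesis using t(2,3) ideal.subspace_0[OF Mp(1)] that by metis
qed

lemma some_chart:
  obtains u v t where "chart u v t"
proof -
  obtain t1 t2 where t: "t1 + t2 = 1" "t1 \<noteq> 0 \<Longrightarrow> chart x (to_fract a) t1" "t2 \<noteq> 0 \<Longrightarrow> chart y (to_fract b) t2"
    by (rule two_charts) blast
  have "t1 \<noteq> 0 \<or> t2 \<noteq> 0" using t(1) by auto
  then show ?thesis using t(2,3) that by blast
qed

text \<open>
  Take for h a common divisor of f and the coefficients of g of largest degree.
\<close>

lemma reduced_integral_exists:
  assumes "f \<noteq> 0"
  obtains h \<phi> \<Gamma> where "f = h * \<phi>" "g = smult h (pderiv \<Gamma>)" "coeff \<Gamma> 0 = 0"
    "\<And>\<pi>. \<pi> dvd \<phi> \<Longrightarrow> (\<And>i. \<pi> dvd coeff \<Gamma> i) \<Longrightarrow> \<pi> dvd 1"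
proof -
  let ?P = "\<lambda>h. h dvd f \<and> [:h:] dvd g"
  have "\<exists>h. ?P h \<and> (\<forall>h'. ?P h' \<longrightarrow> degree h' \<le> degree h)"
    by (rule ex_has_greatest_nat[where k = 1 and b = "Suc (degree f)"])
      (use assms dvd_imp_degree_le in \<open>auto simp: less_Suc_eq_le simp flip: one_pCons\<close>)
  then obtain h where h: "h dvd f" "[:h:] dvd g" "\<And>h'. h' dvd f \<Longrightarrow> [:h':] dvd g \<Longrightarrow> degree h' \<le> degree h"
    by blast
  obtain \<phi> where \<phi>: "f = h * \<phi>" using h(1) by (auto elim: dvdE)
  obtain g' where g': "g = smult h g'" using h(2) by (auto elim: dvdE)
  obtain \<Gamma> where \<Gamma>: "pderiv \<Gamma> = g'" "coeff \<Gamma> 0 = 0" by (rule antiderivative_exists[OF nat_units_poly[OF nu_fract]])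
  show ?thesis
  proof (rule that[OF \<phi> _ \<Gamma>(2)])
    show "g = smult h (pderiv \<Gamma>)" using g' \<Gamma> by simp
    fix \<pi> assume \<pi>: "\<pi> dvd \<phi>" "\<And>i. \<pi> dvd coeff \<Gamma> i"
    have nz: "h \<noteq> 0" "\<pi> \<noteq> 0" using assms \<phi> \<pi>(1) by auto
    have "[:\<pi>:] dvd g'" unfolding const_poly_dvd_iff \<Gamma>(1)[symmetric] coeff_pderiv using \<pi>(2) by simp
    then have "[:h * \<pi>:] dvd g"
      unfolding g' const_poly_dvd_iff by (simp add: mult_dvd_mono)
    moreover have "h * \<pi> dvd f" unfolding \<phi> using \<pi>(1) by (simp add: mult_dvd_mono)
    ultimately have "degree (h * \<pi>) \<le> degree h" using h(3) by blast
    then have "degree \<pi> = 0" using nz by (simp add: degree_mult_eq)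
    then show "\<pi> dvd 1" using nz(2) by (metis is_unit_iff_degree)
  qed
qed

text \<open>
  Scaling preserves the shape of a polynomial, so an integral multiple of \<phi> Z - \<Gamma> is again of
  this form over R.
\<close>

lemma lift_first_integral:
  assumes uv: "u \<noteq> 0" "v \<noteq> 0" and \<Omega>: "scale3 u v \<Omega> = [:A, [:B:]:]" "coeff A 0 = 0"
  obtains \<Gamma> \<phi> where "\<Omega> = [:- \<Gamma>, [:\<phi>:]:]" "coeff \<Gamma> 0 = 0"
proof -
  have 0: "coeff (coeff (coeff \<Omega> k) j) i = 0"
    if "coeff (coeff (coeff [:A, [:B:]:] k) j) i = 0" for i j k
    using that uv unfolding \<Omega>(1)[symmetric] coeff_scale3 by simp
  define \<Gamma> where "\<Gamma> = - coeff \<Omega> 0"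
  define \<phi> where "\<phi> = coeff (coeff \<Omega> 1) 0"
  have "\<Omega> = [:- \<Gamma>, [:\<phi>:]:]"
  proof (rule poly3_eqI)
    fix i j k
    show "coeff (coeff (coeff \<Omega> k) j) i = coeff (coeff (coeff [:- \<Gamma>, [:\<phi>:]:] k) j) i"
      using 0[of k j i] by (auto simp: coeff_pCons \<Gamma>_def \<phi>_def split: nat.splits)
  qed
  moreover have "coeff \<Gamma> 0 = 0"
    using 0[of 0 0] \<Omega>(2) by (auto simp: \<Gamma>_def intro!: poly_eqI)
  ultimately show ?thesis by (rule that)
qed

text \<open>
  Clear the denominators of W = \<phi> Z - \<Gamma> in the chart, and divide by a local greatest common divisor
  of the coefficients.
\<close>

lemma primitive_multiple:
  assumes M: "maximal_ideal M" and ch: "chart u v t"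
    and W0: "[:- \<Gamma>, [:\<phi>:]:] \<noteq> 0" and \<Gamma>0: "coeff \<Gamma> 0 = 0"
  obtains q \<Gamma>' \<phi>' where "q \<noteq> 0" "const3 q * [:- \<Gamma>, [:\<phi>:]:] = scale3 u v [:- \<Gamma>', [:\<phi>':]:]"
    "coeff \<Gamma>' 0 = 0" "\<phi>' \<notin> poly_ideal M \<or> (\<exists>i. coeff \<Gamma>' i \<notin> poly_ideal M)"
proof -
  define W where "W = [:- \<Gamma>, [:\<phi>:]:]"
  have uv: "u \<noteq> 0" "v \<noteq> 0" using chart_nonzero[OF ch] by auto
  obtain d \<Omega>0 where d: "d \<noteq> 0" "scalar d * W = scale3 u v \<Omega>0"
    by (rule scale3_clear_denominators[OF uv])
  have "\<Omega>0 \<noteq> 0" using d W0[folded W_def] by auto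
  then obtain k0 j0 i0 where nz: "coeff (coeff (coeff \<Omega>0 k0) j0) i0 \<noteq> 0" using poly3_eqI[of \<Omega>0 0] by auto
  let ?C = "{coeff (coeff (coeff \<Omega>0 k) j) i | i j k. True}"
  have Cs: "coeff (coeff (coeff \<Omega>0 k) j) i \<in> ?C" for i j k by blast
  obtain e c z w where e: "e \<noteq> 0" "\<And>a. a \<in> ?C \<Longrightarrow> e dvd c * a" "z \<in> ?C" "c * z = e * w" "w \<notin> M"
    by (rule dedekind_locally_principal[OF ded Cs nz M]) blast
  have "const3 e dvd const3 c * \<Omega>0"
    unfolding const3_def const_poly_dvd_iff using e(2)[OF Cs] by (simp add: const_poly_dvd_iff)
  then obtain \<Omega> where \<Omega>: "const3 c * \<Omega>0 = const3 e * \<Omega>" by (auto elim: dvdE)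
  have cC: "c * coeff (coeff (coeff \<Omega>0 k) j) i = e * coeff (coeff (coeff \<Omega> k) j) i" for i j k
    using \<Omega> by (metis coeff_const3_mult)
  obtain i1 j1 k1 where "z = coeff (coeff (coeff \<Omega>0 k1) j1) i1" using e(3) by blast
  then have notM: "coeff (coeff (coeff \<Omega> k1) j1) i1 \<notin> M" using e(1,4,5) cC[of k1 j1 i1] by auto
  \<comment> \<open>the multiple of \<open>W\<close> that is integral in the chart and nonzero modulo \<open>M\<close>\<close>
  define q where "q = to_fract (c * d) / to_fract e"
  have qW: "const3 q * W = scale3 u v \<Omega>"
  proof -
    have "scalar e * scale3 u v \<Omega> = scale3 u v (const3 c * \<Omega>0)"
      unfolding \<Omega> by (simp add: scale3_simps scale3_gens)
    also have "\<dots> = scalar c * (scalar d * W)"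
      by (simp add: scale3_simps scale3_gens d(2))
    also have "\<dots> = const3 (to_fract c * to_fract d) * W" by (simp add: const3_simps)
    also have "to_fract c * to_fract d = to_fract e * q" using e(1) by (simp add: q_def)
    also have "const3 (to_fract e * q) * W = scalar e * (const3 q * W)" by (simp add: const3_simps)
    finally have "scalar e * (scale3 u v \<Omega> - const3 q * W) = 0" by (simp add: right_diff_distrib)
    then show ?thesis using e(1) by simp
  qed
  have "scale3 u v \<Omega> = [:- smult [:q:] \<Gamma>, [:[:q:] * \<phi>:]:]"
    unfolding qW[symmetric] by (simp add: const3_def W_def)
  then obtain \<Gamma>' \<phi>' where \<Omega>': "\<Omega> = [:- \<Gamma>', [:\<phi>':]:]" "coeff \<Gamma>' 0 = 0"
    using lift_first_integral[OF uv] \<Gamma>0 by (metis coeff_minus coeff_smult mult_zero_right neg_equal_0_iff_equal)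
  have nt: "\<phi>' \<notin> poly_ideal M \<or> (\<exists>i. coeff \<Gamma>' i \<notin> poly_ideal M)"
  proof (rule ccontr)
    assume *: "\<not> ?thesis"
    note M0 = ideal.subspace_0[OF prime_idealD(1)[OF maximal_ideal_prime[OF M]]]
    note Mn = ideal.subspace_neg[OF prime_idealD(1)[OF maximal_ideal_prime[OF M]]]
    have "coeff \<phi>' i \<in> M" "coeff (coeff \<Gamma>' j) i \<in> M" for i j using * by (auto simp: poly_ideal_def)
    then have "coeff (coeff (coeff \<Omega> k1) j1) i1 \<in> M"
      using M0 Mn by (auto simp: \<Omega>'(1) coeff_pCons split: nat.splits)
    then show False using notM by simp
  qed
  have q0: "q \<noteq> 0"
  proof
    assume "q = 0"
    then have "\<Omega> = 0" using qW scale3_inject[OF uv, of \<Omega> 0] by (simp add: const3_simps)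
    then show False using notM ideal.subspace_0[OF prime_idealD(1)[OF maximal_ideal_prime[OF M]]] by simp
  qed
  show ?thesis by (rule that[OF q0 qW[unfolded W_def \<Omega>'(1)] \<Omega>'(2) nt])
qed

lemma scaled_ideal:
  assumes "d \<noteq> 0" "F \<noteq> 0"
  obtains "ideal.subspace {r. const3 (to_fract r / to_fract d) * F \<in> range \<theta>}"
    and "\<exists>r. r \<noteq> 0 \<and> const3 (to_fract r / to_fract d) * F \<in> range \<theta>"
proof
  let ?J = "{r. const3 (to_fract r / to_fract d) * F \<in> range \<theta>}"
  show "ideal.subspace ?J" unfolding subspace_iff
  proof (intro conjI ballI allI)
    show "0 \<in> ?J" using range_\<theta>_closed(4)[of 0] by (simp add: const3_simps)
  next
    fix r s assume "r \<in> ?J" "s \<in> ?J"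
    then show "r + s \<in> ?J"
      using range_\<theta>_closed(1) by (simp add: const3_simps add_divide_distrib distrib_right)
  next
    fix c r assume "r \<in> ?J"
    moreover have "const3 (to_fract (c * r) / to_fract d) * F
        = scalar c * (const3 (to_fract r / to_fract d) * F)"
      by (simp add: mult.assoc[symmetric] flip: const3_simps(3))
    ultimately show "c * r \<in> ?J" unfolding mem_Collect_eq using range_\<theta>_closed(3,4) by metis
  qed
  obtain u v t where ch: "chart u v t" by (rule some_chart)
  then have uv: "u \<noteq> 0" "v \<noteq> 0" using chart_nonzero by auto
  obtain d' G where d': "d' \<noteq> 0" "scalar d' * F = scale3 u v G"
    by (rule scale3_clear_denominators[OF uv])
  have "to_fract (d' * d) / to_fract d = to_fract d'" using assms(1) by simp
  then have "const3 (to_fract (d' * d) / to_fract d) * F \<in> range \<theta>"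
    using d'(2) range_scale3_subset[OF ch] by simp
  moreover have "d' * d \<noteq> 0" using d'(1) assms(1) by simp
  ultimately show "\<exists>r. r \<noteq> 0 \<and> const3 (to_fract r / to_fract d) * F \<in> range \<theta>" by blast
qed

text \<open>
  The scalars c with c U, respectively c W, in the range of \<theta> form fractional ideals; multiplication by
  d1 and d2 turns them into the ideals ?J and ?I. Three generators of ?J \<oplus> ?I give the three
  generators of the kernel, because locally at every maximal ideal the kernel is generated by
  one integral multiple of U and one of W.
\<close>

theorem kernel_three_generators:
  assumes f0: "f \<noteq> 0"
  shows "\<exists>S. finite S \<and> card S \<le> 3 \<and> adjoin const3 S = Ker D"
proof -
  obtain h \<phi> \<Gamma> where h: "f = h * \<phi>" "g = smult h (pderiv \<Gamma>)" "coeff \<Gamma> 0 = 0"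
    "\<And>\<pi>. \<pi> dvd \<phi> \<Longrightarrow> (\<And>i. \<pi> dvd coeff \<Gamma> i) \<Longrightarrow> \<pi> dvd 1"
    by (rule reduced_integral_exists[OF f0]) blast
  define W where "W = [:- \<Gamma>, [:\<phi>:]:]"
  have W0: "W \<noteq> 0" using f0 h(1) by (auto simp: W_def)
  have W: "tri f g W = 0" unfolding W_def by (rule first_integral[OF h(1,2)])
  have X0: "(var_X :: 'a fract poly3) \<noteq> 0" by (simp add: var_X_def)
  obtain d1 where d1: "d1 \<noteq> 0" "\<And>c. const3 c * var_X \<in> range \<theta> \<Longrightarrow> to_fract d1 * c \<in> range to_fract"
    by (rule bounded_denominators[OF X0]) blast
  obtain d2 where d2: "d2 \<noteq> 0" "\<And>c. const3 c * W \<in> range \<theta> \<Longrightarrow> to_fract d2 * c \<in> range to_fract"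
    by (rule bounded_denominators[OF W0]) blast
  let ?J = "{r. const3 (to_fract r / to_fract d1) * var_X \<in> range \<theta>}"
  let ?I = "{r. const3 (to_fract r / to_fract d2) * W \<in> range \<theta>}"
  obtain J: "ideal.subspace ?J" and Jn: "\<exists>r. r \<noteq> 0 \<and> const3 (to_fract r / to_fract d1) * var_X \<in> range \<theta>"
    by (rule scaled_ideal[OF d1(1) X0])
  obtain I: "ideal.subspace ?I" and In: "\<exists>r. r \<noteq> 0 \<and> const3 (to_fract r / to_fract d2) * W \<in> range \<theta>"
    by (rule scaled_ideal[OF d2(1) W0])
  obtain j where j: "j \<in> ?J" "j \<noteq> 0" using Jn by blast
  obtain i where i: "i \<in> ?I" "i \<noteq> 0" using In by blast
  obtain \<alpha>1 \<beta>1 \<alpha>2 \<beta>2 \<alpha>3 \<beta>3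
    where \<alpha>: "\<alpha>1 \<in> ?J" "\<alpha>2 \<in> ?J" "\<alpha>3 \<in> ?J" and \<beta>: "\<beta>1 \<in> ?I" "\<beta>2 \<in> ?I" "\<beta>3 \<in> ?I"
    and gen: "\<And>x y. x \<in> ?J \<Longrightarrow> y \<in> ?I \<Longrightarrow>
       \<exists>r1 r2 r3. x = r1 * \<alpha>1 + r2 * \<alpha>2 + r3 * \<alpha>3 \<and> y = r1 * \<beta>1 + r2 * \<beta>2 + r3 * \<beta>3"
    by (rule dedekind_three_generators[OF ded I i J j]) (rule that; assumption)
  define E where "E r s = const3 (to_fract r / to_fract d1) * var_X + const3 (to_fract s / to_fract d2) * W" for r s
  have E: "\<exists>p. \<theta> p = E r s \<and> D p = 0" if "r \<in> ?J" "s \<in> ?I" for r s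
  proof -
    have "E r s \<in> range \<theta>" unfolding E_def using that range_\<theta>_closed(1) by simp
    then obtain p where p: "\<theta> p = E r s" by auto
    have "D p = 0" unfolding D_eq_0_iff p unfolding E_def tri_add tri_const3_mult(1) unfolding tri_const3_mult(3)
      by (simp add: W)
    then show ?thesis using p by blast
  qed
  obtain p1 p2 p3 where p: "\<theta> p1 = E \<alpha>1 \<beta>1" "D p1 = 0" "\<theta> p2 = E \<alpha>2 \<beta>2" "D p2 = 0" "\<theta> p3 = E \<alpha>3 \<beta>3" "D p3 = 0"
    using E \<alpha> \<beta> by metis
  let ?S = "{p1, p2, p3}"
  have span: "E r s \<in> \<theta> ` adjoin const3 ?S" if rs: "r \<in> ?J" "s \<in> ?I" for r s
  proof -
    obtain r1 r2 r3 where *: "r = r1 * \<alpha>1 + r2 * \<alpha>2 + r3 * \<alpha>3" "s = r1 * \<beta>1 + r2 * \<beta>2 + r3 * \<beta>3"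
      using gen[OF rs] by blast
    have distrib: "(k1 * A1 + k2 * A2 + k3 * A3) * X + (k1 * B1 + k2 * B2 + k3 * B3) * Y
        = k1 * (A1 * X + B1 * Y) + k2 * (A2 * X + B2 * Y) + k3 * (A3 * X + B3 * Y)"
      for k1 k2 k3 A1 A2 A3 B1 B2 B3 X Y :: "'a fract poly3"
      by (simp only: distrib_left distrib_right mult.assoc add_ac)
    have q: "const3 (to_fract (k * \<alpha>) / to_fract d) = scalar k * const3 (to_fract \<alpha> / to_fract d)" for k \<alpha> d
      by (simp flip: const3_simps(3))
    have "E r s = scalar r1 * E \<alpha>1 \<beta>1 + scalar r2 * E \<alpha>2 \<beta>2 + scalar r3 * E \<alpha>3 \<beta>3"
      unfolding E_def *(1) *(2) to_fract_add add_divide_distrib const3_simps(2) q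
      by (rule distrib)
    also have "\<dots> = \<theta> (const3 r1 * p1 + const3 r2 * p2 + const3 r3 * p3)"
      by (simp add: \<theta>_simps \<theta>_gens p)
    finally have "E r s = \<theta> (const3 r1 * p1 + const3 r2 * p2 + const3 r3 * p3)" .
    moreover have gens: "p1 \<in> adjoin const3 ?S" "p2 \<in> adjoin const3 ?S" "p3 \<in> adjoin const3 ?S"
      by (rule adjoin.gen, simp)+
    have "const3 r1 * p1 + const3 r2 * p2 + const3 r3 * p3 \<in> adjoin const3 ?S"
      by (rule adjoin.add[OF adjoin.add[OF adjoin.mult[OF adjoin.const gens(1)] adjoin.mult[OF adjoin.const gens(2)]]
            adjoin.mult[OF adjoin.const gens(3)]])
    ultimately show ?thesis by (rule image_eqI)
  qed
  have span_X: "const3 c * var_X \<in> \<theta> ` adjoin const3 ?S" if rng: "const3 c * var_X \<in> range \<theta>" for c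
  proof -
    obtain r where r: "to_fract d1 * c = to_fract r" using d1(2)[OF rng] by blast
    then have c: "c = to_fract r / to_fract d1" using d1(1) by (simp add: field_simps)
    then have "E r 0 = const3 c * var_X" by (simp add: E_def const3_simps)
    moreover have "r \<in> ?J" using rng c by simp
    moreover have "0 \<in> ?I" by (rule ideal.subspace_0[OF I])
    ultimately show ?thesis using span by metis
  qed
  have span_W: "const3 c * W \<in> \<theta> ` adjoin const3 ?S" if rng: "const3 c * W \<in> range \<theta>" for c
  proof -
    obtain r where r: "to_fract d2 * c = to_fract r" using d2(2)[OF rng] by blast
    then have c: "c = to_fract r / to_fract d2" using d2(1) by (simp add: field_simps)
    then have "E 0 r = const3 c * W" by (simp add: E_def const3_simps)
    moreover have "r \<in> ?I" using rng c by simp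
    moreover have "0 \<in> ?J" by (rule ideal.subspace_0[OF J])
    ultimately show ?thesis using span by metis
  qed
  have "adjoin const3 ?S = Ker D"
  proof (rule kernel_eq_adjoinI)
    show "?S \<subseteq> Ker D" using p by (simp add: Ker_def)
    fix M :: "'a set" and p assume M: "maximal_ideal M" and "D p = 0"
    obtain Q where Q: "\<theta> p = eval_in W Q"
      unfolding W_def by (rule kernel_eval_in[OF f0 h \<open>D p = 0\<close>])
    obtain u v t where ch: "chart u v t" and t: "t \<notin> M" by (rule chart_avoiding[OF M])
    obtain q \<Gamma>' \<phi>' where q0: "q \<noteq> 0" and qW: "const3 q * W = scale3 u v [:- \<Gamma>', [:\<phi>':]:]"
      and \<Gamma>': "coeff \<Gamma>' 0 = 0" and nt: "\<phi>' \<notin> poly_ideal M \<or> (\<exists>i. coeff \<Gamma>' i \<notin> poly_ideal M)"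
      unfolding W_def by (rule primitive_multiple[OF M ch W0[unfolded W_def] h(3)])
    define \<Omega> where "\<Omega> = [:- \<Gamma>', [:\<phi>':]:]"
    note qW = qW[folded \<Omega>_def]
    have "\<theta> p = eval_in (scale3 u v \<Omega>) (pcompose Q [:0, [:1 / q:]:])"
      unfolding qW[symmetric] Q by (rule eval_in_rescale[OF q0, symmetric])
    then obtain r where r: "r \<notin> M"
      "scalar r * \<theta> p \<in> adjoin scalar {const3 u * var_X, scale3 u v \<Omega>}"
      using local_generation[OF ded M ch t \<Omega>_def \<Gamma>' nt] by blast
    moreover have "{const3 u * var_X, scale3 u v \<Omega>} \<subseteq> \<theta> ` adjoin const3 ?S"
      using span_X[OF chart_in_range(1)[OF ch]] span_W[of q] qW range_scale3_subset[OF ch] by simp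
    ultimately show "\<exists>T r. T \<subseteq> \<theta> ` adjoin const3 ?S \<and> r \<notin> M \<and>
        scalar r * \<theta> p \<in> adjoin scalar T" by blast
  qed
  moreover have "finite ?S" "card ?S \<le> 3" by (simp_all add: card_insert_if)
  ultimately show ?thesis by (intro exI[of _ ?S] conjI)
qed

end

section \<open>The fixed-point free case\<close>

lemma derivation_eval:
  fixes D :: "'a::idom poly3 \<Rightarrow> 'a poly3"
  assumes D: "derivation const3 D" and s: "D s = 1" and q: "\<And>i. D (coeff q i) = 0"
  shows "D (poly q s) = poly (pderiv q) s"
  using q
proof (induction q)
  case 0
  then show ?case by (simp add: derivationD[OF D])
next
  case (pCons c q)
  have "D (coeff q i) = 0" for i using pCons.prems[of "Suc i"] by simp
  then have "D (poly q s) = poly (pderiv q) s" by (rule pCons.IH)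
  moreover have "D c = 0" using pCons.prems[of 0] by simp
  ultimately show ?case by (simp add: derivationD[OF D] s pderiv_pCons)
qed

text \<open>
  By induction D F is a polynomial in s over the kernel; its antiderivative in s differs from F by
  a kernel element.
\<close>

lemma slice_generates:
  fixes D :: "'a::idom poly3 \<Rightarrow> 'a poly3"
  assumes nu: "nat_units TYPE('a)" and D: "derivation const3 D" and s: "D s = 1"
    and "(D ^^ n) F = 0"
  shows "\<exists>q. (\<forall>i. D (coeff q i) = 0) \<and> F = poly q s"
  using assms(4)
proof (induction n arbitrary: F)
  case 0
  then show ?case by (intro exI[of _ 0]) (simp add: derivationD[OF D])
next
  case (Suc n)
  have "(D ^^ n) (D F) = 0" using Suc.prems by (simp add: funpow_swap1)
  then obtain q where q: "\<And>i. D (coeff q i) = 0" "D F = poly q s" using Suc.IH by blast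
  have nu3: "nat_units TYPE('a poly3)" by (intro nat_units_poly nu)
  obtain r where r: "pderiv r = q" "coeff r 0 = 0" by (rule antiderivative_exists[OF nu3])
  have "D (coeff r i) = 0" for i
  proof (cases i)
    case 0
    then show ?thesis using r(2) by (simp add: derivationD[OF D])
  next
    case (Suc j)
    have "D (const3 (of_nat (Suc j)) * coeff r (Suc j)) = 0"
      using q(1)[of j] unfolding r(1)[symmetric] coeff_pderiv is_ring_hom_of_nat[OF is_ring_hom_const3] .
    then have "const3 (of_nat (Suc j)) * D (coeff r (Suc j)) = 0"
      unfolding derivationD(4)[OF D] .
    moreover have "const3 (of_nat (Suc j)) \<noteq> (0 :: 'a poly3)"
      unfolding const3_eq_0_iff by (rule nat_units_nonzero[OF nu])
    ultimately show ?thesis using Suc by simp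
  qed
  note dr = this
  have "D (F - poly r s) = 0"
    unfolding derivationD(5)[OF D] derivation_eval[OF D s dr] r(1) q(2) by simp
  then have "D (coeff (r + [:F - poly r s:]) i) = 0" for i
    using dr by (auto simp: derivationD[OF D] coeff_pCons split: nat.splits)
  moreover have "F = poly (r + [:F - poly r s:]) s" by simp
  ultimately show ?case by blast
qed

context adapted_derivation
begin

lemma D_derivation: "D (F + G) = D F + D G" "D (F * G) = F * D G + G * D F"
  "D (const3 r) = 0" "D (const3 r * F) = const3 r * D F"
proof -
  show "D (F + G) = D F + D G" "D (F * G) = F * D G + G * D F"
    by (simp_all add: \<theta>_inject[symmetric] \<theta>_D \<theta>_simps tri_add tri_mult)
  show "D (const3 r) = 0" "D (const3 r * F) = const3 r * D F"
    by (simp_all add: \<theta>_inject[symmetric] \<theta>_D \<theta>_simps \<theta>_gens tri_const3 tri_const3_mult(3))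
qed

lemma D_vars:
  "\<theta> (D var_X) = - (scalar b * [:[:f:]:])"
  "\<theta> (D var_Y) = scalar a * [:[:f:]:]"
  "\<theta> (D var_Z) = [:g:]"
proof -
  show "\<theta> (D var_X) = - (scalar b * [:[:f:]:])"
    unfolding \<theta>_D \<theta>_gens tri_diff tri_const3_mult(1,2) by simp
  show "\<theta> (D var_Y) = scalar a * [:[:f:]:]"
    unfolding \<theta>_D \<theta>_gens tri_add tri_const3_mult(1,2) by simp
  show "\<theta> (D var_Z) = [:g:]"
    unfolding \<theta>_D \<theta>_gens unfolding var_Z_def tri_Z ..
qed

lemma fixed_point_free_unit:
  assumes "fixed_point_free D"
  obtains p q r where "p * D var_X + q * D var_Y + r * D var_Z = 1"
proof -
  let ?I = "ideal.span {D var_X, D var_Y, D var_Z}"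
  have "D F \<in> ?I" for F
  proof (induction F rule: poly3_induct)
    case (const r)
    show ?case unfolding D_derivation by (rule ideal.span_zero)
  next
    case (add F G)
    then show ?case unfolding D_derivation by (rule ideal.span_add)
  next
    case (mult F G)
    then show ?case unfolding D_derivation by (intro ideal.span_add ideal.span_scale)
  qed (auto intro: ideal.span_base)
  then have "ideal.span (range D) \<subseteq> ?I" by (intro ideal.span_minimal ideal.subspace_span) blast
  then have "1 \<in> ?I" using assms unfolding fixed_point_free_def by blast
  then obtain p q r where "1 - p * D var_X - q * D var_Y = r * D var_Z"
    by (auto simp: ideal.span_insert ideal.span_singleton)
  then show ?thesis by (intro that[of p q r]) (simp add: algebra_simps)
qed

text \<open>
  The values of D at X, Y, Z are - b f, \<open>a f\<close>, g and generate the unit ideal. As t a and t b are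
  multiples of v, a power of t is a combination of v f and g with coefficients in the chart.
\<close>

lemma fixed_point_free_chart:
  assumes ch: "chart u v t" and fpf: "fixed_point_free D"
  obtains N \<phi> g0 A B M where
    "scale3 u v [:[:\<phi>:]:] = const3 (to_fract t ^ N) * (const3 v * [:[:f:]:])"
    "scale3 u v [:g0:] = const3 (to_fract t ^ N) * [:g:]"
    "[:\<phi>:] * A + g0 * B = [:[:t:] ^ M:]"
proof -
  have uv: "u \<noteq> 0" "v \<noteq> 0" using chart_nonzero[OF ch] by auto
  obtain ua ub vx vy where c: "u * to_fract a = to_fract ua" "u * to_fract b = to_fract ub"
    "v * x = to_fract vx" "v * y = to_fract vy" using ch by (auto simp: chart_def)
  have t: "to_fract t = u * v" using ch by (simp add: chart_def)
  define T where "T = scalar t"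
  have T: "const3 (to_fract t ^ n) = T ^ n" for n by (simp add: T_def const3_simps)
  have T': "T ^ n = scale3 u v (const3 (t ^ n))" for n
    by (simp add: scale3_gens to_fract_power T)
  define F where "F = const3 v * [:[:f:]:]"
  obtain k where k: "\<theta> k = const3 v * var_Y" using chart_in_range(2)[OF ch] by (metis imageE)
  have "F = \<theta> (D k)" unfolding \<theta>_D k tri_const3_mult(2) F_def ..
  then obtain N1 G1 where 1: "T ^ N1 * F = scale3 u v G1" using chart_clear[OF ch, of "D k"] T by metis
  obtain N2 G2 where 2: "T ^ N2 * [:g:] = scale3 u v G2" using chart_clear[OF ch, of "D var_Z"] T D_vars(3) by metis
  define N where "N = N1 + N2"
  have F: "T ^ N * F = scale3 u v (const3 (t ^ N2) * G1)"
    by (simp add: N_def power_add scale3_simps 1[symmetric] T'[symmetric] algebra_simps)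
  have g: "T ^ N * [:g:] = scale3 u v (const3 (t ^ N1) * G2)"
    by (simp only: N_def power_add scale3_simps 2[symmetric] T'[symmetric] mult.assoc)
  have "scale3 u v (const3 (t ^ N2) * G1) = [:[:smult (to_fract t ^ N * v) f:]:]"
    unfolding F[symmetric] T[symmetric] F_def by (simp add: const3_def mult.commute)
  then obtain \<phi> where \<phi>: "const3 (t ^ N2) * G1 = [:[:\<phi>:]:]" using lift_const(2)[OF uv] by blast
  have "scale3 u v (const3 (t ^ N1) * G2) = [:smult [:to_fract t ^ N:] g:]"
    unfolding g[symmetric] T[symmetric] by (simp add: const3_def)
  then obtain g0 where g0: "const3 (t ^ N1) * G2 = [:g0:]" using lift_const(1)[OF uv] by blast
  obtain p q r where pqr: "p * D var_X + q * D var_Y + r * D var_Z = 1"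
    by (rule fixed_point_free_unit[OF fpf])
  obtain Np P where P: "T ^ Np * \<theta> p = scale3 u v P" using chart_clear[OF ch, of p] T by metis
  obtain Nq Q where Q: "T ^ Nq * \<theta> q = scale3 u v Q" using chart_clear[OF ch, of q] T by metis
  obtain Nr R where R: "T ^ Nr * \<theta> r = scale3 u v R" using chart_clear[OF ch, of r] T by metis
  have Tb: "T * scalar b = scalar ub * const3 v"
    unfolding T_def t c(2)[symmetric] const3_simps by (simp add: ac_simps)
  have Ta: "T * scalar a = scalar ua * const3 v"
    unfolding T_def t c(1)[symmetric] const3_simps by (simp add: ac_simps)
  have "1 = \<theta> p * \<theta> (D var_X) + \<theta> q * \<theta> (D var_Y) + \<theta> r * \<theta> (D var_Z)"
    using arg_cong[OF pqr, of \<theta>] by (simp add: \<theta>_simps)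
  then have one: "1 = - (\<theta> p * (scalar b * [:[:f:]:])) + \<theta> q * (scalar a * [:[:f:]:]) + \<theta> r * [:g:]"
    unfolding D_vars by (simp only: mult_minus_right)
  have ring: "T ^ (N + Np + Nq + Nr + 1)
      = (cua * TR * TP * (TQ * tq) - cub * TR * TQ * (TP * tp)) * (TN * (cv * ff)) + T * TP * TQ * (TR * tr) * (TN * gg)"
    if "TN = T ^ N" "TP = T ^ Np" "TQ = T ^ Nq" "TR = T ^ Nr"
      "T * cb = cub * cv" "T * ca = cua * cv" "1 = - (tp * (cb * ff)) + tq * (ca * ff) + tr * gg"
    for TN TP TQ TR cua cub ca cb cv ff tp tq tr gg :: "'a fract poly3"
  proof -
    have "T ^ (N + Np + Nq + Nr + 1) = TN * TP * TQ * TR * T * (- (tp * (cb * ff)) + tq * (ca * ff) + tr * gg)"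
      unfolding that(7)[symmetric] that(1-4) by (simp add: power_add ac_simps)
    also have "\<dots> = TN * TP * TQ * TR * (- (tp * ((T * cb) * ff)) + tq * ((T * ca) * ff) + T * (tr * gg))"
      by (simp only: distrib_left mult_minus_right ac_simps)
    also have "\<dots> = (cua * TR * TP * (TQ * tq) - cub * TR * TQ * (TP * tp)) * (TN * (cv * ff)) + T * TP * TQ * (TR * tr) * (TN * gg)"
      unfolding that(5,6) by (simp only: distrib_left left_diff_distrib mult_minus_right ac_simps diff_conv_add_uminus)
    finally show ?thesis .
  qed
  define A' where "A' = const3 ua * const3 (t ^ Nr) * const3 (t ^ Np) * Q - const3 ub * const3 (t ^ Nr) * const3 (t ^ Nq) * P"
  define B' where "B' = const3 (t ^ 1) * const3 (t ^ Np) * const3 (t ^ Nq) * R"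
  have "scale3 u v (const3 (t ^ (N + Np + Nq + Nr + 1))) = scale3 u v (A' * [:[:\<phi>:]:] + B' * [:g0:])"
    unfolding T'[symmetric] ring[OF refl refl refl refl Tb Ta one] unfolding F_def[symmetric] F g P Q R \<phi> g0
    by (simp only: A'_def B'_def scale3_simps scale3_gens to_fract_power T power_one_right T_def[symmetric])
  then have "const3 (t ^ (N + Np + Nq + Nr + 1)) = A' * [:[:\<phi>:]:] + B' * [:g0:]"
    by (rule scale3_inject[OF uv])
  then have "coeff (const3 (t ^ (N + Np + Nq + Nr + 1))) 0 = coeff (A' * [:[:\<phi>:]:] + B' * [:g0:]) 0" by simp
  then have "[:\<phi>:] * coeff A' 0 + g0 * coeff B' 0 = [:[:t:] ^ (N + Np + Nq + Nr + 1):]"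
    by (simp only: coeff_add coeff_mult_0 const3_def coeff_pCons_0 poly_const_pow mult.commute)
  moreover have "scale3 u v [:[:\<phi>:]:] = const3 (to_fract t ^ N) * (const3 v * [:[:f:]:])"
    unfolding \<phi>[symmetric] F[symmetric] F_def T ..
  moreover have "scale3 u v [:g0:] = const3 (to_fract t ^ N) * [:g:]"
    unfolding g0[symmetric] g[symmetric] T ..
  ultimately show ?thesis using that by blast
qed

lemma slice_up_to_power:
  assumes f0: "f \<noteq> 0" and ch: "chart u v t" and fpf: "fixed_point_free D"
  obtains s M where "D s = const3 (t ^ M)"
proof -
  have uv: "u \<noteq> 0" "v \<noteq> 0" and t0: "t \<noteq> 0" using chart_nonzero[OF ch] ch by (auto simp: chart_def)
  obtain N \<phi> g0 A B M where *: "scale3 u v [:[:\<phi>:]:] = const3 (to_fract t ^ N) * (const3 v * [:[:f:]:])"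
    "scale3 u v [:g0:] = const3 (to_fract t ^ N) * [:g:]" "[:\<phi>:] * A + g0 * B = [:[:t:] ^ M:]"
    by (rule fixed_point_free_chart[OF ch fpf])
  have "\<phi> \<noteq> 0"
  proof
    assume "\<phi> = 0"
    then have "const3 (to_fract t ^ N) * (const3 v * [:[:f:]:]) = 0" using *(1) by simp
    then show False using t0 uv f0 by simp
  qed
  then obtain s M' where s: "tri \<phi> g0 s = [:[:([:t:] ^ M) ^ M':]:]"
    by (rule tri_slice[OF nat_units_poly[OF nu] _ *(3)])
  then have s': "tri \<phi> g0 s = const3 (t ^ (M * M'))"
    by (simp add: const3_def poly_const_pow flip: power_mult)
  obtain r where r: "scale3 u v s = \<theta> r" using range_scale3_subset[OF ch] by (metis imageE)
  have "\<theta> (D (const3 (t ^ N) * r)) = const3 (to_fract t ^ N) * tri f g (scale3 u v s)"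
    unfolding D_derivation(4) by (simp add: \<theta>_simps \<theta>_gens \<theta>_D r to_fract_power)
  also have "\<dots> = \<theta> (const3 (t ^ (M * M')))"
    unfolding tri_scale3[OF *(1,2)] s' by (simp add: scale3_gens \<theta>_gens)
  finally have "D (const3 (t ^ N) * r) = const3 (t ^ (M * M'))" unfolding \<theta>_inject .
  then show ?thesis by (rule that)
qed

text \<open>
  The elements of R that are values of D form an ideal. It contains powers of the comaximal elements
  t1 = a x and t2 = b y.
\<close>

lemma slice_exists:
  assumes f0: "f \<noteq> 0" and fpf: "fixed_point_free D"
  obtains s where "D s = 1"
proof -
  obtain t1 t2 where t: "t1 + t2 = 1" "t1 \<noteq> 0 \<Longrightarrow> chart x (to_fract a) t1" "t2 \<noteq> 0 \<Longrightarrow> chart y (to_fract b) t2"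
    by (rule two_charts) blast
  let ?I = "{r. \<exists>s. D s = const3 r}"
  have I: "ideal.subspace ?I" unfolding subspace_iff
  proof (intro conjI ballI allI)
    show "0 \<in> ?I" using D_derivation(3)[of 0] by (auto simp: const3_simps)
  next
    fix r r' assume "r \<in> ?I" "r' \<in> ?I"
    then obtain s s' where "D s = const3 r" "D s' = const3 r'" by blast
    then have "D (s + s') = const3 (r + r')" by (simp add: D_derivation const3_simps)
    then show "r + r' \<in> ?I" by blast
  next
    fix c r assume "r \<in> ?I"
    then obtain s where "D s = const3 r" by blast
    then have "D (const3 c * s) = const3 (c * r)" by (simp add: D_derivation const3_simps)
    then show "c * r \<in> ?I" by blast
  qed
  have pow: "\<exists>M. t ^ M \<in> ?I" if ch: "t \<noteq> 0 \<Longrightarrow> chart u v t" for u v t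
  proof (cases "t = 0")
    case True
    then have "t ^ 1 \<in> ?I" using ideal.subspace_0[OF I] by simp
    then show ?thesis by blast
  next
    case False
    obtain s M where "D s = const3 (t ^ M)" by (rule slice_up_to_power[OF f0 ch[OF False] fpf])
    then show ?thesis by blast
  qed
  obtain m n where "t1 ^ m \<in> ?I" "t2 ^ n \<in> ?I" using pow[OF t(2)] pow[OF t(3)] by blast
  then have "1 \<in> ?I" by (rule comaximal_powers[OF I t(1)])
  then show ?thesis using that by (auto simp: const3_simps)
qed

text \<open>
  The local generator \<open>v W\<close> of the kernel over \<open>R[\<ell>\<^sub>1]\<close>, lifted to the chart; its coefficients
  generate the unit ideal away from \<open>t = 0\<close>.
\<close>

lemma lifted_integral:
  assumes ch: "chart u v t" and fpf: "fixed_point_free D" and \<Gamma>: "pderiv \<Gamma> = g" "coeff \<Gamma> 0 = 0"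
  obtains N \<Gamma>0 \<phi> where "scale3 u v [:- \<Gamma>0, [:\<phi>:]:] = const3 (to_fract t ^ N * v) * [:- \<Gamma>, [:f:]:]"
    "coeff \<Gamma>0 0 = 0"
    "\<And>M. maximal_ideal M \<Longrightarrow> t \<notin> M \<Longrightarrow> \<phi> \<notin> poly_ideal M \<or> (\<exists>i. coeff \<Gamma>0 i \<notin> poly_ideal M)"
proof -
  obtain N \<phi> g0 A B k where *: "scale3 u v [:[:\<phi>:]:] = const3 (to_fract t ^ N) * (const3 v * [:[:f:]:])"
    "scale3 u v [:g0:] = const3 (to_fract t ^ N) * [:g:]" "[:\<phi>:] * A + g0 * B = [:[:t:] ^ k:]"
    by (rule fixed_point_free_chart[OF ch fpf])
  obtain \<Gamma>0 where \<Gamma>0: "pderiv \<Gamma>0 = g0" "coeff \<Gamma>0 0 = 0" by (rule antiderivative_exists[OF nat_units_poly[OF nu]])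
  have "scale2 u v \<Gamma>0 = smult [:to_fract t ^ N * v:] \<Gamma>"
  proof (rule pderiv_inject[OF nat_units_poly[OF nu_fract]])
    have "[:scale2 u v g0:] = [:smult [:to_fract t ^ N:] g:]"
      using *(2) by (simp add: scale3_pCons const3_def)
    then show "pderiv (scale2 u v \<Gamma>0) = pderiv (smult [:to_fract t ^ N * v:] \<Gamma>)"
      by (simp add: pderiv_scale2 \<Gamma>0(1) \<Gamma>(1) pderiv_smult mult.commute)
  qed (simp add: coeff_scale2 \<Gamma>0(2) \<Gamma>(2))
  moreover have "scale2 u v [:\<phi>:] = [:smult (to_fract t ^ N * v) f:]"
    using *(1) by (simp add: scale3_pCons const3_def mult.commute)
  ultimately have "scale3 u v [:- \<Gamma>0, [:\<phi>:]:] = const3 (to_fract t ^ N * v) * [:- \<Gamma>, [:f:]:]"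
    by (simp add: scale3_pCons const3_def is_ring_homD[OF scale2_hom])
  moreover have "\<phi> \<notin> poly_ideal M \<or> (\<exists>i. coeff \<Gamma>0 i \<notin> poly_ideal M)" if M: "maximal_ideal M" "t \<notin> M" for M
  proof (rule ccontr)
    assume "\<not> ?thesis"
    then have in_M: "\<phi> \<in> poly_ideal M" "\<And>i. coeff \<Gamma>0 i \<in> poly_ideal M" by auto
    note Mp = maximal_ideal_prime[OF M(1)]
    note MP = poly_ideal_prime[OF Mp]
    note S1 = prime_idealD(1)[OF MP]
    note S2 = poly_ideal_subspace[OF S1]
    have "coeff g0 i \<in> poly_ideal M" for i
      unfolding \<Gamma>0(1)[symmetric] coeff_pderiv by (rule ideal.subspace_scale[OF S1 in_M(2)])
    then have "g0 \<in> poly_ideal (poly_ideal M)" by (simp add: poly_ideal_def[of "poly_ideal M"])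
    moreover have "[:\<phi>:] \<in> poly_ideal (poly_ideal M)" using const_in_poly_ideal[OF S1] in_M(1) by blast
    ultimately have "A * [:\<phi>:] + B * g0 \<in> poly_ideal (poly_ideal M)"
      by (intro ideal.subspace_add[OF S2] ideal.subspace_scale[OF S2])
    then have "[:[:t:] ^ k:] \<in> poly_ideal (poly_ideal M)" using *(3) by (simp only: mult.commute)
    then have "[:t:] ^ k \<in> poly_ideal M" using const_in_poly_ideal[OF S1] by blast
    then have "[:t:] \<in> poly_ideal M" by (rule prime_ideal_power[OF MP])
    then show False using const_in_poly_ideal[OF prime_idealD(1)[OF Mp]] M(2) by blast
  qed
  ultimately show ?thesis using \<Gamma>0(2) that by blast
qed

text \<open>
  In a chart v W is integral up to a power of t, and t a and t b are multiples of v; powers of the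
  two elements t are comaximal.
\<close>

lemma integral_in_range:
  assumes fpf: "fixed_point_free D" and \<Gamma>: "pderiv \<Gamma> = g" "coeff \<Gamma> 0 = 0"
  shows "scalar a * [:- \<Gamma>, [:f:]:] \<in> range \<theta>" "scalar b * [:- \<Gamma>, [:f:]:] \<in> range \<theta>"
proof -
  let ?W = "[:- \<Gamma>, [:f:]:]"
  obtain t1 t2 where t: "t1 + t2 = 1" "t1 \<noteq> 0 \<Longrightarrow> chart x (to_fract a) t1" "t2 \<noteq> 0 \<Longrightarrow> chart y (to_fract b) t2"
    by (rule two_charts) blast
  have main: "scalar c * ?W \<in> range \<theta>"
    if c: "\<And>u v t. chart u v t \<Longrightarrow> u * to_fract c \<in> range to_fract" for c
  proof -
    let ?I = "{r. scalar r * (scalar c * ?W) \<in> range \<theta>}"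
    have I: "ideal.subspace ?I" unfolding subspace_iff
    proof (intro conjI ballI allI)
      show "0 \<in> ?I" using range_\<theta>_closed(4)[of 0] by (simp add: const3_simps)
    next
      fix r r' assume "r \<in> ?I" "r' \<in> ?I"
      then show "r + r' \<in> ?I" using range_\<theta>_closed(1) by (simp only: mem_Collect_eq to_fract_add const3_simps distrib_right)
    next
      fix k r assume "r \<in> ?I"
      then show "k * r \<in> ?I" using range_\<theta>_closed(3,4) by (simp only: mem_Collect_eq to_fract_mult const3_simps mult.assoc)
    qed
    have pow: "\<exists>n. t ^ n \<in> ?I" if ch': "t \<noteq> 0 \<Longrightarrow> chart u v t" for u v t
    proof (cases "t = 0")
      case True
      then have "t ^ 1 \<in> ?I" using ideal.subspace_0[OF I] by simp
      then show ?thesis by blast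
    next
      case False
      note ch = ch'[OF False]
      obtain N \<Gamma>0 \<phi> where *: "scale3 u v [:- \<Gamma>0, [:\<phi>:]:] = const3 (to_fract t ^ N * v) * ?W"
        by (rule lifted_integral[OF ch fpf \<Gamma>])
      obtain k where k: "u * to_fract c = to_fract k" using c[OF ch] by blast
      have "to_fract t = u * v" using ch by (simp add: chart_def)
      then have "to_fract (t ^ Suc N) * to_fract c = to_fract k * (to_fract t ^ N * v)"
        unfolding k[symmetric] by (simp add: to_fract_power)
      then have "scalar (t ^ Suc N) * (scalar c * ?W)
          = scalar k * scale3 u v [:- \<Gamma>0, [:\<phi>:]:]"
        unfolding * by (simp only: mult.assoc[symmetric] const3_simps(3)[symmetric])
      also have "\<dots> \<in> range \<theta>" by (intro range_\<theta>_closed range_scale3_subset[OF ch])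
      finally show ?thesis by blast
    qed
    obtain m n where "t1 ^ m \<in> ?I" "t2 ^ n \<in> ?I" using pow[OF t(2)] pow[OF t(3)] by blast
    then have "1 \<in> ?I" by (rule comaximal_powers[OF I t(1)])
    then show ?thesis by (simp add: const3_simps)
  qed
  show "scalar a * ?W \<in> range \<theta>" by (rule main) (simp add: chart_def)
  show "scalar b * ?W \<in> range \<theta>" by (rule main) (simp add: chart_def)
qed

text \<open>
  The generators p and q correspond to x U - b W and y U + a W. In a chart, u U = u a p + u b q and
  v W = v x q - v y p, and u U, v W generate the kernel locally.
\<close>

lemma kernel_coordinates:
  assumes f0: "f \<noteq> 0" and fpf: "fixed_point_free D"
  obtains p q where "adjoin const3 {p, q} = Ker D"
proof -
  obtain \<Gamma> where \<Gamma>: "pderiv \<Gamma> = g" "coeff \<Gamma> 0 = 0" by (rule antiderivative_exists[OF nat_units_poly[OF nu_fract]])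
  define W where "W = [:- \<Gamma>, [:f:]:]"
  have W: "tri f g W = 0" unfolding W_def using first_integral[of 1 f \<Gamma>] \<Gamma>(1) by simp
  have coprime: "\<pi> dvd 1" if \<pi>: "\<pi> dvd f" "\<And>i. \<pi> dvd coeff \<Gamma> i" for \<pi>
  proof -
    have f: "[:[:\<pi>:]:] dvd [:[:f:]:]" using \<pi>(1) by simp
    have "[:\<pi>:] dvd g" unfolding const_poly_dvd_iff \<Gamma>(1)[symmetric] coeff_pderiv using \<pi>(2) by simp
    then have g: "[:[:\<pi>:]:] dvd [:g:]" by simp
    obtain p q r where pqr: "p * D var_X + q * D var_Y + r * D var_Z = 1"
      by (rule fixed_point_free_unit[OF fpf])
    have "1 = \<theta> p * \<theta> (D var_X) + \<theta> q * \<theta> (D var_Y) + \<theta> r * \<theta> (D var_Z)"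
      using arg_cong[OF pqr, of \<theta>] by (simp add: \<theta>_simps)
    moreover have "[:[:\<pi>:]:] dvd \<theta> p * \<theta> (D var_X) + \<theta> q * \<theta> (D var_Y) + \<theta> r * \<theta> (D var_Z)"
      unfolding D_vars by (intro dvd_add dvd_mult) (simp_all only: dvd_minus_iff dvd_mult[OF f] f g)
    ultimately have "[:[:\<pi>:]:] dvd 1" by simp
    then show ?thesis by (simp only: is_unit_const_poly_iff)
  qed
  have aW: "scalar a * W \<in> range \<theta>" "scalar b * W \<in> range \<theta>"
    unfolding W_def by (rule integral_in_range[OF fpf \<Gamma>])+
  have xU: "const3 c * var_X \<in> range \<theta>" if int: "to_fract a * c \<in> range to_fract" "to_fract b * c \<in> range to_fract" for c
  proof -
    obtain ca cb where c: "to_fract a * c = to_fract ca" "to_fract b * c = to_fract cb" using int by blast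
    have "\<theta> (const3 ca * var_X + const3 cb * var_Y)
        = const3 c * ((scalar a * const3 x + scalar b * const3 y) * var_X)"
      by (simp add: \<theta>_simps \<theta>_gens c[symmetric] const3_simps) (simp add: algebra_simps)
    then show ?thesis unfolding const3_unimodular by (metis mult_1 rangeI)
  qed
  obtain p where p: "\<theta> p = const3 x * var_X - scalar b * W"
    using range_\<theta>_closed(2)[OF xU[OF integral(1,3)] aW(2)] by auto
  obtain q where q: "\<theta> q = const3 y * var_X + scalar a * W"
    using range_\<theta>_closed(1)[OF xU[OF integral(2,4)] aW(1)] by auto
  have "adjoin const3 {p, q} = Ker D"
  proof (rule kernel_eq_adjoinI)
    have "D p = 0" unfolding D_eq_0_iff p tri_diff tri_const3_mult(1) unfolding tri_const3_mult(3) W by simp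
    moreover have "D q = 0" unfolding D_eq_0_iff q tri_add tri_const3_mult(1) unfolding tri_const3_mult(3) W by simp
    ultimately show "{p, q} \<subseteq> Ker D" by (simp add: Ker_def)
    fix M :: "'a set" and F assume M: "maximal_ideal M" and F: "D F = 0"
    obtain Q where Q: "\<theta> F = eval_in W Q"
      unfolding W_def by (rule kernel_eval_in[OF f0, of 1 f \<Gamma>]) (use \<Gamma> coprime F in auto)
    obtain u v t where ch: "chart u v t" and t: "t \<notin> M" by (rule chart_avoiding[OF M])
    have uv: "u \<noteq> 0" "v \<noteq> 0" "t \<noteq> 0" using chart_nonzero[OF ch] ch by (auto simp: chart_def)
    obtain N \<Gamma>0 \<phi> where *: "scale3 u v [:- \<Gamma>0, [:\<phi>:]:] = const3 (to_fract t ^ N * v) * W"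
      "coeff \<Gamma>0 0 = 0" "\<And>M. maximal_ideal M \<Longrightarrow> t \<notin> M \<Longrightarrow> \<phi> \<notin> poly_ideal M \<or> (\<exists>i. coeff \<Gamma>0 i \<notin> poly_ideal M)"
      unfolding W_def by (rule lifted_integral[OF ch fpf \<Gamma>]) blast
    define k where "k = to_fract t ^ N * v"
    have k0: "k \<noteq> 0" using uv by (simp add: k_def)
    let ?\<Omega> = "[:- \<Gamma>0, [:\<phi>:]:]"
    have "\<theta> F = eval_in (scale3 u v ?\<Omega>) (pcompose Q [:0, [:1 / k:]:])"
      unfolding *(1) Q k_def[symmetric] by (rule eval_in_rescale[OF k0, symmetric])
    then obtain r where r: "r \<notin> M"
      "scalar r * \<theta> F \<in> adjoin scalar {const3 u * var_X, scale3 u v ?\<Omega>}"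
      using local_generation[OF ded M ch t refl *(2) *(3)[OF M t]] by blast
    obtain ua ub vx vy where c: "u * to_fract a = to_fract ua" "u * to_fract b = to_fract ub"
      "v * x = to_fract vx" "v * y = to_fract vy" using ch by (auto simp: chart_def)
    have gens: "p \<in> adjoin const3 {p, q}" "q \<in> adjoin const3 {p, q}" by (rule adjoin.gen, simp)+
    have "const3 u * var_X = \<theta> (const3 ua * p + const3 ub * q)"
    proof -
      have "\<theta> (const3 ua * p + const3 ub * q)
          = const3 u * ((scalar a * const3 x + scalar b * const3 y) * var_X)"
        by (simp add: \<theta>_simps \<theta>_gens p q c[symmetric] const3_simps) (simp add: algebra_simps)
      then show ?thesis unfolding const3_unimodular by simp
    qed
    moreover have "const3 ua * p + const3 ub * q \<in> adjoin const3 {p, q}"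
      by (rule adjoin.add[OF adjoin.mult[OF adjoin.const gens(1)] adjoin.mult[OF adjoin.const gens(2)]])
    ultimately have 1: "const3 u * var_X \<in> \<theta> ` adjoin const3 {p, q}" by (rule image_eqI)
    have "scale3 u v ?\<Omega> = \<theta> (const3 (t ^ N) * (const3 vx * q + const3 (- vy) * p))"
    proof -
      have "\<theta> (const3 vx * q + const3 (- vy) * p)
          = const3 v * ((scalar a * const3 x + scalar b * const3 y) * W)"
        by (simp add: \<theta>_simps \<theta>_gens p q c[symmetric] const3_simps) (simp add: algebra_simps)
      then show ?thesis
        unfolding * \<theta>_simps(3) \<theta>_gens const3_unimodular by (simp add: const3_simps to_fract_power mult.assoc)
    qed
    moreover have "const3 (t ^ N) * (const3 vx * q + const3 (- vy) * p) \<in> adjoin const3 {p, q}"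
      by (rule adjoin.mult[OF adjoin.const adjoin.add[OF adjoin.mult[OF adjoin.const gens(2)] adjoin.mult[OF adjoin.const gens(1)]]])
    ultimately have 2: "scale3 u v ?\<Omega> \<in> \<theta> ` adjoin const3 {p, q}" by (rule image_eqI)
    have "{const3 u * var_X, scale3 u v ?\<Omega>} \<subseteq> \<theta> ` adjoin const3 {p, q}" using 1 2 by blast
    then show "\<exists>T r. T \<subseteq> \<theta> ` adjoin const3 {p, q} \<and> r \<notin> M \<and>
        scalar r * \<theta> F \<in> adjoin scalar T" using r by blast
  qed
  then show ?thesis by (rule that)
qed

end

section \<open>Passing to adapted coordinates\<close>

text \<open>
  Dependent forms have a common zero (r, s) \<noteq> (0, 0). Then all elements of K[L1, L2, Z] take the same
  value at (r, s, 0) and at the origin, which fails for X or Y.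
\<close>

lemma linear_forms_independent:
  fixes \<alpha> \<beta> \<gamma> \<delta> :: "'k::field"
  assumes "coordinate_system const3 3 [const3 \<alpha> * var_X + const3 \<beta> * var_Y, const3 \<gamma> * var_X + const3 \<delta> * var_Y, var_Z]"
  shows "\<alpha> * \<delta> \<noteq> \<beta> * \<gamma>"
proof
  assume dep: "\<alpha> * \<delta> = \<beta> * \<gamma>"
  obtain r s where rs: "r \<noteq> 0 \<or> s \<noteq> 0" "\<alpha> * r + \<beta> * s = 0" "\<gamma> * r + \<delta> * s = 0"
  proof -
    consider "\<alpha> \<noteq> 0 \<or> \<beta> \<noteq> 0" | "\<gamma> \<noteq> 0 \<or> \<delta> \<noteq> 0" | "\<alpha> = 0" "\<beta> = 0" "\<gamma> = 0" "\<delta> = 0" by blast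
    then show ?thesis
    proof cases
      case 1
      then show ?thesis using that[of "- \<beta>" \<alpha>] dep by (auto simp: mult.commute)
    next
      case 2
      then show ?thesis using that[of "- \<delta>" \<gamma>] dep by (auto simp: mult.commute)
    next
      case 3
      then show ?thesis using that[of 1 0] by simp
    qed
  qed
  define ev where "ev p q = subst3 (\<lambda>c. c) p q (0::'k)" for p q
  have id: "is_ring_hom (\<lambda>c::'k. c)" by (simp add: is_ring_hom_def)
  note hom = is_ring_homD[OF subst3_hom[OF id]]
  note gens = subst3_gens[OF id]
  have "adjoin const3 {const3 \<alpha> * var_X + const3 \<beta> * var_Y, const3 \<gamma> * var_X + const3 \<delta> * var_Y, var_Z}
      \<subseteq> {F. ev r s F = ev 0 0 F}"
    by (rule adjoin_mono_closed) (simp_all add: ev_def hom gens rs)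
  then have "ev r s F = ev 0 0 F" for F using assms by (auto simp: coordinate_system_def)
  from this[of var_X] this[of var_Y] show False using rs(1) by (simp add: ev_def gens)
qed

text \<open>
  Scale L1 to U = a X + b Y with coefficients in R and split the pair (a, b) by invertibility. The second
  coordinate V = x Y - y X is a combination of L1 and L2, so the extension maps it into K[U] as well.
\<close>

lemma adapted_derivation_exists:
  fixes D :: "'a::idom poly3 \<Rightarrow> 'a poly3" and E :: "'a fract poly3 \<Rightarrow> 'a fract poly3"
  assumes ded: "dedekind_domain TYPE('a)" and nu: "nat_units TYPE('a)"
    and ext: "extends_derivation D E"
    and L: "linear_form_XY L1" "linear_form_XY L2" "coordinate_system const3 3 [L1, L2, var_Z]"
      "E L1 = 0" "E L2 \<in> adjoin const3 {L1}" "E var_Z \<in> adjoin const3 {L1, L2}"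
  obtains a b x y f g where "adapted_derivation a b x y D f g"
proof -
  have E: "derivation const3 E" and ED: "E (fract_poly3 F) = fract_poly3 (D F)" for F
    using ext by (auto simp: extends_derivation_def)
  note ES = derivationD[OF E]
  obtain \<alpha> \<beta> where L1: "L1 = const3 \<alpha> * var_X + const3 \<beta> * var_Y" using L(1) by (auto simp: linear_form_XY_def)
  obtain \<gamma> \<delta> where L2: "L2 = const3 \<gamma> * var_X + const3 \<delta> * var_Y" using L(2) by (auto simp: linear_form_XY_def)
  define \<Delta> where "\<Delta> = \<alpha> * \<delta> - \<beta> * \<gamma>"
  have \<Delta>: "\<Delta> \<noteq> 0" using linear_forms_independent L(3) unfolding L1 L2 \<Delta>_def by auto
  obtain d1 n1 where 1: "d1 \<noteq> 0" "to_fract d1 * \<alpha> = to_fract n1" by (rule fract_denominator)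
  obtain d2 n2 where 2: "d2 \<noteq> 0" "to_fract d2 * \<beta> = to_fract n2" by (rule fract_denominator)
  define d where "d = d1 * d2"
  define a where "a = d2 * n1"
  define b where "b = d1 * n2"
  have d: "d \<noteq> 0" using 1 2 by (simp add: d_def)
  have a: "to_fract a = to_fract d * \<alpha>" by (simp add: a_def d_def 1(2)[symmetric])
  have b: "to_fract b = to_fract d * \<beta>" by (simp add: b_def d_def 2(2)[symmetric])
  have "a \<noteq> 0 \<or> b \<noteq> 0"
  proof (rule ccontr)
    assume "\<not> ?thesis"
    then have "\<alpha> = 0" "\<beta> = 0" using a b d by auto
    then show False using \<Delta> by (simp add: \<Delta>_def)
  qed
  then obtain e c k where e: "e \<noteq> 0" "a * c + b * k = e" "e dvd a * c" "e dvd a * k" "e dvd b * c" "e dvd b * k"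
    by (rule dedekind_split_pair[OF ded])
  define x where "x = to_fract c / to_fract e"
  define y where "y = to_fract k / to_fract e"
  have int: "to_fract r * (to_fract s / to_fract e) \<in> range to_fract" if dv: "e dvd r * s" for r s
  proof -
    obtain m where "r * s = e * m" using dv by (auto elim: dvdE)
    then have "to_fract r * to_fract s = to_fract e * to_fract m" by (simp flip: to_fract_mult)
    then have "to_fract r * (to_fract s / to_fract e) = to_fract m" using e(1) by simp
    then show ?thesis by simp
  qed
  have "to_fract a * x + to_fract b * y = to_fract (a * c + b * k) / to_fract e"
    by (simp add: x_def y_def add_divide_distrib)
  also have "\<dots> = 1" using e(1,2) by simp
  finally have unim: "to_fract a * x + to_fract b * y = 1" .
  interpret A: adapted_coordinates a b x y
    by unfold_locales (use unim int[OF e(3)] int[OF e(4)] int[OF e(5)] int[OF e(6)] in \<open>auto simp: x_def y_def\<close>)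
  note uni = A.const3_unimodular
  define U where "U = scalar a * var_X + scalar b * var_Y"
  define V where "V = const3 x * var_Y - const3 y * var_X"
  have U: "U = scalar d * L1" by (simp add: U_def L1 a b const3_simps distrib_left mult.assoc)
  have EU: "E U = 0" unfolding U ES(4) L(4) by simp
  have V: "V = const3 (- (y * \<delta> + x * \<gamma>) / \<Delta>) * L1 + const3 ((\<alpha> * x + \<beta> * y) / \<Delta>) * L2"
  proof -
    have c1: "- (y * \<delta> + x * \<gamma>) / \<Delta> * \<alpha> + (\<alpha> * x + \<beta> * y) / \<Delta> * \<gamma> = - y"
      using \<Delta> by (simp add: field_simps) (simp add: \<Delta>_def algebra_simps)
    have c2: "- (y * \<delta> + x * \<gamma>) / \<Delta> * \<beta> + (\<alpha> * x + \<beta> * y) / \<Delta> * \<delta> = x"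
      using \<Delta> by (simp add: field_simps) (simp add: \<Delta>_def algebra_simps)
    have lin: "const3 p * L1 + const3 q * L2 = const3 (p * \<alpha> + q * \<gamma>) * var_X + const3 (p * \<beta> + q * \<delta>) * var_Y" for p q
      unfolding L1 L2 const3_simps by (simp add: algebra_simps)
    show ?thesis unfolding lin c1 c2 by (simp add: V_def const3_simps)
  qed
  have X: "var_X = const3 x * U - scalar b * V"
  proof -
    have "const3 x * U - scalar b * V = (scalar a * const3 x + scalar b * const3 y) * var_X"
      by (simp add: U_def V_def algebra_simps)
    then show ?thesis using uni by simp
  qed
  have Y: "var_Y = const3 y * U + scalar a * V"
  proof -
    have "const3 y * U + scalar a * V = (scalar a * const3 x + scalar b * const3 y) * var_Y"
      by (simp add: U_def V_def algebra_simps)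
    then show ?thesis using uni by simp
  qed
  have \<eta>U: "A.\<eta> U = var_X"
  proof -
    have "A.\<eta> U = (scalar a * const3 x + scalar b * const3 y) * var_X"
      by (simp add: U_def A.\<eta>_simps A.\<eta>_gens) (simp add: algebra_simps)
    then show ?thesis using uni by simp
  qed
  have \<eta>L1: "A.\<eta> L1 = const3 (1 / to_fract d) * var_X"
  proof -
    have "const3 (1 / to_fract d) * U = L1" unfolding U mult.assoc[symmetric] const3_simps(3)[symmetric]
      using d by (simp add: const3_simps)
    then show ?thesis using \<eta>U by (metis A.\<eta>_gens(1) A.\<eta>_simps(3))
  qed
  have "adjoin const3 {L1} \<subseteq> {F. \<exists>f. A.\<eta> F = [:[:f:]:]}"
  proof (rule adjoin_mono_closed)
    show "{L1} \<subseteq> {F. \<exists>f. A.\<eta> F = [:[:f:]:]}" using \<eta>L1 by (simp add: const3_def var_X_def)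
    show "const3 r \<in> {F. \<exists>f. A.\<eta> F = [:[:f:]:]}" for r unfolding mem_Collect_eq A.\<eta>_gens by (simp add: const3_def)
  qed (auto simp: A.\<eta>_simps)
  then obtain f0 where f0: "A.\<eta> (E L2) = [:[:f0:]:]" using L(5) by blast
  have "adjoin const3 {L1, L2} \<subseteq> {F. \<exists>g. A.\<eta> F = [:g:]}"
  proof (rule adjoin_mono_closed)
    have "\<exists>g. A.\<eta> (const3 p * var_X + const3 q * var_Y) = [:g:]" for p q
      unfolding A.\<eta>_simps A.\<eta>_gens by (simp add: const3_def var_X_def var_Y_def)
    then show "{L1, L2} \<subseteq> {F. \<exists>g. A.\<eta> F = [:g:]}" using L1 L2 by simp
    show "const3 r \<in> {F. \<exists>g. A.\<eta> F = [:g:]}" for r unfolding mem_Collect_eq A.\<eta>_gens by (simp add: const3_def)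
  qed (auto simp: A.\<eta>_simps)
  then obtain g where g: "A.\<eta> (E var_Z) = [:g:]" using L(6) by blast
  define f where "f = smult ((\<alpha> * x + \<beta> * y) / \<Delta>) f0"
  have EV: "A.\<eta> (E V) = [:[:f:]:]"
    unfolding V ES L(4) A.\<eta>_simps A.\<eta>_gens f0 by (simp add: const3_def f_def A.\<eta>_simps)
  have main: "A.\<eta> (E F) = tri f g (A.\<eta> F)" for F
  proof (rule poly3_derivation_eqI[where h = A.\<eta> and \<delta> = "\<lambda>F. A.\<eta> (E F)" and \<delta>' = "\<lambda>F. tri f g (A.\<eta> F)"])
    show "A.\<eta> (E var_X) = tri f g (A.\<eta> var_X)"
    proof -
      have "A.\<eta> (E var_X) = - (scalar b * [:[:f:]:])"
        by (subst X) (simp only: ES EU A.\<eta>_simps A.\<eta>_gens EV, simp)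
      then show ?thesis unfolding A.\<eta>_gens tri_diff tri_const3_mult(1,2) by simp
    qed
    show "A.\<eta> (E var_Y) = tri f g (A.\<eta> var_Y)"
    proof -
      have "A.\<eta> (E var_Y) = scalar a * [:[:f:]:]"
        by (subst Y) (simp only: ES EU A.\<eta>_simps A.\<eta>_gens EV, simp)
      then show ?thesis unfolding A.\<eta>_gens tri_add tri_const3_mult(1,2) by simp
    qed
    show "A.\<eta> (E var_Z) = tri f g (A.\<eta> var_Z)"
      unfolding g A.\<eta>_gens unfolding var_Z_def tri_Z ..
    show "A.\<eta> (E (const3 r)) = tri f g (A.\<eta> (const3 r))" for r
      unfolding ES A.\<eta>_gens tri_const3 by (simp add: A.\<eta>_simps)
  qed (simp_all add: ES A.\<eta>_simps tri_add tri_mult)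
  have "adapted_derivation a b x y D f g"
  proof unfold_locales
    show "A.\<theta> (D F) = tri f g (A.\<theta> F)" for F
      unfolding A.\<theta>_def ED[symmetric] main ..
  qed (rule ded nu)+
  then show ?thesis by (rule that)
qed

lemma rank_derivation_eq_1:
  assumes s: "D s \<noteq> (0 :: 'a::comm_ring_1 poly3)"
    and coord: "coordinate_system const3 3 [z, p, q]" and ker: "adjoin const3 {p, q} \<subseteq> Ker D"
  shows "rank_derivation const3 3 D = 1"
proof -
  let ?P = "\<lambda>i. \<exists>Xs. coordinate_system const3 3 Xs \<and> adjoin const3 (set (drop i Xs)) \<subseteq> Ker D"
  have "?P 1" using coord ker by (intro exI[of _ "[z, p, q]"]) simp
  moreover have "\<not> ?P 0"
    using s by (auto simp: coordinate_system_def Ker_def)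
  then have "1 \<le> i" if "?P i" for i using that by (cases i) auto
  ultimately show ?thesis unfolding rank_derivation_def by (rule Least_equality)
qed

lemma slice_coordinates:
  fixes D :: "'a::idom poly3 \<Rightarrow> 'a poly3"
  assumes nu: "nat_units TYPE('a)" and D: "derivation const3 D" and nil: "locally_nilpotent D"
    and s: "D s = 1" and ker: "adjoin const3 {p, q} = Ker D"
  shows "coordinate_system const3 3 [s, p, q]"
proof -
  have sub: "adjoin const3 {p, q} \<subseteq> adjoin const3 {s, p, q}"
    by (rule adjoin_mono_closed) (auto intro: adjoin.intros)
  have "F \<in> adjoin const3 {s, p, q}" for F
  proof -
    obtain n where "(D ^^ n) F = 0" using nil by (auto simp: locally_nilpotent_def)
    then obtain Q where Q: "\<And>i. D (coeff Q i) = 0" "F = poly Q s"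
      using slice_generates[OF nu D s] by blast
    have "coeff Q i \<in> adjoin const3 {s, p, q}" for i using Q(1)[of i] sub ker by (auto simp: Ker_def)
    then have "poly Q s \<in> adjoin const3 {s, p, q}"
    proof (induction Q)
      case 0
      show ?case using adjoin.const[of const3 0 "{s, p, q}"] by (simp add: const3_simps)
    next
      case (pCons c Q)
      have "coeff Q i \<in> adjoin const3 {s, p, q}" for i using pCons.prems[of "Suc i"] by simp
      then have 1: "poly Q s \<in> adjoin const3 {s, p, q}" by (rule pCons.IH)
      have 2: "c \<in> adjoin const3 {s, p, q}" using pCons.prems[of 0] by simp
      have 3: "s \<in> adjoin const3 {s, p, q}" by (rule adjoin.gen) simp
      show ?case unfolding poly_pCons by (rule adjoin.add[OF 2 adjoin.mult[OF 3 1]])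
    qed
    then show ?thesis using Q(2) by simp
  qed
  then show ?thesis by (auto simp: coordinate_system_def)
qed

text \<open>
  Here D F is D Z times the partial derivative of F in Z, so irreducibility makes D Z a unit.
\<close>

lemma kernel_if_vars_in_kernel:
  fixes D :: "'a::idom poly3 \<Rightarrow> 'a poly3"
  assumes nu: "nat_units TYPE('a)" and D: "derivation const3 D" and irr: "\<not> reducible_derivation D"
    and X: "D var_X = 0" and Y: "D var_Y = 0"
  shows "adjoin const3 {var_X, var_Y} = Ker D" and "\<exists>s. D s = 1"
proof -
  have D_eq: "D F = pderiv F * D var_Z" for F
  proof (rule poly3_derivation_eqI[where h = "\<lambda>F. F" and \<delta> = D and \<delta>' = "\<lambda>F. pderiv F * D var_Z"])
    show "D (F * G) = F * D G + G * D F" for F G by (rule derivationD(2)[OF D])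
    show "pderiv (F * G) * D var_Z = F * (pderiv G * D var_Z) + G * (pderiv F * D var_Z)" for F G
      by (simp add: pderiv_mult algebra_simps)
    show "D var_Z = pderiv var_Z * D var_Z" by (simp add: var_Z_def pderiv_pCons)
  qed (simp_all add: derivationD[OF D] X Y pderiv_add distrib_right, simp_all add: const3_def var_X_def var_Y_def)
  then have "range D \<subseteq> range (\<lambda>x. D var_Z * x)" 
  proof -
    have "D F \<in> range (\<lambda>x. D var_Z * x)" for F
      using D_eq[of F] by (metis mult.commute rangeI)
    then show ?thesis by blast
  qed
  then have "D var_Z dvd 1" using irr unfolding reducible_derivation_def by blast
  then obtain c where c: "D var_Z = [:c:]" "c dvd 1" by (auto simp: is_unit_poly_iff)
  then obtain c' where c': "1 = c * c'" by (auto elim: dvdE)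
  then have c0: "c \<noteq> 0" by auto
  have "D ([:c':] * var_Z) = 1"
    unfolding D_eq[of "[:c':] * var_Z"] c(1) using c'
    by (simp add: var_Z_def pderiv_pCons mult.commute flip: one_pCons)
  then show "\<exists>s. D s = 1" ..
  have Ker: "Ker D = {F. pderiv F = 0}"
  proof -
    have "D F = 0 \<longleftrightarrow> pderiv F = 0" for F unfolding D_eq[of F] c(1) using c0 by simp
    then show ?thesis by (simp add: Ker_def)
  qed
  have const: "[:coeff F 0:] \<in> adjoin const3 {var_X, var_Y}" for F :: "'a poly3"
  proof (induction F rule: poly3_induct)
    case (const r)
    have "[:coeff (const3 r) 0:] = const3 r" by (simp add: const3_def)
    then show ?case using adjoin.const[of const3 r] by simp
  next
    case X
    show ?case using adjoin.gen[of var_X "{var_X, var_Y}" const3] by (simp add: var_X_def)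
  next
    case Y
    show ?case using adjoin.gen[of var_Y "{var_X, var_Y}" const3] by (simp add: var_Y_def)
  next
    case Z
    show ?case using adjoin.const[of const3 0 "{var_X, var_Y}"] by (simp add: const3_simps var_Z_def)
  next
    case (add F G)
    have "[:coeff (F + G) 0:] = [:coeff F 0:] + [:coeff G 0:]" by simp
    then show ?case using adjoin.add[OF add] by simp
  next
    case (mult F G)
    have "[:coeff (F * G) 0:] = [:coeff F 0:] * [:coeff G 0:]" by (simp add: coeff_mult_0)
    then show ?case using adjoin.mult[OF mult] by simp
  qed
  show "adjoin const3 {var_X, var_Y} = Ker D"
  proof
    show "adjoin const3 {var_X, var_Y} \<subseteq> Ker D"
      by (rule adjoin_mono_closed) (auto simp: Ker_def derivationD[OF D] X Y)
    show "Ker D \<subseteq> adjoin const3 {var_X, var_Y}"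
    proof
      fix F assume "F \<in> Ker D"
      then have "pderiv F = 0" by (simp add: Ker)
      then have "F = [:coeff F 0:]" by (rule pderiv_eq_0_imp_const[OF nat_units_poly[OF nat_units_poly[OF nu]]])
      then show "F \<in> adjoin const3 {var_X, var_Y}" using const[of F] by simp
    qed
  qed
qed

theorem proposition4p6:
  fixes D :: "'a::idom poly3 \<Rightarrow> 'a poly3"
    and Dbar :: "'a fract poly3 \<Rightarrow> 'a fract poly3"
  assumes "dedekind_domain TYPE('a)"
    and "contains_rationals TYPE('a)"
    and "derivation const3 D"
    and "locally_nilpotent D"
    and "\<not> reducible_derivation D"
    and "(D ^^ 2) var_X = 0" and "(D ^^ 2) var_Y = 0"
    and "extends_derivation D Dbar"
    and "\<exists>L1 L2. linear_form_XY L1 \<and> linear_form_XY L2 \<and>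
           coordinate_system const3 3 [L1, L2, var_Z] \<and>
           Dbar L1 = 0 \<and>
           Dbar L2 \<in> adjoin const3 {L1} \<and>
           Dbar var_Z \<in> adjoin const3 {L1, L2}"
  shows "(\<exists>S. finite S \<and> card S \<le> 3 \<and> adjoin const3 S = Ker D) \<and>
    (fixed_point_free D \<longrightarrow>
      rank_derivation const3 3 D < 3 \<and> (\<exists>s. slice D s) \<and> rank_derivation const3 3 D = 1)"
proof -
  have nu: "nat_units TYPE('a)" by (rule nat_units_if_contains_rationals[OF assms(2)])
  note D = assms(3)
  have slice_case: "rank_derivation const3 3 D < 3 \<and> (\<exists>s. slice D s) \<and> rank_derivation const3 3 D = 1"
    if s: "D s = 1" and ker: "adjoin const3 {p, q} = Ker D" for s p q
  proof -
    have "rank_derivation const3 3 D = 1"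
      by (rule rank_derivation_eq_1[where s = s, OF _ slice_coordinates[OF nu D assms(4) s ker]]) (simp_all add: s ker)
    then show ?thesis using s by (auto simp: slice_def)
  qed
  obtain L1 L2 where L: "linear_form_XY L1" "linear_form_XY L2" "coordinate_system const3 3 [L1, L2, var_Z]"
    "Dbar L1 = 0" "Dbar L2 \<in> adjoin const3 {L1}" "Dbar var_Z \<in> adjoin const3 {L1, L2}"
    using assms(9) by blast
  obtain a b x y f g where "adapted_derivation a b x y D f g"
    by (rule adapted_derivation_exists[OF assms(1) nu assms(8) L])
  then interpret adapted_derivation a b x y D f g .
  show ?thesis
  proof (cases "f = 0")
    case True
    have "\<theta> (D var_X) = \<theta> 0" "\<theta> (D var_Y) = \<theta> 0" unfolding D_vars True by (simp_all add: \<theta>_simps)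
    then have XY: "D var_X = 0" "D var_Y = 0" unfolding \<theta>_inject by simp_all
    note ker = kernel_if_vars_in_kernel[OF nu D assms(5) XY]
    have "finite {var_X :: 'a poly3, var_Y}" "card {var_X :: 'a poly3, var_Y} \<le> 3"
      by (simp_all add: card_insert_if)
    then show ?thesis using ker slice_case by blast
  next
    case False
    have "rank_derivation const3 3 D < 3 \<and> (\<exists>s. slice D s) \<and> rank_derivation const3 3 D = 1"
      if fpf: "fixed_point_free D"
    proof -
      obtain s where "D s = 1" by (rule slice_exists[OF False fpf])
      moreover obtain p q where "adjoin const3 {p, q} = Ker D" by (rule kernel_coordinates[OF False fpf])
      ultimately show ?thesis by (rule slice_case)
    qed
    then show ?thesis using kernel_three_generators[OF False] by blast
  qed
qed

end
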